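(* Let $n\geq 4$ be even, $G_0=SO_0(2n-1,1)$, $\mathfrak{g}_0=\mathfrak{so}(2n-1,1)$, $\mathfrak{g}=\mathfrak{so}_{2n}(\mathbb C)=\mathfrak{g}_0\otimes_{\mathbb R}\mathbb C$. With the elements $H_k, X_{jk},Y_{jk},Z_{jk}\in\mathfrak{g}$ defined in the context, put $L=\bigoplus_{k=2}^{n-2}\mathbb C H_k\oplus \mathbb C (H_{n-1}+H_n)$ and let $\mathfrak{s}\subset\mathfrak{g}$ be the complex subalgebra $$\mathfrak{s}=L\oplus \mathbb C (H_1+X_{n-1,n})\oplus \bigoplus_{\substack{1\leq j<k\leq n \\ (j,k)\neq (n-1,n)}} \mathbb C X_{jk}\oplus \bigoplus_{1\leq j<k\leq n} \mathbb C Y_{jk}\oplus \mathbb C Z_{n-1,n}.$$ Let $\omega\in\bigwedge^2\mathfrak{s}^{*}$ be a closed $2$-form such that $$\omega|_{\mathfrak{s}\cap\mathfrak{g}_0}=\sqrt{-1}\cdot\sum_{j=1}^{\frac n2-1}\epsilon_{2j-1}\wedge\epsilon_{2j}.$$ Then $(\mathfrak{s},\omega)$ is a $\mathfrak{g}_0$-admissible pair and defines a non-regular invariant generalized complex structure on $SO_0(2n-1,1)$.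
   Context: **Matrices.** $\mathfrak{g}=\mathfrak{so}_{2n}(\mathbb C)$ is the Lie algebra of $2n\times 2n$ skew-symmetric complex matrices. Let $J=\operatorname{diag}(1,\ldots,1,-1)$ (with $2n-1$ ones) and $\tau:\mathfrak{g}\to\mathfrak{g}$, $\tau(A)=J\bar A J$ (bar is entrywise complex conjugation). Then $\mathfrak{g}_0=\mathfrak{so}(2n-1,1)$ is realized as the fixed-point set of $\tau$. Let $E_{ij}$ be the matrix units. Put $H_k=\sqrt{-1}(E_{2k-1,2k}-E_{2k,2k-1})$ for $1\le k\le n$, and for $1\le j<k\le n$: $G^{+}_{jk}=E_{2j-1,2k-1}-E_{2k-1,2j-1}+E_{2j,2k}-E_{2k,2j}+\sqrt{-1}(E_{2j-1,2k}-E_{2j,2k-1}-E_{2k,2j-1}+E_{2k-1,2j})$, $G^{+}_{kj}=-\overline{G^{+}_{jk}}$, $G^{-}_{jk}=E_{2j-1,2k-1}-E_{2k-1,2j-1}-E_{2j,2k}+E_{2k,2j}+\sqrt{-1}(E_{2j-1,2k}+E_{2j,2k-1}-E_{2k,2j-1}-E_{2k-1,2j})$, $G^{-}_{kj}=-\overline{G^{-}_{jk}}$. Set $X_{jk}=G^{+}_{jk}$ for $j\neq k$, and $Y_{jk}=G^{-}_{kj}$, $Z_{jk}=G^{-}_{jk}$ for $j<k$. Then $\mathfrak{h}=\bigoplus_{k=1}^n\mathbb C H_k$ is a Cartan subalgebra of $\mathfrak{g}$; let $\epsilon_k\in\mathfrak{h}^*$ be defined by $\epsilon_k(H_j)=\delta_{jk}$.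 The elements $X_{jk},Y_{jk},Z_{jk}$ are root vectors for the roots $\epsilon_j-\epsilon_k$, $\epsilon_j+\epsilon_k$, $-(\epsilon_j+\epsilon_k)$ respectively. Each $\epsilon_j$ is extended to a linear functional on $\mathfrak{g}$ vanishing on all root vectors $X_{jk},Y_{jk},Z_{jk}$. **Admissible pairs.** Let $G_0$ be a finite-dimensional connected real Lie group with Lie algebra $\mathfrak{g}_0$, $\mathfrak{g}=\mathfrak{g}_0\otimes_{\mathbb R}\mathbb C$, and $\tau$ the conjugation of $\mathfrak{g}$ with respect to $\mathfrak{g}_0$. A $\mathfrak{g}_0$-admissible pair is a pair $(\mathfrak{s},\omega)$ with $\mathfrak{s}\subset\mathfrak{g}$ a complex subalgebra and $\omega\in\bigwedge^2\mathfrak{s}^*$ a closed $2$-form (closed for the Chevalley–Eilenberg differential) such that $\mathfrak{s}+\tau(\mathfrak{s})=\mathfrak{g}$ and $\operatorname{Im}(\omega|_{\mathfrak{g}_0\cap\mathfrak{s}})$ is non-degenerate. By a theorem of Alekseevsky–David and Milburn, invariant generalized complex structures on $G_0$ are in one-to-one correspondence with $\mathfrak{g}_0$-admissible pairs: the pair $(\mathfrak{s},\omega)$ corresponds to the structure whose holomorphic subbundle is, at the identity, $L(\mathfrak{s},\omega)=\{X+\xi\in\mathfrak{g}\oplus\mathfrak{g}^*: X\in\mathfrak{s},\ \xi|_{\mathfrak{s}}=\omega(X,\cdot)\}$. **Regularity.** An invariant generalized complex structure on $G_0$ is called regular if the associated subalgebra $\mathfrak{s}\subset\mathfrak{g}$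 is normalized by a Cartan subalgebra of $\mathfrak{g}_0$; non-regular means not regular. *)

theory Defs
  imports "HOL-Analysis.Analysis" "HOL-Library.Function_Algebras"
begin

section \<open>Generalized complex structures on embedded submanifolds of a Euclidean space\<close>

text \<open>
  A manifold is given as a closed embedded submanifold \<open>M\<close> of a Euclidean space, so that smooth
  functions, vector fields and forms on \<open>M\<close> are exactly the restrictions of smooth ones on the
  ambient space. The definitions below are meaningful for such \<open>M\<close> only; they do not test
  that \<open>M\<close> is one.
\<close>

primrec times_differentiable ::
  "nat \<Rightarrow> ('a::real_normed_vector \<Rightarrow> 'b::real_normed_vector) \<Rightarrow> bool" where
  "times_differentiable 0 f \<longleftrightarrow> True"
| "times_differentiable (Suc k) f \<longleftrightarrow>
     (\<forall>x. f differentiable at x) \<and>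
     (\<forall>v. times_differentiable k (\<lambda>x. frechet_derivative f (at x) v))"

definition smooth :: "('a::real_normed_vector \<Rightarrow> 'b::real_normed_vector) \<Rightarrow> bool" where
  "smooth f \<longleftrightarrow> (\<forall>k. times_differentiable k f)"

definition tangent_space :: "'a::euclidean_space set \<Rightarrow> 'a \<Rightarrow> 'a set" where
  "tangent_space M p =
     {v. \<exists>\<gamma> :: real \<Rightarrow> 'a. \<gamma> 0 = p \<and> eventually (\<lambda>t. \<gamma> t \<in> M) (at 0) \<and>
           (\<gamma> has_vector_derivative v) (at 0)}"

text \<open>A covector at \<open>p\<close> is a linear form on the tangent space. To make it a unique HOL function
  it takes the value 0 off the tangent space (so it is not linear on the ambient space).\<close>

definition cotangent_space :: "'a::euclidean_space set \<Rightarrow> 'a \<Rightarrow> ('a \<Rightarrow> real) set" where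
  "cotangent_space M p =
     {\<alpha>. (\<forall>v\<in>tangent_space M p. \<forall>w\<in>tangent_space M p. \<forall>a b.
            \<alpha> (a *\<^sub>R v + b *\<^sub>R w) = a * \<alpha> v + b * \<alpha> w) \<and>
          (\<forall>v. v \<notin> tangent_space M p \<longrightarrow> \<alpha> v = 0)}"

type_synonym 'a gvec = "'a \<times> ('a \<Rightarrow> real)"

definition gtangent_space :: "'a::euclidean_space set \<Rightarrow> 'a \<Rightarrow> 'a gvec set" where
  "gtangent_space M p = tangent_space M p \<times> cotangent_space M p"

definition gscale :: "real \<Rightarrow> 'a::real_vector gvec \<Rightarrow> 'a gvec" where
  "gscale c u = (c *\<^sub>R fst u, \<lambda>w. c * snd u w)"

definition gpairing :: "'a gvec \<Rightarrow> 'a gvec \<Rightarrow> real" where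
  "gpairing u v = (snd u (fst v) + snd v (fst u)) / 2"

text \<open>Sections of \<open>TM \<oplus> T\<^sup>*M\<close> are handled through ambient representatives: a vector field
  tangent to \<open>M\<close> along \<open>M\<close> and an ambient 1-form, of which only the restriction to \<open>TM\<close> matters.\<close>

type_synonym 'a gfield = "('a \<Rightarrow> 'a) \<times> ('a \<Rightarrow> 'a \<Rightarrow> real)"

definition gsection :: "'a::euclidean_space set \<Rightarrow> 'a gfield \<Rightarrow> bool" where
  "gsection M \<sigma> \<longleftrightarrow>
     smooth (fst \<sigma>) \<and> (\<forall>p. linear (snd \<sigma> p)) \<and> (\<forall>v. smooth (\<lambda>p. snd \<sigma> p v)) \<and>
     (\<forall>p\<in>M. fst \<sigma> p \<in> tangent_space M p)"

definition gvalue :: "'a::euclidean_space set \<Rightarrow> 'a gfield \<Rightarrow> 'a \<Rightarrow> 'a gvec" where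
  "gvalue M \<sigma> p = (fst \<sigma> p, \<lambda>v. if v \<in> tangent_space M p then snd \<sigma> p v else 0)"

definition Lie_bracket_field :: "('a::euclidean_space \<Rightarrow> 'a) \<Rightarrow> ('a \<Rightarrow> 'a) \<Rightarrow> 'a \<Rightarrow> 'a" where
  "Lie_bracket_field X Y p =
     frechet_derivative Y (at p) (X p) - frechet_derivative X (at p) (Y p)"

text \<open>\<open>(L\<^sub>X \<eta>)(v) = X(\<eta>(V)) - \<eta>([X, V])\<close> with \<open>V\<close> the constant vector field \<open>v\<close>, for which
  \<open>[X, V] = - DX(v)\<close>.\<close>

definition Lie_derivative_form ::
  "('a::euclidean_space \<Rightarrow> 'a) \<Rightarrow> ('a \<Rightarrow> 'a \<Rightarrow> real) \<Rightarrow> 'a \<Rightarrow> 'a \<Rightarrow> real" where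
  "Lie_derivative_form X \<eta> p v =
     frechet_derivative (\<lambda>q. \<eta> q v) (at p) (X p) + \<eta> p (frechet_derivative X (at p) v)"

text \<open>The Courant bracket \<open>[X + \<xi>, Y + \<eta>] = [X, Y] + L\<^sub>X \<eta> - L\<^sub>Y \<xi> - d(\<eta>(X) - \<xi>(Y))/2\<close> of the
  ambient space. For sections over \<open>M\<close>, its value in \<open>TM \<oplus> T\<^sup>*M\<close> is the Courant bracket of \<open>M\<close>,
  because Lie and exterior derivatives commute with the pullback to \<open>M\<close>.\<close>

definition courant_bracket :: "'a::euclidean_space gfield \<Rightarrow> 'a gfield \<Rightarrow> 'a gfield" where
  "courant_bracket \<sigma> \<rho> =
     (Lie_bracket_field (fst \<sigma>) (fst \<rho>),
      \<lambda>p v. Lie_derivative_form (fst \<sigma>) (snd \<rho>) p v - Lie_derivative_form (fst \<rho>) (snd \<sigma>) p v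
        - frechet_derivative (\<lambda>q. snd \<rho> q (fst \<sigma> q) - snd \<sigma> q (fst \<rho> q)) (at p) v / 2)"

text \<open>The fibre at \<open>p\<close> of the holomorphic subbundle, i.e. of the \<open>\<i>\<close>-eigenbundle of \<open>J\<close> on the
  complexification of \<open>TM \<oplus> T\<^sup>*M\<close>; the pair \<open>(u, v)\<close> stands for \<open>u + \<i> v\<close>.\<close>

definition holomorphic_fibre ::
  "'a::euclidean_space set \<Rightarrow> ('a \<Rightarrow> 'a gvec \<Rightarrow> 'a gvec) \<Rightarrow> 'a \<Rightarrow> ('a gvec \<times> 'a gvec) set" where
  "holomorphic_fibre M J p =
     {(u, v). u \<in> gtangent_space M p \<and> v \<in> gtangent_space M p \<and> J p u = - v \<and> J p v = u}"

definition generalized_complex_structure ::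
  "'a::euclidean_space set \<Rightarrow> ('a \<Rightarrow> 'a gvec \<Rightarrow> 'a gvec) \<Rightarrow> bool" where
  "generalized_complex_structure M J \<longleftrightarrow>
     \<comment> \<open>bundle endomorphism with square \<open>-1\<close>, orthogonal for the natural pairing\<close>
     (\<forall>p\<in>M. \<forall>u\<in>gtangent_space M p.
        J p u \<in> gtangent_space M p \<and> J p (J p u) = - u \<and>
        (\<forall>v\<in>gtangent_space M p.
           gpairing (J p u) (J p v) = gpairing u v \<and>
           (\<forall>a b. J p (gscale a u + gscale b v) = gscale a (J p u) + gscale b (J p v)))) \<and>
     \<comment> \<open>smoothness\<close>
     (\<forall>\<sigma>. gsection M \<sigma> \<longrightarrow>
        (\<exists>\<rho>. gsection M \<rho> \<and> (\<forall>p\<in>M. gvalue M \<rho> p = J p (gvalue M \<sigma> p)))) \<and>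
     \<comment> \<open>if \<open>\<sigma> + \<i> \<sigma>'\<close> and \<open>\<rho> + \<i> \<rho>'\<close> are sections of the holomorphic subbundle, so is the
         complex bilinear extension of the Courant bracket applied to them\<close>
     (\<forall>\<sigma> \<sigma>' \<rho> \<rho>'. gsection M \<sigma> \<and> gsection M \<sigma>' \<and> gsection M \<rho> \<and> gsection M \<rho>' \<and>
        (\<forall>p\<in>M. (gvalue M \<sigma> p, gvalue M \<sigma>' p) \<in> holomorphic_fibre M J p) \<and>
        (\<forall>p\<in>M. (gvalue M \<rho> p, gvalue M \<rho>' p) \<in> holomorphic_fibre M J p) \<longrightarrow>
        (\<forall>p\<in>M. (gvalue M (courant_bracket \<sigma> \<rho>) p - gvalue M (courant_bracket \<sigma>' \<rho>') p,
                 gvalue M (courant_bracket \<sigma> \<rho>') p + gvalue M (courant_bracket \<sigma>' \<rho>) p)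
               \<in> holomorphic_fibre M J p))"


section \<open>Complex matrices\<close>

type_synonym 'm cmatrix = "complex^'m^'m"

definition cscale :: "complex \<Rightarrow> 'm::finite cmatrix \<Rightarrow> 'm cmatrix" where
  "cscale c A = (\<chi> i j. c * A $ i $ j)"

interpretation cmat: vector_space "cscale :: complex \<Rightarrow> 'm::finite cmatrix \<Rightarrow> 'm cmatrix"
  by unfold_locales (simp_all add: cscale_def vec_eq_iff algebra_simps)

definition conj_matrix :: "'m::finite cmatrix \<Rightarrow> 'm cmatrix" where
  "conj_matrix A = (\<chi> i j. cnj (A $ i $ j))"

definition commutator :: "'m::finite cmatrix \<Rightarrow> 'm cmatrix \<Rightarrow> 'm cmatrix" where
  "commutator A B = A ** B - B ** A"

definition complex_linear_on :: "'m::finite cmatrix set \<Rightarrow> ('m cmatrix \<Rightarrow> complex) \<Rightarrow> bool" where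
  "complex_linear_on V f \<longleftrightarrow>
     (\<forall>X\<in>V. \<forall>Y\<in>V. \<forall>a b. f (cscale a X + cscale b Y) = a * f X + b * f Y)"

text \<open>As for covectors above, elements of the dual are normalized to be 0 off \<open>V\<close>.\<close>

definition complex_dual :: "'m::finite cmatrix set \<Rightarrow> ('m cmatrix \<Rightarrow> complex) set" where
  "complex_dual V = {f. complex_linear_on V f \<and> (\<forall>X. X \<notin> V \<longrightarrow> f X = 0)}"

definition wedge :: "('a \<Rightarrow> complex) \<Rightarrow> ('a \<Rightarrow> complex) \<Rightarrow> 'a \<Rightarrow> 'a \<Rightarrow> complex" where
  "wedge f g X Y = f X * g Y - f Y * g X"


section \<open>Admissible pairs\<close>

definition complex_subalgebra :: "'m::finite cmatrix set \<Rightarrow> bool" where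
  "complex_subalgebra s \<longleftrightarrow> cmat.subspace s \<and> (\<forall>X\<in>s. \<forall>Y\<in>s. commutator X Y \<in> s)"

definition two_form_on ::
  "'m::finite cmatrix set \<Rightarrow> ('m cmatrix \<Rightarrow> 'm cmatrix \<Rightarrow> complex) \<Rightarrow> bool" where
  "two_form_on s \<omega> \<longleftrightarrow>
     (\<forall>X\<in>s. complex_linear_on s (\<omega> X)) \<and> (\<forall>X\<in>s. \<forall>Y\<in>s. \<omega> X Y = - \<omega> Y X)"

definition CE_differential ::
  "('m::finite cmatrix \<Rightarrow> 'm cmatrix \<Rightarrow> complex) \<Rightarrow>
   'm cmatrix \<Rightarrow> 'm cmatrix \<Rightarrow> 'm cmatrix \<Rightarrow> complex" where
  "CE_differential \<omega> X Y Z =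
     - \<omega> (commutator X Y) Z + \<omega> (commutator X Z) Y - \<omega> (commutator Y Z) X"

definition closed_two_form_on ::
  "'m::finite cmatrix set \<Rightarrow> ('m cmatrix \<Rightarrow> 'm cmatrix \<Rightarrow> complex) \<Rightarrow> bool" where
  "closed_two_form_on s \<omega> \<longleftrightarrow>
     two_form_on s \<omega> \<and> (\<forall>X\<in>s. \<forall>Y\<in>s. \<forall>Z\<in>s. CE_differential \<omega> X Y Z = 0)"

definition real_form :: "'m::finite cmatrix set \<Rightarrow> ('m cmatrix \<Rightarrow> 'm cmatrix) \<Rightarrow> 'm cmatrix set" where
  "real_form g \<tau> = {A \<in> g. \<tau> A = A}"

definition admissible_pair ::
  "'m::finite cmatrix set \<Rightarrow> ('m cmatrix \<Rightarrow> 'm cmatrix) \<Rightarrow> 'm cmatrix set \<Rightarrow>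
   ('m cmatrix \<Rightarrow> 'm cmatrix \<Rightarrow> complex) \<Rightarrow> bool" where
  "admissible_pair g \<tau> s \<omega> \<longleftrightarrow>
     s \<subseteq> g \<and> complex_subalgebra s \<and> closed_two_form_on s \<omega> \<and>
     {A + \<tau> B | A B. A \<in> s \<and> B \<in> s} = g \<and>
     (\<forall>X \<in> real_form g \<tau> \<inter> s. (\<forall>Y \<in> real_form g \<tau> \<inter> s. Im (\<omega> X Y) = 0) \<longrightarrow> X = 0)"

text \<open>The subspace \<open>L(s, \<omega>)\<close> of \<open>g \<oplus> g\<^sup>*\<close>.\<close>

definition L_space ::
  "'m::finite cmatrix set \<Rightarrow> 'm cmatrix set \<Rightarrow> ('m cmatrix \<Rightarrow> 'm cmatrix \<Rightarrow> complex) \<Rightarrow>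
   ('m cmatrix \<times> ('m cmatrix \<Rightarrow> complex)) set" where
  "L_space g s \<omega> = {(X, \<xi>). X \<in> s \<and> \<xi> \<in> complex_dual g \<and> (\<forall>Y\<in>s. \<xi> Y = \<omega> X Y)}"


section \<open>Invariant generalized complex structures on matrix groups\<close>

text \<open>The action of the differential of the left translation by \<open>a\<close> on generalized vectors.\<close>

definition left_translate :: "'m::finite cmatrix \<Rightarrow> 'm cmatrix gvec \<Rightarrow> 'm cmatrix gvec" where
  "left_translate a u = (a ** fst u, \<lambda>w. snd u (matrix_inv a ** w))"

definition invariant_gcs ::
  "'m::finite cmatrix set \<Rightarrow> ('m cmatrix \<Rightarrow> 'm cmatrix gvec \<Rightarrow> 'm cmatrix gvec) \<Rightarrow> bool" where
  "invariant_gcs G J \<longleftrightarrow>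
     generalized_complex_structure G J \<and>
     (\<forall>a\<in>G. \<forall>p\<in>G. \<forall>u\<in>gtangent_space G p.
        J (a ** p) (left_translate a u) = left_translate a (J p u))"

text \<open>The holomorphic subbundle at the identity as a subspace of \<open>g \<oplus> g\<^sup>*\<close>, where \<open>g\<close> is a matrix
  realization of the complexification of the Lie algebra of \<open>G\<close>: the element
  \<open>(A + \<alpha>) + \<i> (B + \<beta>)\<close> is identified with \<open>X + \<xi>\<close>, \<open>X = A + \<i> B\<close>, and \<open>\<xi>\<close> the complex linear
  form that restricts to \<open>\<alpha> + \<i> \<beta>\<close> on the Lie algebra of \<open>G\<close>.\<close>

definition holomorphic_at_identity ::
  "'m::finite cmatrix set \<Rightarrow> 'm cmatrix set \<Rightarrow> ('m cmatrix \<Rightarrow> 'm cmatrix gvec \<Rightarrow> 'm cmatrix gvec) \<Rightarrow>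
   ('m cmatrix \<times> ('m cmatrix \<Rightarrow> complex)) set" where
  "holomorphic_at_identity g G J =
     {(X, \<xi>). \<xi> \<in> complex_dual g \<and>
        (\<exists>A \<alpha> B \<beta>. ((A, \<alpha>), (B, \<beta>)) \<in> holomorphic_fibre G J (mat 1) \<and>
           X = A + cscale \<i> B \<and>
           (\<forall>C\<in>tangent_space G (mat 1). \<xi> C = complex_of_real (\<alpha> C) + \<i> * complex_of_real (\<beta> C)))}"

definition associated_subalgebra ::
  "'m::finite cmatrix set \<Rightarrow> 'm cmatrix set \<Rightarrow> ('m cmatrix \<Rightarrow> 'm cmatrix gvec \<Rightarrow> 'm cmatrix gvec) \<Rightarrow>
   'm cmatrix set" where
  "associated_subalgebra g G J = fst ` holomorphic_at_identity g G J"


section \<open>Cartan subalgebras and regularity\<close>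

primrec lower_central_series :: "'m::finite cmatrix set \<Rightarrow> nat \<Rightarrow> 'm cmatrix set" where
  "lower_central_series h 0 = h"
| "lower_central_series h (Suc k) =
     span {commutator X Y | X Y. X \<in> h \<and> Y \<in> lower_central_series h k}"

text \<open>Cartan subalgebras of a real Lie algebra: nilpotent and self-normalizing.\<close>

definition cartan_subalgebra :: "'m::finite cmatrix set \<Rightarrow> 'm cmatrix set \<Rightarrow> bool" where
  "cartan_subalgebra g0 h \<longleftrightarrow>
     h \<subseteq> g0 \<and> subspace h \<and> (\<forall>X\<in>h. \<forall>Y\<in>h. commutator X Y \<in> h) \<and>
     (\<exists>k. lower_central_series h k = {0}) \<and>
     (\<forall>X\<in>g0. (\<forall>Y\<in>h. commutator X Y \<in> h) \<longrightarrow> X \<in> h)"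

definition regular_gcs ::
  "'m::finite cmatrix set \<Rightarrow> ('m cmatrix \<Rightarrow> 'm cmatrix) \<Rightarrow> 'm cmatrix set \<Rightarrow>
   ('m cmatrix \<Rightarrow> 'm cmatrix gvec \<Rightarrow> 'm cmatrix gvec) \<Rightarrow> bool" where
  "regular_gcs g \<tau> G J \<longleftrightarrow>
     (\<exists>h. cartan_subalgebra (real_form g \<tau>) h \<and>
        (\<forall>X\<in>h. \<forall>Y\<in>associated_subalgebra g G J. commutator X Y \<in> associated_subalgebra g G J))"


section \<open>The Lie algebra \<open>so(2n, C)\<close>, its real form \<open>so(2n-1, 1)\<close>, and the group\<close>

definition so_complex :: "'m::finite cmatrix set" where
  "so_complex = {A. transpose A = - A}"

text \<open>Rows and columns are numbered \<open>1, \<dots>, 2n\<close> by a bijection \<open>ix\<close> from \<open>{1..2 * n}\<close> to the index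
  type.\<close>

definition J_matrix :: "nat \<Rightarrow> (nat \<Rightarrow> 'm::finite) \<Rightarrow> 'm cmatrix" where
  "J_matrix n ix = (\<chi> i j. if i = j then (if i = ix (2 * n) then - 1 else 1) else 0)"

definition tau :: "nat \<Rightarrow> (nat \<Rightarrow> 'm::finite) \<Rightarrow> 'm cmatrix \<Rightarrow> 'm cmatrix" where
  "tau n ix A = J_matrix n ix ** conj_matrix A ** J_matrix n ix"

text \<open>\<open>SO(2n-1, 1)\<close> in the realization that has \<open>real_form so_complex (tau n ix)\<close> as its Lie algebra.
  Conjugation by \<open>diag(1, \<dots>, 1, \<i>)\<close> carries the real matrices of determinant 1 preserving
  \<open>J_matrix n ix\<close> onto this group.\<close>

definition SO_real_form :: "nat \<Rightarrow> (nat \<Rightarrow> 'm::finite) \<Rightarrow> 'm cmatrix set" where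
  "SO_real_form n ix = {A. transpose A ** A = mat 1 \<and> det A = 1 \<and> tau n ix A = A}"

definition SO0 :: "nat \<Rightarrow> (nat \<Rightarrow> 'm::finite) \<Rightarrow> 'm cmatrix set" where
  "SO0 n ix = connected_component_set (SO_real_form n ix) (mat 1)"

definition E_unit :: "(nat \<Rightarrow> 'm::finite) \<Rightarrow> nat \<Rightarrow> nat \<Rightarrow> 'm cmatrix" where
  "E_unit ix i j = (\<chi> a b. if a = ix i \<and> b = ix j then 1 else 0)"

definition H_elem :: "(nat \<Rightarrow> 'm::finite) \<Rightarrow> nat \<Rightarrow> 'm cmatrix" where
  "H_elem ix k = cscale \<i> (E_unit ix (2*k-1) (2*k) - E_unit ix (2*k) (2*k-1))"

definition G_plus_upper :: "(nat \<Rightarrow> 'm::finite) \<Rightarrow> nat \<Rightarrow> nat \<Rightarrow> 'm cmatrix" where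
  "G_plus_upper ix j k =
     E_unit ix (2*j-1) (2*k-1) - E_unit ix (2*k-1) (2*j-1)
     + E_unit ix (2*j) (2*k) - E_unit ix (2*k) (2*j)
     + cscale \<i> (E_unit ix (2*j-1) (2*k) - E_unit ix (2*j) (2*k-1)
                - E_unit ix (2*k) (2*j-1) + E_unit ix (2*k-1) (2*j))"

definition G_minus_upper :: "(nat \<Rightarrow> 'm::finite) \<Rightarrow> nat \<Rightarrow> nat \<Rightarrow> 'm cmatrix" where
  "G_minus_upper ix j k =
     E_unit ix (2*j-1) (2*k-1) - E_unit ix (2*k-1) (2*j-1)
     - E_unit ix (2*j) (2*k) + E_unit ix (2*k) (2*j)
     + cscale \<i> (E_unit ix (2*j-1) (2*k) + E_unit ix (2*j) (2*k-1)
                - E_unit ix (2*k) (2*j-1) - E_unit ix (2*k-1) (2*j))"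

text \<open>Only the cases \<open>j < k\<close> and \<open>j > k\<close> of the next two definitions are meaningful.\<close>

definition G_plus :: "(nat \<Rightarrow> 'm::finite) \<Rightarrow> nat \<Rightarrow> nat \<Rightarrow> 'm cmatrix" where
  "G_plus ix j k = (if j < k then G_plus_upper ix j k else - conj_matrix (G_plus_upper ix k j))"

definition G_minus :: "(nat \<Rightarrow> 'm::finite) \<Rightarrow> nat \<Rightarrow> nat \<Rightarrow> 'm cmatrix" where
  "G_minus ix j k = (if j < k then G_minus_upper ix j k else - conj_matrix (G_minus_upper ix k j))"

definition X_elem :: "(nat \<Rightarrow> 'm::finite) \<Rightarrow> nat \<Rightarrow> nat \<Rightarrow> 'm cmatrix" where
  "X_elem ix j k = G_plus ix j k"

definition Y_elem :: "(nat \<Rightarrow> 'm::finite) \<Rightarrow> nat \<Rightarrow> nat \<Rightarrow> 'm cmatrix" where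
  "Y_elem ix j k = G_minus ix k j"

definition Z_elem :: "(nat \<Rightarrow> 'm::finite) \<Rightarrow> nat \<Rightarrow> nat \<Rightarrow> 'm cmatrix" where
  "Z_elem ix j k = G_minus ix j k"

text \<open>\<open>\<epsilon> 1, \<dots>, \<epsilon> n\<close> is the basis dual to \<open>H\<^sub>1, \<dots>, H\<^sub>n\<close>, extended to \<open>g\<close> by 0 on the root vectors.
  As the \<open>H\<^sub>k\<close> and the root vectors form a basis of \<open>g\<close>, this determines \<open>\<epsilon> k\<close> on \<open>g\<close>.\<close>

definition dual_cartan_basis ::
  "nat \<Rightarrow> (nat \<Rightarrow> 'm::finite) \<Rightarrow> (nat \<Rightarrow> 'm cmatrix \<Rightarrow> complex) \<Rightarrow> bool" where
  "dual_cartan_basis n ix \<epsilon> \<longleftrightarrow>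
     (\<forall>k\<in>{1..n}.
        \<epsilon> k \<in> complex_dual so_complex \<and>
        (\<forall>j\<in>{1..n}. \<epsilon> k (H_elem ix j) = (if j = k then 1 else 0)) \<and>
        (\<forall>i\<in>{1..n}. \<forall>j\<in>{1..n}. i \<noteq> j \<longrightarrow> \<epsilon> k (X_elem ix i j) = 0) \<and>
        (\<forall>i\<in>{1..n}. \<forall>j\<in>{1..n}. i < j \<longrightarrow> \<epsilon> k (Y_elem ix i j) = 0 \<and> \<epsilon> k (Z_elem ix i j) = 0))"

definition s_algebra :: "nat \<Rightarrow> (nat \<Rightarrow> 'm::finite) \<Rightarrow> 'm cmatrix set" where
  "s_algebra n ix = cmat.span
     ({H_elem ix k | k. 2 \<le> k \<and> k \<le> n - 2} \<union> {H_elem ix (n-1) + H_elem ix n}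
      \<union> {H_elem ix 1 + X_elem ix (n-1) n}
      \<union> {X_elem ix j k | j k. 1 \<le> j \<and> j < k \<and> k \<le> n \<and> (j, k) \<noteq> (n-1, n)}
      \<union> {Y_elem ix j k | j k. 1 \<le> j \<and> j < k \<and> k \<le> n}
      \<union> {Z_elem ix (n-1) n})"

end

theory Submission
  imports Defs
begin

text \<open>
  The proof has two independent parts, a construction that works for every admissible pair on a group
  of orthogonal matrices, and linear algebra in \<open>so(2n, C)\<close>.

  \<^bold>\<open>From the pair to the structure.\<close> On the generalized tangent space at the identity, the structure is
  to be the real endomorphism \<open>J\<close> whose \<open>\<i>\<close>-eigenspace is \<open>L(s, \<omega>)\<close>; that is, \<open>J u = w\<close> means
  \<open>u - \<i> w \<in> L(s, \<omega>)\<close>. Such a \<open>w\<close> exists (\<open>inL_exists\<close>) and is unique (\<open>inL_unique\<close>), because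
  \<open>s + \<tau> s = g\<close> and \<open>Im \<omega>\<close> is nondegenerate on \<open>s \<inter> g0\<close>. That \<open>J\<close> has square \<open>-1\<close> is clear from this
  description, and \<open>J\<close> is orthogonal because \<open>L(s, \<omega>)\<close> is isotropic. Translate \<open>J\<close> over the group. As
  the inverse of an orthogonal matrix is its transpose, everything in sight is polynomial and extends
  to the space of all matrices, where smoothness is tested (\<open>Jfield_smooth\<close>). For integrability, write
  sections of the holomorphic bundle in the left trivialization: the vector parts are functions \<open>\<alpha>\<close>,
  \<open>\<beta>\<close> into \<open>s\<close> and the forms restrict to \<open>\<omega>(\<alpha>, \<sqdot>)\<close>, \<open>\<omega>(\<beta>, \<sqdot>)\<close> on \<open>s\<close>. The Courant bracket has the
  vector part \<open>\<gamma> = [\<alpha>, \<beta>] + D\<^sub>\<alpha>\<beta> - D\<^sub>\<beta>\<alpha>\<close>, which is again in \<open>s\<close>, and its form restricts to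
  \<open>\<omega>(\<gamma>, \<sqdot>)\<close> by the closedness of \<open>\<omega>\<close> (\<open>Jfield_integrable\<close>). No Lie theory of the group enters except
  its tangent spaces, and these are found from its equations and from Cayley transforms
  (\<open>tangent_space_SO0\<close>).

  \<^bold>\<open>The subalgebra.\<close> In a basis \<open>q\<^sub>1, \<dots>, q\<^sub>n, r\<^sub>1, \<dots>, r\<^sub>n\<close> of isotropic weight vectors with
  \<open>q\<^sub>k\<close> dual to \<open>r\<^sub>k\<close>, the root vectors are bivectors, and \<open>s\<close> consists of the matrices that stabilize a
  flag in the span of the \<open>q\<^sub>k\<close>, have trace 0 on its last quotient, and satisfy one more linear equation:
  the coefficient of \<open>X\<^sub>n\<^sub>-\<^sub>1\<^sub>,\<^sub>n = q\<^sub>n\<^sub>-\<^sub>1 \<and> q\<^sub>n\<close> equals that of \<open>H\<^sub>1\<close> (\<open>s_eq_coupled\<close>). The conjugation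
  exchanges \<open>q\<^sub>k\<close> and \<open>r\<^sub>k\<close> for \<open>k < n\<close> and fixes \<open>q\<^sub>n\<close> and \<open>r\<^sub>n\<close>. From these equations one reads off
  that \<open>s\<close> is a subalgebra, that \<open>s + \<tau> s = g\<close>, and that \<open>\<epsilon>\<^sub>1, \<dots>, \<epsilon>\<^sub>n\<^sub>-\<^sub>2\<close> are coordinates on
  \<open>s \<inter> g0\<close>, in which \<open>Im \<omega>\<close> is a symplectic form with constant coefficients.

  \<^bold>\<open>Non-regularity.\<close> Because of the last equation, \<open>H\<^sub>n\<close> does not normalize \<open>s\<close>. The elements of the real
  form that do so lie in the span \<open>W\<close> of \<open>H\<^sub>1, \<dots>, H\<^sub>n\<^sub>-\<^sub>2\<close>, \<open>X\<^sub>n\<^sub>-\<^sub>1\<^sub>,\<^sub>n\<close> and its conjugate, which is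
  abelian. A Cartan subalgebra \<open>h \<subseteq> W\<close> is self-normalizing and therefore contains all real elements
  of \<open>W\<close>. Now \<open>H\<^sub>n\<close> is real and \<open>[H\<^sub>n, W] \<subseteq> W\<close>, so \<open>H\<^sub>n\<close> normalizes \<open>h\<close> and would have to
  lie in \<open>h\<close>, but it is not in \<open>W\<close> (\<open>no_normalizing_cartan_subalgebra\<close>).
\<close>

section \<open>Complex matrices\<close>

lemma cscale_of_real: "cscale (of_real r) A = r *\<^sub>R A"
  by (simp add: cscale_def vec_eq_iff complex_eq_iff)

lemma cscale_nth [simp]: "cscale c A $ i $ j = c * A $ i $ j"
  by (simp add: cscale_def)

lemma cscale_i_i [simp]: "cscale \<i> (cscale \<i> A) = - A"
  by (simp add: vec_eq_iff mult.assoc[symmetric])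

lemma scaleR_cscale: "r *\<^sub>R cscale c A = cscale c (r *\<^sub>R A)"
  by (simp add: vec_eq_iff)

lemma cscale_mult_left [simp]: "cscale c A ** B = cscale c (A ** B)"
  by (simp add: vec_eq_iff matrix_matrix_mult_def sum_distrib_left mult.assoc)

lemma cscale_mult_right [simp]: "A ** cscale c B = cscale c (A ** B)"
  by (simp add: vec_eq_iff matrix_matrix_mult_def sum_distrib_left mult_ac)

lemma scaleR_mult_left [simp]: "(r *\<^sub>R A) ** B = r *\<^sub>R (A ** B)"
  for A B :: "'m::finite cmatrix"
  unfolding cscale_of_real[symmetric] by simp

lemma scaleR_mult_right [simp]: "A ** (r *\<^sub>R B) = r *\<^sub>R (A ** B)"
  for A B :: "'m::finite cmatrix"
  unfolding cscale_of_real[symmetric] by simp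

lemma matrix_diff_ldistrib: "(A :: 'm::finite cmatrix) ** (B - C) = A ** B - A ** C"
  by (simp add: vec_eq_iff matrix_matrix_mult_def algebra_simps sum_subtractf)

lemma matrix_diff_rdistrib: "(B - C) ** (A :: 'm::finite cmatrix) = B ** A - C ** A"
  by (simp add: vec_eq_iff matrix_matrix_mult_def algebra_simps sum_subtractf)

lemma matrix_minus_left [simp]: "(- A) ** (B :: 'm::finite cmatrix) = - (A ** B)"
  by (simp add: vec_eq_iff matrix_matrix_mult_def sum_negf)

lemma matrix_minus_right [simp]: "A ** (- B :: 'm::finite cmatrix) = - (A ** B)"
  by (simp add: vec_eq_iff matrix_matrix_mult_def sum_negf)

lemma matrix_zero_left [simp]: "0 ** (B :: 'm::finite cmatrix) = 0"
  by (simp add: vec_eq_iff matrix_matrix_mult_def)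

lemma matrix_zero_right [simp]: "B ** (0 :: 'm::finite cmatrix) = 0"
  by (simp add: vec_eq_iff matrix_matrix_mult_def)

lemma matrix_add_rdistrib: "(B + C) ** (A :: 'm::finite cmatrix) = B ** A + C ** A"
  by (simp add: vec_eq_iff matrix_matrix_mult_def algebra_simps sum.distrib)

lemmas matrix_distribs = matrix_add_ldistrib matrix_add_rdistrib matrix_diff_ldistrib
  matrix_diff_rdistrib

lemma bounded_bilinear_matrix_mult:
  "bounded_bilinear ((**) :: 'm::finite cmatrix \<Rightarrow> 'm cmatrix \<Rightarrow> 'm cmatrix)"
  by (subst bilinear_conv_bounded_bilinear[symmetric])
    (auto simp: bilinear_def matrix_distribs intro!: linearI)

lemma linear_transpose: "linear (transpose :: 'm::finite cmatrix \<Rightarrow> 'm cmatrix)"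
  by (intro linearI) (simp_all add: transpose_def vec_eq_iff)

lemma transpose_simps [simp]:
  fixes A B :: "'m::finite cmatrix"
  shows "transpose (A + B) = transpose A + transpose B"
    "transpose (A - B) = transpose A - transpose B"
    "transpose (- A) = - transpose A" "transpose (0 :: 'm cmatrix) = 0"
    "transpose (cscale c A) = cscale c (transpose A)"
    "transpose (r *\<^sub>R A) = r *\<^sub>R transpose A"
  by (simp_all add: transpose_def vec_eq_iff)

lemma commutator_simps:
  "commutator (A + B) C = commutator A C + commutator B C"
  "commutator A (B + C) = commutator A B + commutator A C"
  "commutator (cscale c A) B = cscale c (commutator A B)"
  "commutator A (cscale c B) = cscale c (commutator A B)"
  "commutator (r *\<^sub>R A) B = r *\<^sub>R (commutator A B)"
  "commutator A (r *\<^sub>R B) = r *\<^sub>R (commutator A B)"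
  "commutator (- A) B = - commutator A B"
  "commutator A (- B) = - commutator A B"
  "commutator 0 B = 0" "commutator A 0 = 0"
  by (simp_all add: commutator_def matrix_distribs cmat.scale_right_diff_distrib
      scaleR_diff_right)

lemma commutator_minus_commute: "commutator A B = - commutator B A"
  by (simp add: commutator_def)

lemma cmat_subspace_imp_subspace: "cmat.subspace V \<Longrightarrow> subspace V"
  by (auto simp: cmat.subspace_def subspace_def simp flip: cscale_of_real)

lemma orthogonal_matrix_right:
  "transpose p ** p = mat 1 \<Longrightarrow> p ** transpose p = mat 1"
  for p :: "'m::finite cmatrix"
  using matrix_left_right_inverse by blast

lemma matrix_inv_orthogonal:
  fixes p :: "'m::finite cmatrix"
  assumes "transpose p ** p = mat 1"
  shows "matrix_inv p = transpose p"
proof -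
  have "invertible p"
    using assms orthogonal_matrix_right by (auto simp: invertible_def)
  then have "p ** matrix_inv p = mat 1"
    unfolding matrix_inv_def invertible_def by (rule someI2_ex) blast
  then have "transpose p ** (p ** matrix_inv p) = transpose p" by simp
  then show ?thesis using assms by (simp add: matrix_mul_assoc)
qed

text \<open>Precomposition with such a projection extends complex linear forms from the subspace.\<close>

lemma complex_projection_exists:
  fixes V :: "'m::finite cmatrix set"
  assumes "cmat.subspace V"
  obtains P :: "'m cmatrix \<Rightarrow> 'm cmatrix"
  where "\<And>X. P X \<in> V" "\<And>X. X \<in> V \<Longrightarrow> P X = X" "\<And>X Y. P (X + Y) = P X + P Y"
    "\<And>c X. P (cscale c X) = cscale c (P X)"
proof -
  interpret vector_space_pair "cscale :: complex \<Rightarrow> 'm cmatrix \<Rightarrow> 'm cmatrix"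
    "cscale :: complex \<Rightarrow> 'm cmatrix \<Rightarrow> 'm cmatrix" ..
  have "Vector_Spaces.linear cscale cscale (id :: 'm cmatrix \<Rightarrow> 'm cmatrix)"
    by (unfold_locales) auto
  from linear_exists_left_inverse_on[OF this assms]
  obtain P where P: "range P \<subseteq> V" "Vector_Spaces.linear cscale cscale P"
    "\<forall>v\<in>V. P v = v" by auto
  interpret P: Vector_Spaces.linear cscale cscale P by (rule P(2))
  show thesis using P(1,3) by (intro that[of P]) (auto simp: P.add P.scale)
qed

section \<open>Smooth maps\<close>

lemma times_differentiable_differentiable:
  "times_differentiable (Suc k) f \<Longrightarrow> f differentiable at x"
  by simp

lemma smooth_imp_differentiable: "smooth f \<Longrightarrow> f differentiable at x"
  unfolding smooth_def using times_differentiable_differentiable by blast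

lemma smooth_has_derivative:
  "smooth f \<Longrightarrow> (f has_derivative frechet_derivative f (at x)) (at x)"
  using smooth_imp_differentiable frechet_derivative_works by blast

lemma times_differentiable_SucI:
  assumes "\<And>x. (f has_derivative f' x) (at x)" "\<And>v. times_differentiable k (\<lambda>x. f' x v)"
  shows "times_differentiable (Suc k) f"
proof -
  have "frechet_derivative f (at x) = f' x" for x
    using assms(1) frechet_derivative_at by metis
  moreover have "f differentiable at x" for x using assms(1) unfolding differentiable_def by blast
  ultimately show ?thesis using assms(2) by auto
qed

lemma times_differentiable_mono:
  "times_differentiable (Suc k) f \<Longrightarrow> times_differentiable k f"
  by (induction k arbitrary: f) auto

lemma times_differentiable_const: "times_differentiable k (\<lambda>x. c)"
proof (induction k arbitrary: c)
  case (Suc k)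
  show ?case by (rule times_differentiable_SucI[where f' = "\<lambda>x v. 0"]) (auto intro: Suc)
qed simp

lemma smooth_const: "smooth (\<lambda>x. c)"
  by (simp add: smooth_def times_differentiable_const)

lemma smooth_bounded_linear: "bounded_linear f \<Longrightarrow> smooth f"
  unfolding smooth_def
proof
  fix k assume "bounded_linear f"
  then show "times_differentiable k f"
  proof (cases k)
    case (Suc n)
    then show ?thesis using bounded_linear_imp_has_derivative[OF \<open>bounded_linear f\<close>]
      by (auto intro!: times_differentiable_SucI[where f' = "\<lambda>x v. f v"]
          times_differentiable_const simp del: times_differentiable.simps)
  qed simp
qed

lemma times_differentiable_compose_linear:
  assumes "bounded_linear L"
  shows "times_differentiable k f \<Longrightarrow> times_differentiable k (\<lambda>x. L (f x))"
proof (induction k arbitrary: f)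
  case (Suc k)
  have "(f has_derivative frechet_derivative f (at x)) (at x)" for x
    using Suc.prems by (auto simp flip: frechet_derivative_works)
  then have "((\<lambda>x. L (f x)) has_derivative (\<lambda>v. L (frechet_derivative f (at x) v))) (at x)" for x
    by (rule bounded_linear.has_derivative[OF assms])
  then show ?case using Suc by (intro times_differentiable_SucI) auto
qed simp

lemma smooth_compose_linear: "bounded_linear L \<Longrightarrow> smooth f \<Longrightarrow> smooth (\<lambda>x. L (f x))"
  unfolding smooth_def using times_differentiable_compose_linear by blast

lemma times_differentiable_add:
  "times_differentiable k f \<Longrightarrow> times_differentiable k g \<Longrightarrow> times_differentiable k (\<lambda>x. f x + g x)"
proof (induction k arbitrary: f g)
  case (Suc k)
  have "(f has_derivative frechet_derivative f (at x)) (at x)"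
    "(g has_derivative frechet_derivative g (at x)) (at x)" for x
    using Suc.prems by (auto simp flip: frechet_derivative_works)
  then show ?case using Suc
    by (intro times_differentiable_SucI[where f' = "\<lambda>x v. frechet_derivative f (at x) v
          + frechet_derivative g (at x) v"] has_derivative_add) auto
qed simp

lemma smooth_add: "smooth f \<Longrightarrow> smooth g \<Longrightarrow> smooth (\<lambda>x. f x + g x)"
  by (simp add: smooth_def times_differentiable_add)

lemma smooth_sum: "(\<And>i. i \<in> I \<Longrightarrow> smooth (f i)) \<Longrightarrow> smooth (\<lambda>x. \<Sum>i\<in>I. f i x)"
  by (induction I rule: infinite_finite_induct) (auto intro: smooth_const smooth_add)

lemma times_differentiable_bilinear:
  assumes "bounded_bilinear B"
  shows "times_differentiable k f \<Longrightarrow> times_differentiable k g \<Longrightarrow>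
    times_differentiable k (\<lambda>x. B (f x) (g x))"
proof (induction k arbitrary: f g)
  case (Suc k)
  have D: "(f has_derivative frechet_derivative f (at x)) (at x)"
    "(g has_derivative frechet_derivative g (at x)) (at x)" for x
    using Suc.prems by (auto simp flip: frechet_derivative_works)
  have "times_differentiable k (\<lambda>x. B (f x) (frechet_derivative g (at x) v)
      + B (frechet_derivative f (at x) v) (g x))" for v
    using Suc.prems by (intro times_differentiable_add Suc.IH)
      (auto intro: times_differentiable_mono simp del: times_differentiable.simps
        simp: times_differentiable.simps(2)[of _ f] times_differentiable.simps(2)[of _ g])
  then show ?case
    using bounded_bilinear.FDERIV[OF assms D] by (intro times_differentiable_SucI) auto
qed simp

lemma smooth_bilinear: "bounded_bilinear B \<Longrightarrow> smooth f \<Longrightarrow> smooth g \<Longrightarrow> smooth (\<lambda>x. B (f x) (g x))"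
  unfolding smooth_def using times_differentiable_bilinear by blast

lemmas smooth_matrix_mult = smooth_bilinear[OF bounded_bilinear_matrix_mult]

lemma smooth_id: "smooth (\<lambda>x. x)"
  by (rule smooth_bounded_linear) (rule bounded_linear_ident)

lemma smooth_transpose: "smooth f \<Longrightarrow> smooth (\<lambda>x. transpose (f x :: 'm::finite cmatrix))"
  by (rule smooth_compose_linear) (simp_all add: linear_transpose flip: linear_conv_bounded_linear)

section \<open>Derivatives along a submanifold\<close>

text \<open>A tangent vector differentiates a function through a curve in \<open>M\<close>; hence only the
  values on \<open>M\<close> matter.\<close>

lemma derivative_along_eqI:
  fixes f h :: "'a::euclidean_space \<Rightarrow> 'b::real_normed_vector"
  assumes f: "(f has_derivative f') (at p)" and h: "(h has_derivative h') (at p)"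
    and eq: "\<And>q. q \<in> M \<Longrightarrow> f q = h q" and p: "p \<in> M" and v: "v \<in> tangent_space M p"
  shows "f' v = h' v"
proof -
  obtain \<gamma> where \<gamma>: "\<gamma> 0 = p" "eventually (\<lambda>t. \<gamma> t \<in> M) (at 0)"
    "(\<gamma> has_vector_derivative v) (at (0::real))"
    using v by (auto simp: tangent_space_def)
  have 1: "((\<lambda>t. f (\<gamma> t)) has_vector_derivative f' v) (at 0)"
    using \<gamma>(1,3) f has_derivative_compose[of \<gamma> "\<lambda>t. t *\<^sub>R v" 0 UNIV f f']
    by (simp add: has_vector_derivative_def linear_scale[OF has_derivative_linear[OF f]])
  have 2: "((\<lambda>t. h (\<gamma> t)) has_vector_derivative h' v) (at 0)"
    using \<gamma>(1,3) h has_derivative_compose[of \<gamma> "\<lambda>t. t *\<^sub>R v" 0 UNIV h h']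
    by (simp add: has_vector_derivative_def linear_scale[OF has_derivative_linear[OF h]])
  have "((\<lambda>t. h (\<gamma> t)) has_vector_derivative f' v) (at 0)"
    using 1 unfolding has_vector_derivative_def
    by (rule has_derivative_transform_eventually)
      (use \<gamma> eq p in \<open>auto elim!: eventually_mono\<close>)
  from vector_derivative_unique_at[OF this 2] show ?thesis .
qed

text \<open>Linear forms that vanish on \<open>S\<close> reduce this to the previous lemma.\<close>

lemma derivative_along_subspace:
  fixes f :: "'a::euclidean_space \<Rightarrow> 'b::euclidean_space"
  assumes f: "(f has_derivative f') (at p)" and S: "subspace S"
    and mem: "\<And>q. q \<in> M \<Longrightarrow> f q \<in> S" and p: "p \<in> M" and v: "v \<in> tangent_space M p"
  shows "f' v \<in> S"
proof -
  have "y \<bullet> f' v = 0" if y: "y \<in> S\<^sup>\<bottom>" for y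
  proof -
    have "((\<lambda>q. y \<bullet> f q) has_derivative (\<lambda>w. y \<bullet> f' w)) (at p)"
      by (rule has_derivative_inner_right[OF f])
    moreover have "((\<lambda>q. 0::real) has_derivative (\<lambda>w. 0)) (at p)" by simp
    moreover have "y \<bullet> f q = 0" if "q \<in> M" for q
      using y mem[OF that] by (auto simp: orthogonal_comp_def orthogonal_def inner_commute)
    ultimately show ?thesis using derivative_along_eqI p v by blast
  qed
  then have "f' v \<in> S\<^sup>\<bottom>\<^sup>\<bottom>" by (auto simp: orthogonal_comp_def orthogonal_def)
  then show ?thesis using S by (simp add: orthogonal_comp_self)
qed

section \<open>The conjugation and the tangent spaces of the group\<close>

lemma mat_1_nth: "(mat 1 :: 'm::finite cmatrix) $ i $ j = (if i = j then 1 else 0)"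
  by (simp add: mat_def)

lemma tau_nth:
  "tau n ix A $ i $ j
    = (if i = ix (2*n) then - 1 else 1) * (if j = ix (2*n) then - 1 else 1) * cnj (A $ i $ j)"
proof -
  have 1: "(J_matrix n ix ** B) $ i $ j = (if i = ix (2*n) then - 1 else 1) * B $ i $ j" for B i j
    unfolding matrix_matrix_mult_def J_matrix_def
    by (simp add: if_distrib[of "\<lambda>x. x * _"] cong: if_cong)
  have 2: "(B ** J_matrix n ix) $ i $ j = (if j = ix (2*n) then - 1 else 1) * B $ i $ j" for B i j
    unfolding matrix_matrix_mult_def J_matrix_def
    by (simp add: if_distrib[of "\<lambda>x. _ * x"] cong: if_cong)
  show ?thesis unfolding tau_def 1 2 by (simp add: conj_matrix_def)
qed

lemma tau_add: "tau n ix (A + B) = tau n ix A + tau n ix B"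
  and tau_minus: "tau n ix (- A) = - tau n ix A"
  and tau_diff: "tau n ix (A - B) = tau n ix A - tau n ix B"
  and tau_cscale: "tau n ix (cscale c A) = cscale (cnj c) (tau n ix A)"
  and tau_scaleR: "tau n ix (r *\<^sub>R A) = r *\<^sub>R tau n ix A"
  and tau_transpose: "tau n ix (transpose A) = transpose (tau n ix A)"
  and tau_one: "tau n ix (mat 1) = mat 1"
  and tau_tau: "tau n ix (tau n ix A) = A"
  by (simp_all add: vec_eq_iff tau_nth transpose_def algebra_simps mat_1_nth)

lemma tau_mult: "tau n ix (A ** B) = tau n ix A ** tau n ix B"
  unfolding vec_eq_iff tau_nth matrix_matrix_mult_def
  by (auto simp: sum_distrib_left cnj_sum simp flip: sum_negf intro!: sum.cong)

lemma linear_tau: "linear (tau n ix)"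
  by (rule linearI) (simp_all add: tau_add tau_scaleR)

lemma one_in_SO_real_form: "mat 1 \<in> SO_real_form n ix"
  by (simp add: SO_real_form_def tau_one)

lemma SO_real_form_mult:
  assumes "A \<in> SO_real_form n ix" "B \<in> SO_real_form n ix"
  shows "A ** B \<in> SO_real_form n ix"
proof -
  have "transpose (A ** B) ** (A ** B) = transpose B ** (transpose A ** A) ** B"
    by (simp add: matrix_transpose_mul matrix_mul_assoc)
  then show ?thesis using assms by (simp add: SO_real_form_def det_mul tau_mult)
qed

lemma one_in_SO0: "mat 1 \<in> SO0 n ix"
  by (simp add: SO0_def one_in_SO_real_form)

lemma SO0_subset: "SO0 n ix \<subseteq> SO_real_form n ix"
  by (simp add: SO0_def connected_component_subset)

lemma SO0_orthogonal: "p \<in> SO0 n ix \<Longrightarrow> transpose p ** p = mat 1"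
  using SO0_subset by (force simp: SO_real_form_def)

lemma SO0_connectedI:
  assumes "p \<in> SO0 n ix" "connected T" "p \<in> T" "T \<subseteq> SO_real_form n ix"
  shows "T \<subseteq> SO0 n ix"
proof -
  have "T \<subseteq> connected_component_set (SO_real_form n ix) p"
    using assms by (intro connected_component_maximal) auto
  also have "\<dots> = SO0 n ix"
    using assms(1) unfolding SO0_def by (metis connected_component_eq)
  finally show ?thesis .
qed

lemma continuous_on_det:
  fixes M :: "'a::topological_space \<Rightarrow> 'm::finite cmatrix"
  assumes "\<And>i j. continuous_on S (\<lambda>t. M t $ i $ j)"
  shows "continuous_on S (\<lambda>t. det (M t))"
  unfolding det_def by (intro continuous_intros assms)

text \<open>By Cramer's rule the entries of the inverse are quotients of determinants.\<close>

lemma continuous_inverse_matrix: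
  fixes B :: "'a::topological_space \<Rightarrow> 'm::finite cmatrix"
  assumes B: "\<And>i j. continuous_on S (\<lambda>t. B t $ i $ j)" and nz: "\<And>t. t \<in> S \<Longrightarrow> det (B t) \<noteq> 0"
  obtains I where "continuous_on S I" "\<And>t. t \<in> S \<Longrightarrow> B t ** I t = mat 1"
proof
  define I where "I = (\<lambda>t. \<chi> k l. det (\<chi> i j. if j = k then axis l 1 $ i else B t $ i $ j)
    / det (B t))"
  show "continuous_on S I" unfolding I_def
  proof (intro continuous_on_vec_lambda continuous_on_divide continuous_on_det)
    show "continuous_on S (\<lambda>t. (\<chi> i j. if j = k then axis l 1 $ i else B t $ i $ j) $ i $ j)"
      for k l i j :: 'm by (cases "j = k") (auto intro: B)
  qed (auto intro: B dest: nz)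
  fix t assume t: "t \<in> S"
  have "B t *v (\<chi> k. I t $ k $ l) = axis l 1" for l
    unfolding cramer[OF nz[OF t]] by (simp add: I_def vec_eq_iff)
  then have "(B t *v (\<chi> k. I t $ k $ l)) $ i = axis l 1 $ i" for l i by simp
  then show "B t ** I t = mat 1"
    by (simp add: vec_eq_iff matrix_matrix_mult_def matrix_vector_mult_def axis_def mat_1_nth)
qed

lemma has_vector_derivative_scale_continuous:
  fixes h :: "real \<Rightarrow> 'a::real_normed_vector"
  assumes "(h \<longlongrightarrow> h 0) (at 0)"
  shows "((\<lambda>t. t *\<^sub>R h t) has_vector_derivative h 0) (at 0)"
proof -
  have "((\<lambda>t. norm (h t - h 0)) \<longlongrightarrow> 0) (at 0)"
    using assms by (simp add: LIM_zero tendsto_norm_zero)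
  then have "((\<lambda>t. norm (t *\<^sub>R h t - 0 *\<^sub>R h 0 - (t - 0) *\<^sub>R h 0) / norm (t - 0)) \<longlongrightarrow> 0) (at 0)"
    by (rule Lim_transform_eventually)
      (simp add: eventually_at_filter scaleR_diff_right[symmetric] del: scaleR_diff_right)
  then show ?thesis
    unfolding has_vector_derivative_def has_derivative_iff_norm
    by (auto intro: bounded_linear_scaleR_left)
qed

text \<open>The Cayley transform \<open>t \<mapsto> (1 - tA/2)\<^sup>-\<^sup>1 (1 + tA/2)\<close> replaces the exponential: for small
  \<open>t\<close> it is a curve in the group with velocity \<open>A\<close> at the identity, and it is algebraic.\<close>

lemma cayley_curve:
  assumes A: "A \<in> real_form so_complex (tau n ix)"
  obtains C :: "real \<Rightarrow> 'm::finite cmatrix" and e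
  where "e > 0" "continuous_on (ball 0 e) C" "C 0 = mat 1"
    "(C has_vector_derivative A) (at 0)" "\<And>t. t \<in> ball 0 e \<Longrightarrow> C t \<in> SO_real_form n ix"
proof -
  define B where "B = (\<lambda>t. mat 1 - (t/2) *\<^sub>R A)"
  define D where "D = (\<lambda>t. mat 1 + (t/2) *\<^sub>R A)"
  have AT: "transpose A = - A" and At: "tau n ix A = A"
    using A by (auto simp: real_form_def so_complex_def)
  have BT: "transpose (B t) = D t" for t
    by (simp add: B_def D_def AT transpose_mat)
  have Bcont: "continuous_on S (\<lambda>t. B t $ i $ j)" for S i j
    unfolding B_def by (auto intro!: continuous_intros)
  have "open {t. det (B t) \<noteq> 0}"
    using continuous_on_det[OF Bcont] by (intro open_Collect_neq continuous_on_const) auto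
  moreover have "0 \<in> {t. det (B t) \<noteq> 0}" by (simp add: B_def)
  ultimately obtain e where e: "e > 0" "ball 0 e \<subseteq> {t. det (B t) \<noteq> 0}"
    unfolding open_contains_ball by blast
  from e obtain I where I: "continuous_on (ball 0 e) I"
    and BI: "\<And>t. t \<in> ball 0 e \<Longrightarrow> B t ** I t = mat 1"
    using continuous_inverse_matrix[OF Bcont, of "ball 0 e"] by blast
  have IB: "I t ** B t = mat 1" if "t \<in> ball 0 e" for t
    using BI[OF that] matrix_left_right_inverse1 by blast
  define C where "C = (\<lambda>t. I t ** D t)"
  have I0: "I 0 = mat 1" using BI[of 0] e(1) by (simp add: B_def)
  have Ceq: "C t = mat 1 + t *\<^sub>R (I t ** A)" if t: "t \<in> ball 0 e" for t
  proof -
    have "D t = B t + t *\<^sub>R A"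
      by (simp add: B_def D_def algebra_simps flip: scaleR_add_left)
    then show ?thesis by (simp add: C_def matrix_distribs IB[OF t])
  qed
  have Icont: "(I \<longlongrightarrow> I 0) (at 0)"
    using I e(1) by (simp add: continuous_on_eq_continuous_at continuous_at)
  have "((\<lambda>t. I t ** A) \<longlongrightarrow> I 0 ** A) (at 0)"
    by (intro bounded_bilinear.tendsto[OF bounded_bilinear_matrix_mult] Icont tendsto_const)
  from has_vector_derivative_scale_continuous[of "\<lambda>t. I t ** A", OF this]
  have "((\<lambda>t. mat 1 + t *\<^sub>R (I t ** A)) has_vector_derivative A) (at 0)"
    by (auto simp: I0 intro: derivative_eq_intros)
  then have deriv: "(C has_vector_derivative A) (at 0)"
    unfolding has_vector_derivative_def
  proof (rule has_derivative_transform_eventually)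
    show "\<forall>\<^sub>F t in at 0. mat 1 + t *\<^sub>R (I t ** A) = C t"
      using eventually_at_in_open'[of "ball 0 e" 0] e(1) by (auto elim!: eventually_mono simp: Ceq)
  qed (use e(1) in \<open>auto simp: Ceq\<close>)
  have Dcont: "continuous_on S D" for S
    unfolding D_def by (auto intro!: continuous_intros)
  have Ccont: "continuous_on (ball 0 e) C"
    unfolding C_def by (rule bounded_bilinear.continuous_on[OF bounded_bilinear_matrix_mult I Dcont])
  have "C t \<in> SO_real_form n ix" if t: "t \<in> ball 0 e" for t
  proof -
    have BD: "B t ** D t = D t ** B t"
      by (simp add: B_def D_def matrix_distribs algebra_simps)
    have ID: "I t ** D t = D t ** I t"
    proof -
      have "I t ** (B t ** D t) ** I t = I t ** (D t ** B t) ** I t" by (simp add: BD)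
      then show ?thesis
        by (simp add: matrix_mul_assoc IB[OF t])
          (simp add: BI[OF t] flip: matrix_mul_assoc)
    qed
    have ITD: "transpose (I t) ** D t = mat 1"
      using BI[OF t] by (metis BT matrix_transpose_mul transpose_mat)
    have "transpose (D t) = B t" using BT[of t] by (metis transpose_transpose)
    then have "transpose (C t) ** C t = B t ** (transpose (I t) ** (I t ** D t))"
      by (simp add: C_def matrix_transpose_mul matrix_mul_assoc)
    also have "\<dots> = B t ** ((transpose (I t) ** D t) ** I t)"
      by (simp add: ID matrix_mul_assoc)
    also have "\<dots> = mat 1" by (simp add: ITD BI[OF t])
    finally have 1: "transpose (C t) ** C t = mat 1" .
    have "det (B t) * det (I t) = 1" using BI[OF t] by (metis det_I det_mul)
    moreover have "det (D t) = det (B t)" by (metis BT det_transpose)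
    ultimately have 2: "det (C t) = 1" by (simp add: C_def det_mul mult.commute)
    have tB: "tau n ix (B t) = B t" and tD: "tau n ix (D t) = D t"
      by (simp_all add: B_def D_def tau_add tau_diff tau_scaleR tau_one At)
    have "tau n ix (I t) ** B t = mat 1"
      using IB[OF t] by (metis tB tau_mult tau_one)
    then have "tau n ix (I t) ** B t ** I t = I t" by simp
    then have "tau n ix (I t) = I t" by (simp add: BI[OF t] flip: matrix_mul_assoc)
    then have 3: "tau n ix (C t) = C t" by (simp add: C_def tau_mult tD)
    from 1 2 3 show ?thesis by (simp add: SO_real_form_def)
  qed
  with e(1) Ccont deriv show thesis by (intro that[of e C]) (auto simp: C_def I0 D_def)
qed

text \<open>Differentiating the equations \<open>q\<^sup>T q = 1\<close> and \<open>\<tau> q = q\<close> of the group bounds the tangent space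
  from above; the translated Cayley curves fill it.\<close>

lemma tangent_space_SO0:
  assumes p: "p \<in> SO0 n ix"
  shows "tangent_space (SO0 n ix) p = {p ** A | A. A \<in> real_form so_complex (tau n ix)}"
proof (intro equalityI subsetI)
  fix v assume v: "v \<in> tangent_space (SO0 n ix) p"
  have pS: "p \<in> SO_real_form n ix" using p SO0_subset by blast
  have d: "(transpose has_derivative transpose) (at p)"
    by (simp add: bounded_linear_imp_has_derivative linear_transpose flip: linear_conv_bounded_linear)
  have "((\<lambda>q. transpose q ** q) has_derivative (\<lambda>w. transpose p ** w + transpose w ** p)) (at p)"
    by (rule bounded_bilinear.FDERIV[OF bounded_bilinear_matrix_mult d has_derivative_ident])
  moreover have "((\<lambda>q. mat 1 :: 'a cmatrix) has_derivative (\<lambda>w. 0)) (at p)"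
    by simp
  ultimately have 1: "transpose p ** v + transpose v ** p = 0"
    by (rule derivative_along_eqI[OF _ _ SO0_orthogonal p v])
  have "(tau n ix has_derivative tau n ix) (at p)"
    by (simp add: bounded_linear_imp_has_derivative linear_tau flip: linear_conv_bounded_linear)
  moreover have "((\<lambda>q. q) has_derivative (\<lambda>w. w)) (at p)" by simp
  moreover have "tau n ix q = q" if "q \<in> SO0 n ix" for q
    using that SO0_subset by (force simp: SO_real_form_def)
  ultimately have 2: "tau n ix v = v" by (rule derivative_along_eqI[OF _ _ _ p v])
  have "transpose (transpose p ** v) = - (transpose p ** v)"
    using 1 by (simp add: matrix_transpose_mul eq_neg_iff_add_eq_0 add.commute)
  moreover have "tau n ix (transpose p ** v) = transpose p ** v"
    using 2 pS by (simp add: tau_mult tau_transpose SO_real_form_def)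
  moreover have "p ** (transpose p ** v) = v"
    using orthogonal_matrix_right[OF SO0_orthogonal[OF p]] by (simp add: matrix_mul_assoc)
  ultimately show "v \<in> {p ** A | A. A \<in> real_form so_complex (tau n ix)}"
    by (auto simp: real_form_def so_complex_def intro!: exI[of _ "transpose p ** v"])
next
  fix v assume "v \<in> {p ** A | A. A \<in> real_form so_complex (tau n ix)}"
  then obtain A where v: "v = p ** A" and A: "A \<in> real_form so_complex (tau n ix)" by blast
  from cayley_curve[OF A] obtain C e where C: "e > 0" "continuous_on (ball 0 e) C" "C 0 = mat 1"
    "(C has_vector_derivative A) (at 0)" "\<And>t. t \<in> ball 0 e \<Longrightarrow> C t \<in> SO_real_form n ix" by blast
  let ?T = "(\<lambda>t. p ** C t) ` ball 0 e"
  have "?T \<subseteq> SO0 n ix"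
  proof (rule SO0_connectedI[OF p])
    show "connected ?T"
      by (intro connected_continuous_image
          bounded_bilinear.continuous_on[OF bounded_bilinear_matrix_mult] continuous_on_const C) auto
    show "p \<in> ?T" using C(1,3) by (auto intro!: image_eqI[of _ _ 0])
    show "?T \<subseteq> SO_real_form n ix" using C(5) p SO0_subset by (auto intro!: SO_real_form_mult)
  qed
  then have "\<forall>\<^sub>F t in at 0. p ** C t \<in> SO0 n ix"
    using eventually_at_in_open'[of "ball 0 e" 0] C(1)
    by (auto simp: image_subset_iff simp del: mem_ball elim!: eventually_mono)
  moreover have "((\<lambda>t. p ** C t) has_vector_derivative p ** A) (at 0)"
    using bounded_bilinear.has_vector_derivative[OF bounded_bilinear_matrix_mult
        has_vector_derivative_const C(4)] by simp
  ultimately show "v \<in> tangent_space (SO0 n ix) p"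
    unfolding tangent_space_def v using C(3)
    by (auto intro!: exI[of _ "\<lambda>t. p ** C t"])
qed

section \<open>Linear forms on subspaces\<close>

definition real_linear_on :: "'a::real_vector set \<Rightarrow> ('a \<Rightarrow> real) \<Rightarrow> bool" where
  "real_linear_on V f \<longleftrightarrow>
     (\<forall>v\<in>V. \<forall>w\<in>V. \<forall>a b. f (a *\<^sub>R v + b *\<^sub>R w) = a * f v + b * f w)"

lemma real_linear_onD:
  "real_linear_on V f \<Longrightarrow> v \<in> V \<Longrightarrow> w \<in> V \<Longrightarrow> f (a *\<^sub>R v + b *\<^sub>R w) = a * f v + b * f w"
  by (auto simp: real_linear_on_def)

lemma real_linear_on_add:
  "real_linear_on V f \<Longrightarrow> v \<in> V \<Longrightarrow> w \<in> V \<Longrightarrow> f (v + w) = f v + f w"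
  using real_linear_onD[of V f v w 1 1] by simp

lemma real_linear_on_scale: "real_linear_on V f \<Longrightarrow> v \<in> V \<Longrightarrow> f (a *\<^sub>R v) = a * f v"
  using real_linear_onD[of V f v v a 0] by simp

lemma real_linear_on_minus: "real_linear_on V f \<Longrightarrow> v \<in> V \<Longrightarrow> f (- v) = - f v"
  using real_linear_on_scale[of V f v "-1"] by simp

lemma real_linear_on_sum:
  assumes "real_linear_on V f" "subspace V" "finite I" "\<And>i. i \<in> I \<Longrightarrow> x i \<in> V"
  shows "f (\<Sum>i\<in>I. c i *\<^sub>R x i) = (\<Sum>i\<in>I. c i * f (x i))"
  using assms(3,4)
proof (induction I rule: finite_induct)
  case empty
  show ?case using real_linear_on_scale[OF assms(1) subspace_0[OF assms(2)], of 0] by simp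
next
  case (insert i I)
  then show ?case
    by (simp add: real_linear_on_add[OF assms(1)] real_linear_on_scale[OF assms(1)]
        subspace_sum subspace_scale assms(2))
qed

lemma orthonormal_basis_expansion:
  fixes V :: "'a::euclidean_space set"
  assumes V: "subspace V"
  obtains B where "finite B" "B \<subseteq> V" "independent B"
    "\<And>x. x \<in> V \<Longrightarrow> (\<Sum>i\<in>B. (x \<bullet> i) *\<^sub>R i) = x"
proof -
  obtain B where B: "B \<subseteq> V" "pairwise orthogonal B" "\<And>x. x \<in> B \<Longrightarrow> norm x = 1"
    "independent B" "card B = dim V" "span B = V"
    using orthonormal_basis_subspace[OF V] by metis
  show thesis
    using B by (intro that[of B] orthonormal_basis_expand independent_imp_finite) auto
qed

text \<open>A nondegenerate bilinear form on a finite-dimensional space is injective as a map to the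
  dual, hence surjective.\<close>

lemma nondegenerate_represents:
  fixes b :: "'a::euclidean_space \<Rightarrow> 'a \<Rightarrow> real"
  assumes V: "subspace V" and b: "bilinear b"
    and nondeg: "\<And>X. X \<in> V \<Longrightarrow> (\<And>Y. Y \<in> V \<Longrightarrow> b X Y = 0) \<Longrightarrow> X = 0"
    and f: "real_linear_on V f"
  obtains X where "X \<in> V" "\<And>Y. Y \<in> V \<Longrightarrow> b X Y = f Y"
proof -
  obtain B where B: "finite B" "B \<subseteq> V" "independent B"
    and expand: "\<And>x. x \<in> V \<Longrightarrow> (\<Sum>i\<in>B. (x \<bullet> i) *\<^sub>R i) = x"
    using orthonormal_basis_expansion[OF V] by blast
  have coeff: "u i = w i" if eq: "(\<Sum>i\<in>B. u i *\<^sub>R i) = (\<Sum>i\<in>B. w i *\<^sub>R i)" and i: "i \<in> B" for u w i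
  proof -
    have "(\<Sum>i\<in>B. (u i - w i) *\<^sub>R i) = 0"
      using eq by (simp add: scaleR_diff_left sum_subtractf)
    then show ?thesis using B(1,3) i by (auto simp: independent_explicit)
  qed
  have lin2: "real_linear_on V (b X)" for X
    using b by (auto simp: real_linear_on_def bilinear_def linear_add linear_scale)
  have agree: "g Y = h Y"
    if "real_linear_on V g" "real_linear_on V h" "\<And>i. i \<in> B \<Longrightarrow> g i = h i" "Y \<in> V" for g h Y
  proof -
    have "k Y = (\<Sum>i\<in>B. (Y \<bullet> i) * k i)" if "real_linear_on V k" for k
      using real_linear_on_sum[OF that V B(1), of "\<lambda>i. i" "\<lambda>i. Y \<bullet> i"] B(2) expand[OF \<open>Y \<in> V\<close>]
      by auto
    from this[OF that(1)] this[OF that(2)] show ?thesis using that(3) by simp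
  qed
  define T where "T X = (\<Sum>i\<in>B. b X i *\<^sub>R i)" for X
  have T: "linear T"
    by (auto intro!: linearI simp: T_def bilinear_ladd[OF b] bilinear_lmul[OF b]
        scaleR_add_left sum.distrib scaleR_sum_right)
  have TV: "T ` V \<subseteq> V"
    using B V by (auto simp: T_def intro!: subspace_sum subspace_scale)
  have "inj_on T V"
  proof (subst linear_inj_on_iff_eq_0[OF T V], intro ballI impI)
    fix X assume X: "X \<in> V" "T X = 0"
    have "b X i = 0" if "i \<in> B" for i
      using coeff[of "b X" "\<lambda>_. 0"] X(2) that by (simp add: T_def)
    moreover have "real_linear_on V (\<lambda>_. 0)" by (simp add: real_linear_on_def)
    ultimately have "b X Y = 0" if "Y \<in> V" for Y
      using agree[OF lin2 _ _ that, of "\<lambda>_. 0"] by auto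
    then show "X = 0" using nondeg X(1) by blast
  qed
  then have "T ` V = V"
    using subspace_dim_equal[of "T ` V" V] TV dim_image_eq[OF T, of V] V
      linear_subspace_image[OF T V] by (simp add: span_eq_iff[THEN iffD2])
  moreover have "(\<Sum>i\<in>B. f i *\<^sub>R i) \<in> V"
    using B V by (auto intro!: subspace_sum subspace_scale)
  ultimately obtain X where X: "X \<in> V" "T X = (\<Sum>i\<in>B. f i *\<^sub>R i)" by force
  show thesis
  proof (rule that[OF X(1)])
    fix Y assume "Y \<in> V"
    moreover have "b X i = f i" if "i \<in> B" for i
      using coeff[OF _ that, of "b X" f] X(2) by (simp add: T_def)
    ultimately show "b X Y = f Y" using agree[OF lin2 f] by blast
  qed
qed

section \<open>From an admissible pair to a complex structure on the generalized tangent space\<close>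

text \<open>What is needed of the group is that inverses are transposes, hence polynomial, and that its
  tangent spaces are the translates of the real form of \<open>g\<close>.\<close>

locale admissible_matrix_group =
  fixes G g :: "'m::finite cmatrix set"
    and \<tau> :: "'m cmatrix \<Rightarrow> 'm cmatrix" and s :: "'m cmatrix set"
    and \<omega> :: "'m cmatrix \<Rightarrow> 'm cmatrix \<Rightarrow> complex"
  assumes one_in_G: "mat 1 \<in> G"
    and G_orthogonal: "p \<in> G \<Longrightarrow> transpose p ** p = mat 1"
    and tangent_space_G: "p \<in> G \<Longrightarrow> tangent_space G p = {p ** A | A. A \<in> real_form g \<tau>}"
    and g_algebra: "complex_subalgebra g"
    and tau_add: "\<tau> (A + B) = \<tau> A + \<tau> B"
    and tau_cscale: "\<tau> (cscale c A) = cscale (cnj c) (\<tau> A)"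
    and tau_tau: "\<tau> (\<tau> A) = A"
    and tau_in_g: "A \<in> g \<Longrightarrow> \<tau> A \<in> g"
    and tau_commutator: "\<tau> (commutator A B) = commutator (\<tau> A) (\<tau> B)"
    and admissible: "admissible_pair g \<tau> s \<omega>"
begin

abbreviation g0 where "g0 \<equiv> real_form g \<tau>"

lemma g_subspace: "cmat.subspace g"
  using g_algebra by (simp add: complex_subalgebra_def)

lemma s_subspace: "cmat.subspace s" and s_subset: "s \<subseteq> g"
  and s_commutator: "X \<in> s \<Longrightarrow> Y \<in> s \<Longrightarrow> commutator X Y \<in> s"
  and closed_omega: "closed_two_form_on s \<omega>"
  using admissible by (auto simp: admissible_pair_def complex_subalgebra_def)

lemmas s_closed = cmat.subspace_0[OF s_subspace] cmat.subspace_add[OF s_subspace]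
  cmat.subspace_diff[OF s_subspace] cmat.subspace_neg[OF s_subspace]
  cmat.subspace_scale[OF s_subspace]
lemmas g_closed = cmat.subspace_0[OF g_subspace] cmat.subspace_add[OF g_subspace]
  cmat.subspace_diff[OF g_subspace] cmat.subspace_neg[OF g_subspace]
  cmat.subspace_scale[OF g_subspace]

lemma tau_scaleR: "\<tau> (r *\<^sub>R A) = r *\<^sub>R \<tau> A"
  using tau_cscale[of "complex_of_real r" A] by (simp add: cscale_of_real)

lemma tau_minus: "\<tau> (- A) = - \<tau> A"
  using tau_scaleR[of "-1" A] by simp

lemma tau_diff: "\<tau> (A - B) = \<tau> A - \<tau> B"
  using tau_add[of A "- B"] by (simp add: tau_minus)

lemma tau_zero: "\<tau> 0 = 0"
  using tau_scaleR[of 0 0] by simp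

lemma g0_subspace: "subspace g0"
  using cmat_subspace_imp_subspace[OF g_subspace]
  by (auto simp: subspace_def real_form_def tau_zero tau_add tau_scaleR)

lemmas g0_closed = subspace_0[OF g0_subspace] subspace_add[OF g0_subspace]
  subspace_diff[OF g0_subspace] subspace_neg[OF g0_subspace] subspace_scale[OF g0_subspace]

lemma g0_commutator: "X \<in> g0 \<Longrightarrow> Y \<in> g0 \<Longrightarrow> commutator X Y \<in> g0"
  using g_algebra by (auto simp: real_form_def tau_commutator complex_subalgebra_def)

definition re_part :: "'m cmatrix \<Rightarrow> 'm cmatrix" where
  "re_part A = (1/2) *\<^sub>R (A + \<tau> A)"

definition im_part :: "'m cmatrix \<Rightarrow> 'm cmatrix" where
  "im_part A = cscale (- \<i>) ((1/2) *\<^sub>R (A - \<tau> A))"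

lemma re_im_decomp: "re_part A + cscale \<i> (im_part A) = A"
  by (simp add: re_part_def im_part_def vec_eq_iff complex_eq_iff field_simps)

lemma re_part_add: "re_part (A + B) = re_part A + re_part B"
  and im_part_add: "im_part (A + B) = im_part A + im_part B"
  and re_part_i: "re_part (cscale \<i> A) = - im_part A"
  and im_part_i: "im_part (cscale \<i> A) = re_part A"
  and re_part_scaleR: "re_part (r *\<^sub>R A) = r *\<^sub>R re_part A"
  and im_part_scaleR: "im_part (r *\<^sub>R A) = r *\<^sub>R im_part A"
  by (simp_all add: re_part_def im_part_def vec_eq_iff tau_add tau_scaleR tau_cscale algebra_simps)

lemma re_part_g0: "A \<in> g \<Longrightarrow> re_part A \<in> g0"
  using cmat_subspace_imp_subspace[OF g_subspace]
  by (auto simp: re_part_def real_form_def tau_add tau_scaleR tau_tau tau_in_g subspace_scale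
      g_closed add.commute)

lemma im_part_g0: "A \<in> g \<Longrightarrow> im_part A \<in> g0"
  using re_part_g0[of "cscale (- \<i>) A"] re_part_i[of "cscale (- \<i>) A"]
    im_part_i[of "cscale (- \<i>) A"] re_part_i[of "A"] re_part_g0[of "cscale \<i> A"]
    g0_closed(4)[of "- im_part A"]
  by (auto simp: g_closed)

lemma re_im_of_real_pair:
  assumes "A \<in> g0" "B \<in> g0"
  shows "re_part (A + cscale \<i> B) = A" "im_part (A + cscale \<i> B) = B"
  using assms by (simp_all add: re_part_def im_part_def real_form_def tau_add tau_cscale
      vec_eq_iff)

text \<open>Since \<open>s + \<tau> s = g\<close>, the real parts of elements of \<open>s\<close> fill the real form.\<close>

lemma re_part_surj: "C \<in> g0 \<Longrightarrow> \<exists>Y\<in>s. re_part Y = C"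
proof -
  assume C: "C \<in> g0"
  then have "C \<in> {A + \<tau> B | A B. A \<in> s \<and> B \<in> s}"
    using admissible by (auto simp: admissible_pair_def real_form_def)
  then obtain A B where AB: "C = A + \<tau> B" "A \<in> s" "B \<in> s" by blast
  have "C = \<tau> C" using C by (simp add: real_form_def)
  then have "C = \<tau> A + B" by (simp add: AB(1) tau_add tau_tau)
  then have "(A + B) + (\<tau> A + \<tau> B) = C + C" using AB(1) by simp
  then have "re_part (A + B) = C"
    unfolding re_part_def tau_add by (simp only: scaleR_half_double)
  then show ?thesis using AB s_closed(2) by blast
qed

text \<open>The value on \<open>Y\<close> of the complex linear extension of the real linear form \<open>\<alpha> + \<i> \<beta>\<close>.\<close>

definition cext :: "('m cmatrix \<Rightarrow> real) \<Rightarrow> ('m cmatrix \<Rightarrow> real) \<Rightarrow> 'm cmatrix \<Rightarrow> complex" where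
  "cext \<alpha> \<beta> Y = Complex (\<alpha> (re_part Y) - \<beta> (im_part Y)) (\<alpha> (im_part Y) + \<beta> (re_part Y))"

text \<open>Composing \<open>\<omega>\<close> with a projection onto \<open>s\<close> gives a form that is bilinear everywhere.\<close>

definition proj_s :: "'m cmatrix \<Rightarrow> 'm cmatrix" where
  "proj_s = (SOME P. (\<forall>X. P X \<in> s) \<and> (\<forall>X\<in>s. P X = X) \<and> (\<forall>X Y. P (X + Y) = P X + P Y) \<and>
     (\<forall>c X. P (cscale c X) = cscale c (P X)))"

lemma proj_s: "proj_s X \<in> s" "X \<in> s \<Longrightarrow> proj_s X = X" "proj_s (X + Y) = proj_s X + proj_s Y"
  "proj_s (cscale c X) = cscale c (proj_s X)"
proof -
  have "\<exists>P. (\<forall>X. P X \<in> s) \<and> (\<forall>X\<in>s. P X = X) \<and> (\<forall>X Y. P (X + Y) = P X + P Y) \<and>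
     (\<forall>c X. P (cscale c X) = cscale c (P X))"
    by (rule complex_projection_exists[OF s_subspace]) blast
  from someI_ex[OF this] have "(\<forall>X. proj_s X \<in> s) \<and> (\<forall>X\<in>s. proj_s X = X) \<and>
     (\<forall>X Y. proj_s (X + Y) = proj_s X + proj_s Y) \<and>
     (\<forall>c X. proj_s (cscale c X) = cscale c (proj_s X))"
    unfolding proj_s_def .
  then show "proj_s X \<in> s" "X \<in> s \<Longrightarrow> proj_s X = X" "proj_s (X + Y) = proj_s X + proj_s Y"
    "proj_s (cscale c X) = cscale c (proj_s X)" by blast+
qed

definition \<Omega> :: "'m cmatrix \<Rightarrow> 'm cmatrix \<Rightarrow> complex" where
  "\<Omega> X Y = \<omega> (proj_s X) (proj_s Y)"

lemma Omega_eq: "X \<in> s \<Longrightarrow> Y \<in> s \<Longrightarrow> \<Omega> X Y = \<omega> X Y"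
  by (simp add: \<Omega>_def proj_s)

lemma Omega_swap: "\<Omega> X Y = - \<Omega> Y X"
  using closed_omega proj_s(1)
  unfolding \<Omega>_def closed_two_form_on_def two_form_on_def by blast

lemma Omega_comb: "\<Omega> X (cscale a Y + cscale b Z) = a * \<Omega> X Y + b * \<Omega> X Z"
  using closed_omega proj_s(1)
  unfolding \<Omega>_def closed_two_form_on_def two_form_on_def complex_linear_on_def proj_s(3,4)
  by blast

lemma Omega_add_right: "\<Omega> X (Y + Z) = \<Omega> X Y + \<Omega> X Z"
  using Omega_comb[of X 1 Y 1 Z] by simp

lemma Omega_cscale_right: "\<Omega> X (cscale a Y) = a * \<Omega> X Y"
  using Omega_comb[of X a Y 0 Y] by simp

lemma Omega_add_left: "\<Omega> (X + Y) Z = \<Omega> X Z + \<Omega> Y Z"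
  using Omega_add_right[of Z X Y] by (simp add: Omega_swap[of _ Z])

lemma Omega_cscale_left: "\<Omega> (cscale a X) Z = a * \<Omega> X Z"
  using Omega_cscale_right[of Z a X] by (simp add: Omega_swap[of _ Z])

lemma Omega_scaleR_right: "\<Omega> X (r *\<^sub>R Y) = r * \<Omega> X Y"
  using Omega_cscale_right[of X "complex_of_real r"] by (simp add: cscale_of_real)

lemma Omega_scaleR_left: "\<Omega> (r *\<^sub>R X) Y = r * \<Omega> X Y"
  using Omega_cscale_left[of "complex_of_real r"] by (simp add: cscale_of_real)

lemma Omega_minus_right: "\<Omega> X (- Y) = - \<Omega> X Y"
  using Omega_scaleR_right[of X "-1" Y] by simp

lemma Omega_minus_left: "\<Omega> (- X) Y = - \<Omega> X Y"
  using Omega_scaleR_left[of "-1" X Y] by simp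

lemma Omega_diff_right: "\<Omega> X (Y - Z) = \<Omega> X Y - \<Omega> X Z"
  using Omega_add_right[of X Y "- Z"] by (simp add: Omega_minus_right)

lemma Omega_diff_left: "\<Omega> (X - Y) Z = \<Omega> X Z - \<Omega> Y Z"
  using Omega_add_left[of X "- Y" Z] by (simp add: Omega_minus_left)

lemmas Omega_linear = Omega_add_right Omega_add_left Omega_diff_right Omega_diff_left
  Omega_cscale_right Omega_cscale_left Omega_scaleR_right Omega_scaleR_left
  Omega_minus_right Omega_minus_left

text \<open>Closedness, arranged as it occurs in the Courant bracket.\<close>

lemma Omega_closed:
  assumes "X \<in> s" "Y \<in> s" "Z \<in> s"
  shows "\<Omega> (commutator X Y) Z = \<Omega> Y (commutator Z X) - \<Omega> X (commutator Z Y)"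
proof -
  have "CE_differential \<omega> X Y Z = 0"
    using closed_omega assms by (auto simp: closed_two_form_on_def)
  then have "\<Omega> (commutator X Y) Z = \<Omega> (commutator X Z) Y - \<Omega> (commutator Y Z) X"
    using assms by (simp add: CE_differential_def Omega_eq s_commutator algebra_simps)
  then show ?thesis
    using Omega_swap[of Y "commutator Z X"] Omega_swap[of X "commutator Z Y"]
      commutator_minus_commute[of X Z] commutator_minus_commute[of Y Z]
    by (simp add: Omega_linear)
qed

lemma Omega_nondegenerate:
  assumes "X \<in> g0 \<inter> s" "\<And>Y. Y \<in> g0 \<inter> s \<Longrightarrow> Im (\<Omega> X Y) = 0"
  shows "X = 0"
  using admissible assms by (auto simp: admissible_pair_def Omega_eq)

subsection \<open>The fibre at the identity\<close>

definition gtan :: "'m cmatrix gvec set" where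
  "gtan = g0 \<times> {\<alpha>. real_linear_on g0 \<alpha> \<and> (\<forall>v. v \<notin> g0 \<longrightarrow> \<alpha> v = 0)}"

text \<open>The relation \<open>u + \<i> v \<in> L(s, \<omega>)\<close> for generalized vectors \<open>u\<close>, \<open>v\<close> at the identity.\<close>

definition inL :: "'m cmatrix gvec \<Rightarrow> 'm cmatrix gvec \<Rightarrow> bool" where
  "inL u v \<longleftrightarrow> fst u + cscale \<i> (fst v) \<in> s \<and>
     (\<forall>Y\<in>s. cext (snd u) (snd v) Y = \<Omega> (fst u + cscale \<i> (fst v)) Y)"

lemma gtanD: "u \<in> gtan \<Longrightarrow> fst u \<in> g0" "u \<in> gtan \<Longrightarrow> real_linear_on g0 (snd u)"
  "u \<in> gtan \<Longrightarrow> v \<notin> g0 \<Longrightarrow> snd u v = 0"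
  by (auto simp: gtan_def)

lemma gtan_add: "u \<in> gtan \<Longrightarrow> v \<in> gtan \<Longrightarrow> u + v \<in> gtan"
  and gtan_diff: "u \<in> gtan \<Longrightarrow> v \<in> gtan \<Longrightarrow> u - v \<in> gtan"
  and gtan_minus: "u \<in> gtan \<Longrightarrow> - u \<in> gtan"
  and gtan_scale: "u \<in> gtan \<Longrightarrow> gscale c u \<in> gtan"
  by (auto simp: gtan_def gscale_def real_linear_on_def g0_closed algebra_simps)

lemma inL_add: "inL u v \<Longrightarrow> inL u' v' \<Longrightarrow> inL (u + u') (v + v')"
proof -
  assume a: "inL u v" "inL u' v'"
  have e: "fst (u + u') + cscale \<i> (fst (v + v')) =
      (fst u + cscale \<i> (fst v)) + (fst u' + cscale \<i> (fst v'))"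
    by (simp add: cmat.scale_right_distrib)
  have c: "cext (snd (u + u')) (snd (v + v')) Y = cext (snd u) (snd v) Y + cext (snd u') (snd v') Y"
    for Y by (simp add: cext_def complex_eq_iff)
  show ?thesis using a unfolding inL_def e c by (simp add: Omega_linear s_closed)
qed

lemma inL_scale: "inL u v \<Longrightarrow> inL (gscale r u) (gscale r v)"
proof -
  assume a: "inL u v"
  have e: "fst (gscale r u) + cscale \<i> (fst (gscale r v)) = cscale (complex_of_real r) (fst u + cscale \<i> (fst v))"
    by (simp add: gscale_def vec_eq_iff complex_eq_iff algebra_simps)
  have c: "cext (snd (gscale r u)) (snd (gscale r v)) Y = complex_of_real r * cext (snd u) (snd v) Y"
    for Y by (simp add: cext_def gscale_def complex_eq_iff algebra_simps)
  show ?thesis using a unfolding inL_def e c by (simp only: Omega_linear s_closed) simp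
qed

lemma inL_rotate: "inL u v \<Longrightarrow> inL (- v) u"
proof -
  assume a: "inL u v"
  have e: "fst (- v) + cscale \<i> (fst u) = cscale \<i> (fst u + cscale \<i> (fst v))"
    by (simp add: vec_eq_iff complex_eq_iff)
  have c: "cext (snd (- v)) (snd u) Y = \<i> * cext (snd u) (snd v) Y"
    for Y by (simp add: cext_def complex_eq_iff)
  show ?thesis using a unfolding inL_def e c by (simp add: Omega_linear s_closed)
qed

lemma inL_minus: "inL u v \<Longrightarrow> inL (- u) (- v)"
  using inL_rotate[of "- v" u] inL_rotate by blast

text \<open>The vector part \<open>K\<close> of a difference of two solutions has \<open>\<i> K \<in> s\<close>, and its form part is real,
  so \<open>Im \<omega>(K, \<sqdot>)\<close> vanishes on \<open>s \<inter> g0\<close>. Once \<open>K = 0\<close>, the form part vanishes on the real parts of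
  elements of \<open>s\<close>, which is everything.\<close>

lemma inL_unique:
  assumes u: "u \<in> gtan" and v: "v \<in> gtan" "v' \<in> gtan" and L: "inL u v" "inL u v'"
  shows "v = v'"
proof -
  have L0: "inL 0 (v - v')" using inL_add[OF L(1) inL_minus[OF L(2)]] by simp
  define w where "w = v - v'"
  have w: "w \<in> gtan" by (simp add: w_def gtan_diff v)
  have "cscale \<i> (fst w) \<in> s" using L0 by (simp add: inL_def w_def)
  then have "cscale (- \<i>) (cscale \<i> (fst w)) \<in> s" by (rule s_closed(5))
  then have fs: "fst w \<in> s" by simp
  have eq: "cext 0 (snd w) Y = \<Omega> (cscale \<i> (fst w)) Y" if "Y \<in> s" for Y
    using L0 that by (simp add: inL_def w_def zero_fun_def zero_prod_def)
  have fw: "fst w = 0"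
  proof (rule Omega_nondegenerate)
    show "fst w \<in> g0 \<inter> s" using fs gtanD(1)[OF w] by simp
    fix Y assume Y: "Y \<in> g0 \<inter> s"
    then have "re_part Y = Y" "im_part Y = 0"
      by (simp_all add: re_part_def im_part_def real_form_def vec_eq_iff)
    then have "Complex 0 (snd w Y) = \<i> * \<Omega> (fst w) Y"
      using eq[of Y] Y real_linear_on_scale[OF gtanD(2)[OF w] g0_closed(1), of 0]
      by (simp add: cext_def Omega_linear)
    then show "Im (\<Omega> (fst w) Y) = 0" by (simp add: complex_eq_iff)
  qed
  have "snd w C = 0" for C
  proof (cases "C \<in> g0")
    case True
    then obtain Y where "Y \<in> s" "re_part Y = C" using re_part_surj by blast
    then show ?thesis using eq[of Y] Omega_scaleR_left[of 0 0 Y]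
      by (simp add: cext_def fw complex_eq_iff)
  qed (simp add: gtanD(3)[OF w])
  then have "w = 0" using fw by (auto simp: prod_eq_iff)
  then show ?thesis by (simp add: w_def)
qed

text \<open>Existence of the second component: its vector part is corrected by an element of
  \<open>s \<inter> g0\<close>, found from the nondegeneracy of \<open>Im \<omega>\<close>, and then the equation for its form part is
  consistent because \<open>Y \<in> s\<close> has zero real part only if \<open>Y \<in> \<i> (s \<inter> g0)\<close>.\<close>

lemma inL_exists:
  assumes u: "u \<in> gtan"
  obtains v where "v \<in> gtan" "inL u v"
proof -
  define A \<eta> where "A = fst u" and "\<eta> = snd u"
  have A: "A \<in> g0" and \<eta>: "real_linear_on g0 \<eta>"
    using u by (auto simp: A_def \<eta>_def gtanD)
  obtain Y0 where Y0: "Y0 \<in> s" "re_part Y0 = A" using re_part_surj[OF A] by blast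
  define B0 where "B0 = im_part Y0"
  have B0: "B0 \<in> g0" "A + cscale \<i> B0 \<in> s"
    using Y0 s_subset by (auto simp: B0_def im_part_g0 re_im_decomp simp flip: Y0(2))
  define k0 where "k0 = g0 \<inter> s"
  have k0: "subspace k0"
    unfolding k0_def by (intro subspace_inter g0_subspace cmat_subspace_imp_subspace s_subspace)
  have f: "real_linear_on k0 (\<lambda>K. Re (\<Omega> (A + cscale \<i> B0) K) - \<eta> K)"
    unfolding real_linear_on_def
    by (auto simp: k0_def real_linear_onD[OF \<eta>] Omega_linear algebra_simps)
  have b: "bilinear (\<lambda>X Y. Im (\<Omega> X Y))"
    by (auto simp: bilinear_def Omega_linear intro!: linearI)
  have nd: "X = 0" if "X \<in> k0" "\<And>Y. Y \<in> k0 \<Longrightarrow> Im (\<Omega> X Y) = 0" for X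
    using that Omega_nondegenerate[of X] by (auto simp: k0_def)
  obtain K where K: "K \<in> k0"
    and K2: "\<And>Y. Y \<in> k0 \<Longrightarrow> Im (\<Omega> K Y) = Re (\<Omega> (A + cscale \<i> B0) Y) - \<eta> Y"
    using nondegenerate_represents[OF k0 b nd f] by blast
  define B where "B = B0 + K"
  have B: "B \<in> g0" using B0 K by (simp add: B_def k0_def g0_closed)
  define X where "X = A + cscale \<i> B"
  have Xeq: "X = (A + cscale \<i> B0) + cscale \<i> K"
    by (simp add: X_def B_def cmat.scale_right_distrib)
  have X: "X \<in> s" using B0(2) K by (auto simp: Xeq k0_def intro!: s_closed)
  have consistent: "Re (\<Omega> X Y) = \<eta> Y" if "Y \<in> k0" for Y
    using K2[OF that] by (simp add: Xeq Omega_linear)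
  define r where "r Y = Im (\<Omega> X Y) - \<eta> (im_part Y)" for Y
  have im_s: "im_part Y \<in> g0" "re_part Y \<in> g0" if "Y \<in> s" for Y
    using that s_subset by (auto simp: im_part_g0 re_part_g0)
  have r_lin: "r (a *\<^sub>R Y + b *\<^sub>R Z) = a * r Y + b * r Z" if "Y \<in> s" "Z \<in> s" for a b Y Z
    using that by (simp add: r_def Omega_linear im_part_add im_part_scaleR
        real_linear_onD[OF \<eta>] im_s algebra_simps)
  have r0: "r Y = 0" if Y: "Y \<in> s" "re_part Y = 0" for Y
  proof -
    have e: "Y = cscale \<i> (im_part Y)" using re_im_decomp[of Y] Y(2) by simp
    have "- (cscale \<i> Y) \<in> s" using Y(1) by (intro s_closed(4,5))
    then have "im_part Y \<in> s" using e cscale_i_i by (metis minus_minus)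
    then have "im_part Y \<in> k0" using im_s[OF Y(1)] by (simp add: k0_def)
    then have "\<eta> (im_part Y) = Re (\<Omega> X (im_part Y))" using consistent by simp
    also have "\<dots> = Im (\<Omega> X Y)" by (subst (2) e) (simp add: Omega_linear)
    finally show ?thesis by (simp add: r_def)
  qed
  define \<beta> where "\<beta> C = (if C \<in> g0 then r (SOME Y. Y \<in> s \<and> re_part Y = C) else 0)" for C
  have \<beta>: "\<beta> (re_part Y) = r Y" if Y: "Y \<in> s" for Y
  proof -
    define Z where "Z = (SOME Z. Z \<in> s \<and> re_part Z = re_part Y)"
    have Z: "Z \<in> s" "re_part Z = re_part Y"
      using someI[of "\<lambda>Z. Z \<in> s \<and> re_part Z = re_part Y" Y] Y by (auto simp: Z_def)
    have "re_part (1 *\<^sub>R Z + (-1) *\<^sub>R Y) = 0"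
      unfolding re_part_add re_part_scaleR by (simp add: Z)
    moreover have "1 *\<^sub>R Z + (-1) *\<^sub>R Y \<in> s" using Z Y by (simp add: s_closed)
    ultimately have "r (1 *\<^sub>R Z + (-1) *\<^sub>R Y) = 0" using r0 by blast
    then have "r Z = r Y" unfolding r_lin[OF Z(1) Y] by simp
    then show ?thesis using im_s[OF Y] by (simp add: \<beta>_def Z_def)
  qed
  have \<beta>_lin: "real_linear_on g0 \<beta>"
    unfolding real_linear_on_def
  proof (intro ballI allI)
    fix C D a b assume "C \<in> g0" "D \<in> g0"
    then obtain Y Z where YZ: "Y \<in> s" "Z \<in> s" "re_part Y = C" "re_part Z = D"
      using re_part_surj by metis
    have "a *\<^sub>R Y + b *\<^sub>R Z \<in> s"
      using YZ cmat_subspace_imp_subspace[OF s_subspace] by (simp add: subspace_add subspace_scale)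
    from \<beta>[OF this] show "\<beta> (a *\<^sub>R C + b *\<^sub>R D) = a * \<beta> C + b * \<beta> D"
      using \<beta>[OF YZ(1)] \<beta>[OF YZ(2)] YZ by (simp add: re_part_add re_part_scaleR r_lin)
  qed
  have v: "(B, \<beta>) \<in> gtan" using B \<beta>_lin by (auto simp: gtan_def \<beta>_def)
  have "cext \<eta> \<beta> Y = \<Omega> X Y" if Y: "Y \<in> s" for Y
  proof -
    have 1: "Im (cext \<eta> \<beta> Z) = Im (\<Omega> X Z)" if "Z \<in> s" for Z
      using \<beta>[OF that] by (simp add: cext_def r_def)
    have iY: "cscale \<i> Y \<in> s" using Y by (rule s_closed(5))
    have im: "im_part Y \<in> g0" "re_part Y \<in> g0" using im_s[OF Y] by auto
    have "Im (cext \<eta> \<beta> (cscale \<i> Y)) = Re (cext \<eta> \<beta> Y)"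
      by (simp add: cext_def re_part_i im_part_i real_linear_on_minus[OF \<beta>_lin] im)
    with 1[OF iY] have "Re (cext \<eta> \<beta> Y) = Re (\<Omega> X Y)" by (simp add: Omega_linear)
    with 1[OF Y] show ?thesis by (simp add: complex_eq_iff)
  qed
  then have "inL u (B, \<beta>)" using X by (simp add: inL_def X_def A_def \<eta>_def)
  with v show thesis by (rule that)
qed

end

section \<open>The invariant almost complex structure\<close>

lemma gpairing_left_translate:
  "transpose p ** p = mat 1 \<Longrightarrow>
    gpairing (left_translate p u) (left_translate p v) = gpairing u v"
  by (simp add: gpairing_def left_translate_def matrix_inv_orthogonal matrix_mul_assoc)

lemma left_translate_add: "left_translate p (u + v) = left_translate p u + left_translate p v"
  and left_translate_diff: "left_translate p (u - v) = left_translate p u - left_translate p v"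
  and left_translate_minus: "left_translate p (- u) = - left_translate p u"
  and left_translate_gscale: "left_translate p (gscale c u) = gscale c (left_translate p u)"
  by (simp_all add: left_translate_def gscale_def matrix_distribs prod_eq_iff fun_eq_iff)

lemma transpose_orthogonal:
  "transpose p ** p = mat 1 \<Longrightarrow> transpose (transpose p) ** transpose p = mat 1"
  for p :: "'m::finite cmatrix"
  by (simp add: orthogonal_matrix_right)

lemma orthogonal_mult:
  fixes a p :: "'m::finite cmatrix"
  assumes "transpose a ** a = mat 1" "transpose p ** p = mat 1"
  shows "transpose (a ** p) ** (a ** p) = mat 1"
proof -
  have "transpose (a ** p) ** (a ** p) = transpose p ** (transpose a ** a) ** p"
    by (simp add: matrix_transpose_mul matrix_mul_assoc)
  then show ?thesis using assms by simp
qed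

lemma left_translate_mult:
  assumes "transpose a ** a = mat 1" "transpose p ** p = mat 1"
  shows "left_translate a (left_translate p u) = left_translate (a ** p) u"
  using assms orthogonal_mult[OF assms]
  by (simp add: left_translate_def matrix_inv_orthogonal matrix_mul_assoc matrix_transpose_mul)

lemma left_translate_one: "left_translate (mat 1) u = u"
  by (simp add: left_translate_def matrix_inv_orthogonal transpose_mat)

lemma left_translate_inverse:
  assumes "transpose p ** p = mat 1"
  shows "left_translate p (left_translate (transpose p) u) = u"
    "left_translate (transpose p) (left_translate p u) = u"
  using left_translate_mult[OF assms transpose_orthogonal[OF assms]]
    left_translate_mult[OF transpose_orthogonal[OF assms] assms] assms
    orthogonal_matrix_right[OF assms]
  by (simp_all add: left_translate_one)

lemma linear_form_expansion:
  fixes f :: "'a::euclidean_space \<Rightarrow> real"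
  assumes "linear f"
  shows "f x = (\<Sum>b\<in>Basis. (x \<bullet> b) * f b)"
  using arg_cong[OF euclidean_representation[of x], of f] assms
  by (simp add: linear_sum linear_scale)

lemma smooth_inner: "smooth f \<Longrightarrow> smooth (\<lambda>x. f x \<bullet> c)"
  by (rule smooth_compose_linear[OF bounded_linear_inner_left])

lemma smooth_form_apply:
  fixes \<eta> :: "'a::euclidean_space \<Rightarrow> 'b::euclidean_space \<Rightarrow> real"
  assumes "\<And>p. linear (\<eta> p)" "\<And>v. smooth (\<lambda>p. \<eta> p v)" "smooth f"
  shows "smooth (\<lambda>p. \<eta> p (f p))"
  unfolding linear_form_expansion[OF assms(1), of _ "f _"]
  by (intro smooth_sum smooth_bilinear[OF bounded_bilinear_mult] smooth_inner assms)

context admissible_matrix_group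
begin

text \<open>The real endomorphism with \<open>\<i>\<close>-eigenspace \<open>L(s, \<omega>)\<close>: \<open>u - \<i> w\<close> is an eigenvector for \<open>\<i>\<close>
  exactly if \<open>w\<close> is the image of \<open>u\<close>.\<close>

definition J0 :: "'m cmatrix gvec \<Rightarrow> 'm cmatrix gvec" where
  "J0 u = - (THE v. v \<in> gtan \<and> inL u v)"

lemma J0:
  assumes "u \<in> gtan"
  shows J0_gtan: "J0 u \<in> gtan" and J0_inL: "inL u (- J0 u)"
proof -
  obtain v where "v \<in> gtan" "inL u v" using inL_exists[OF assms] .
  then have "\<exists>!v. v \<in> gtan \<and> inL u v" using inL_unique[OF assms] by blast
  from theI'[OF this] have "- J0 u \<in> gtan" "inL u (- J0 u)" by (auto simp: J0_def)
  then show "J0 u \<in> gtan" "inL u (- J0 u)" using gtan_minus[of "- J0 u"] by auto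
qed

lemma J0_eqI:
  assumes "u \<in> gtan" "w \<in> gtan" "inL u (- w)"
  shows "J0 u = w"
proof -
  have "- J0 u = - w"
    using assms by (intro inL_unique[OF assms(1)] gtan_minus J0_gtan J0_inL)
  then show ?thesis by (metis minus_minus)
qed

lemma J0_J0: "u \<in> gtan \<Longrightarrow> J0 (J0 u) = - u"
  using inL_rotate[OF J0_inL] by (intro J0_eqI) (auto simp: J0_gtan gtan_minus)

lemma J0_linear:
  assumes "u \<in> gtan" "v \<in> gtan"
  shows "J0 (gscale a u + gscale b v) = gscale a (J0 u) + gscale b (J0 v)"
proof (rule J0_eqI)
  have "- (gscale a (J0 u) + gscale b (J0 v)) = gscale a (- J0 u) + gscale b (- J0 v)"
    by (simp add: gscale_def prod_eq_iff fun_eq_iff)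
  then show "inL (gscale a u + gscale b v) (- (gscale a (J0 u) + gscale b (J0 v)))"
    using assms by (simp add: inL_add inL_scale J0_inL)
qed (use assms in \<open>auto intro!: gtan_add gtan_scale J0_gtan\<close>)

text \<open>The pairing is preserved because \<open>L(s, \<omega>)\<close> is isotropic: the real part of
  \<open>\<langle>u + \<i> v, u' + \<i> v'\<rangle> = 0\<close> says \<open>\<langle>u, u'\<rangle> = \<langle>v, v'\<rangle>\<close>.\<close>

lemma inL_isotropic:
  assumes uv: "u \<in> gtan" "v \<in> gtan" "u' \<in> gtan" "v' \<in> gtan" and L: "inL u v" "inL u' v'"
  shows "gpairing u u' = gpairing v v'"
proof -
  let ?X = "fst u + cscale \<i> (fst v)" and ?X' = "fst u' + cscale \<i> (fst v')"
  have "cext (snd u) (snd v) ?X' = \<Omega> ?X ?X'" "cext (snd u') (snd v') ?X = \<Omega> ?X' ?X"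
    using L by (auto simp: inL_def)
  then have "cext (snd u) (snd v) ?X' + cext (snd u') (snd v') ?X = 0"
    using Omega_swap[of ?X ?X'] by simp
  then have "Re (cext (snd u) (snd v) ?X') + Re (cext (snd u') (snd v') ?X) = 0"
    by (metis plus_complex.sel(1) zero_complex.sel(1))
  then show ?thesis
    using uv by (simp add: cext_def re_im_of_real_pair gtanD gpairing_def)
qed

lemma J0_pairing: "u \<in> gtan \<Longrightarrow> v \<in> gtan \<Longrightarrow> gpairing (J0 u) (J0 v) = gpairing u v"
  using inL_isotropic[OF _ _ _ _ J0_inL J0_inL, of u v]
    gtan_minus J0_gtan by (simp add: gpairing_def real_linear_on_minus[OF gtanD(2)] gtanD(1))

definition Jfield :: "'m cmatrix \<Rightarrow> 'm cmatrix gvec \<Rightarrow> 'm cmatrix gvec" where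
  "Jfield p u = left_translate p (J0 (left_translate (transpose p) u))"

lemma tangent_space_iff:
  assumes "p \<in> G"
  shows "v \<in> tangent_space G p \<longleftrightarrow> transpose p ** v \<in> g0"
proof
  assume "transpose p ** v \<in> g0"
  moreover have "v = p ** (transpose p ** v)"
    using orthogonal_matrix_right[OF G_orthogonal[OF assms]] by (simp add: matrix_mul_assoc)
  ultimately show "v \<in> tangent_space G p" unfolding tangent_space_G[OF assms] by blast
qed (use G_orthogonal[OF assms] in \<open>auto simp: tangent_space_G[OF assms] matrix_mul_assoc\<close>)

lemma transpose_cancel:
  assumes "p \<in> G"
  shows "transpose p ** (p ** A) = A" "p ** (transpose p ** A) = A"
  using orthogonal_matrix_right[OF G_orthogonal[OF assms]] G_orthogonal[OF assms]
  by (simp_all add: matrix_mul_assoc)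

lemma gtangent_space_iff:
  assumes p: "p \<in> G"
  shows "u \<in> gtangent_space G p \<longleftrightarrow> left_translate (transpose p) u \<in> gtan"
proof -
  have inv: "matrix_inv (transpose p) = p"
    using matrix_inv_orthogonal[OF transpose_orthogonal[OF G_orthogonal[OF p]]] by simp
  have "snd u \<in> cotangent_space G p \<longleftrightarrow>
    real_linear_on g0 (\<lambda>w. snd u (p ** w)) \<and> (\<forall>w. w \<notin> g0 \<longrightarrow> snd u (p ** w) = 0)"
  proof
    assume "snd u \<in> cotangent_space G p"
    then show "real_linear_on g0 (\<lambda>w. snd u (p ** w)) \<and> (\<forall>w. w \<notin> g0 \<longrightarrow> snd u (p ** w) = 0)"
      by (auto simp: cotangent_space_def real_linear_on_def tangent_space_iff[OF p] matrix_distribs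
          transpose_cancel[OF p])
  next
    assume a: "real_linear_on g0 (\<lambda>w. snd u (p ** w)) \<and> (\<forall>w. w \<notin> g0 \<longrightarrow> snd u (p ** w) = 0)"
    show "snd u \<in> cotangent_space G p"
      unfolding cotangent_space_def
    proof (intro CollectI conjI ballI allI impI)
      fix v w a' b assume "v \<in> tangent_space G p" "w \<in> tangent_space G p"
      then show "snd u (a' *\<^sub>R v + b *\<^sub>R w) = a' * snd u v + b * snd u w"
        using real_linear_onD[of g0 "\<lambda>w. snd u (p ** w)" "transpose p ** v" "transpose p ** w" a' b] a
        by (simp add: tangent_space_iff[OF p] matrix_distribs transpose_cancel[OF p])
    next
      fix v assume "v \<notin> tangent_space G p"
      then show "snd u v = 0" using a[THEN conjunct2, rule_format, of "transpose p ** v"]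
        by (simp add: tangent_space_iff[OF p] transpose_cancel[OF p])
    qed
  qed
  then show ?thesis
    by (auto simp: gtangent_space_def left_translate_def gtan_def inv mem_Times_iff
        tangent_space_iff[OF p])
qed

lemma Jfield_closed:
  assumes "p \<in> G" "u \<in> gtangent_space G p"
  shows "Jfield p u \<in> gtangent_space G p"
  using assms left_translate_inverse(2)[OF G_orthogonal]
  by (simp add: gtangent_space_iff Jfield_def J0_gtan)

lemma Jfield_Jfield:
  assumes "p \<in> G" "u \<in> gtangent_space G p"
  shows "Jfield p (Jfield p u) = - u"
  using assms left_translate_inverse[OF G_orthogonal]
  by (simp add: gtangent_space_iff Jfield_def J0_J0 left_translate_minus)

lemma Jfield_pairing:
  assumes "p \<in> G" "u \<in> gtangent_space G p" "v \<in> gtangent_space G p"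
  shows "gpairing (Jfield p u) (Jfield p v) = gpairing u v"
  using assms gpairing_left_translate[OF G_orthogonal]
    gpairing_left_translate[OF transpose_orthogonal[OF G_orthogonal]]
  by (simp add: gtangent_space_iff Jfield_def J0_pairing)

lemma Jfield_linear:
  assumes "p \<in> G" "u \<in> gtangent_space G p" "v \<in> gtangent_space G p"
  shows "Jfield p (gscale a u + gscale b v) = gscale a (Jfield p u) + gscale b (Jfield p v)"
  using assms
  by (simp add: gtangent_space_iff Jfield_def J0_linear left_translate_add left_translate_gscale)

lemma Jfield_invariant:
  assumes "a \<in> G" "p \<in> G"
  shows "Jfield (a ** p) (left_translate a u) = left_translate a (Jfield p u)"
proof -
  note o = G_orthogonal[OF assms(1)] G_orthogonal[OF assms(2)]
  have "left_translate (transpose (a ** p)) (left_translate a u) = left_translate (transpose p) u"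
    using left_translate_mult[OF transpose_orthogonal[OF orthogonal_mult[OF o]] o(1)]
      o by (simp add: matrix_transpose_mul flip: matrix_mul_assoc)
  then show ?thesis by (simp add: Jfield_def left_translate_mult o)
qed

lemma holomorphic_fibre_iff:
  assumes p: "p \<in> G"
  shows "(u, v) \<in> holomorphic_fibre G Jfield p \<longleftrightarrow>
    left_translate (transpose p) u \<in> gtan \<and> left_translate (transpose p) v \<in> gtan \<and>
    inL (left_translate (transpose p) u) (left_translate (transpose p) v)"
    (is "_ \<longleftrightarrow> ?u \<in> _ \<and> ?v \<in> _ \<and> _")
proof -
  note lt = left_translate_inverse[OF G_orthogonal[OF p]]
  have tr: "Jfield p x = y \<longleftrightarrow> J0 (left_translate (transpose p) x) = left_translate (transpose p) y"
    for x y unfolding Jfield_def by (metis lt)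
  show ?thesis
  proof
    assume "(u, v) \<in> holomorphic_fibre G Jfield p"
    then have *: "?u \<in> gtan" "?v \<in> gtan" "J0 ?u = - ?v"
      by (auto simp: holomorphic_fibre_def gtangent_space_iff[OF p] tr left_translate_minus)
    then show "?u \<in> gtan \<and> ?v \<in> gtan \<and> inL ?u ?v" using J0_inL[OF *(1)] by simp
  next
    assume *: "?u \<in> gtan \<and> ?v \<in> gtan \<and> inL ?u ?v"
    then have "J0 ?u = - ?v" by (intro J0_eqI) (auto intro: gtan_minus)
    moreover have "J0 ?v = ?u"
      using * inL_minus[OF inL_rotate, of ?u ?v] by (intro J0_eqI) auto
    ultimately show "(u, v) \<in> holomorphic_fibre G Jfield p"
      using * by (auto simp: holomorphic_fibre_def gtangent_space_iff[OF p] tr left_translate_minus)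
  qed
qed

text \<open>A complex linear form on \<open>g\<close> is the extension \<open>cext\<close> of its real and imaginary parts on the
  real form.\<close>

lemma holomorphic_at_identity_Jfield: "holomorphic_at_identity g G Jfield = L_space g s \<omega>"
proof -
  have hol: "(u, v) \<in> holomorphic_fibre G Jfield (mat 1) \<longleftrightarrow> u \<in> gtan \<and> v \<in> gtan \<and> inL u v" for u v
    using holomorphic_fibre_iff[OF one_in_G] by (simp add: transpose_mat left_translate_one)
  have T: "tangent_space G (mat 1) = g0"
    using tangent_space_iff[OF one_in_G] by (auto simp: transpose_mat)
  have ext: "\<xi> Y = cext \<alpha> \<beta> Y"
    if "\<xi> \<in> complex_dual g" "\<And>C. C \<in> g0 \<Longrightarrow> \<xi> C = complex_of_real (\<alpha> C) + \<i> * complex_of_real (\<beta> C)"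
      "Y \<in> g" for \<xi> \<alpha> \<beta> Y
  proof -
    have "re_part Y \<in> g" "im_part Y \<in> g"
      using re_part_g0 im_part_g0 that(3) by (auto simp: real_form_def)
    then have "\<xi> (cscale 1 (re_part Y) + cscale \<i> (im_part Y)) = 1 * \<xi> (re_part Y) + \<i> * \<xi> (im_part Y)"
      using that(1) unfolding complex_dual_def complex_linear_on_def by blast
    then show ?thesis using that(2)[OF re_part_g0] that(2)[OF im_part_g0] that(3)
      by (simp add: re_im_decomp cext_def complex_eq_iff)
  qed
  show ?thesis
  proof (intro equalityI subsetI)
    fix z assume "z \<in> holomorphic_at_identity g G Jfield"
    then obtain X \<xi> A \<alpha> B \<beta> where z: "z = (X, \<xi>)" "\<xi> \<in> complex_dual g"
      "inL (A, \<alpha>) (B, \<beta>)" "X = A + cscale \<i> B"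
      "\<And>C. C \<in> g0 \<Longrightarrow> \<xi> C = complex_of_real (\<alpha> C) + \<i> * complex_of_real (\<beta> C)"
      unfolding holomorphic_at_identity_def T hol by blast
    have "\<xi> Y = \<omega> X Y" if "Y \<in> s" for Y
      using z(3,4) ext[OF z(2,5)] s_subset that by (auto simp: inL_def Omega_eq)
    moreover have "X \<in> s" using z(3,4) by (simp add: inL_def)
    ultimately show "z \<in> L_space g s \<omega>" using z(1,2) by (simp add: L_space_def)
  next
    fix z assume "z \<in> L_space g s \<omega>"
    then obtain X \<xi> where z: "z = (X, \<xi>)" "X \<in> s" "\<xi> \<in> complex_dual g" "\<And>Y. Y \<in> s \<Longrightarrow> \<xi> Y = \<omega> X Y"
      by (auto simp: L_space_def)
    define \<alpha> \<beta> where "\<alpha> C = (if C \<in> g0 then Re (\<xi> C) else 0)"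
      and "\<beta> C = (if C \<in> g0 then Im (\<xi> C) else 0)" for C
    have Xg: "X \<in> g" using z(2) s_subset by blast
    have lin: "\<xi> (a *\<^sub>R v + b *\<^sub>R w) = a * \<xi> v + b * \<xi> w" if "v \<in> g0" "w \<in> g0" for a b v w
      using z(3) that unfolding complex_dual_def complex_linear_on_def real_form_def
      by (auto simp flip: cscale_of_real)
    have gt: "(re_part X, \<alpha>) \<in> gtan" "(im_part X, \<beta>) \<in> gtan"
      using re_part_g0[OF Xg] im_part_g0[OF Xg] g0_closed
      by (auto simp: gtan_def \<alpha>_def \<beta>_def real_linear_on_def lin)
    have \<xi>: "\<xi> C = complex_of_real (\<alpha> C) + \<i> * complex_of_real (\<beta> C)" if "C \<in> g0" for C
      using that by (simp add: \<alpha>_def \<beta>_def complex_eq_iff)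
    have "inL (re_part X, \<alpha>) (im_part X, \<beta>)"
      unfolding inL_def using z(2,4) s_subset ext[OF z(3) \<xi>, symmetric]
      by (auto simp: re_im_decomp Omega_eq)
    with gt \<xi> z(1,3) show "z \<in> holomorphic_at_identity g G Jfield"
      unfolding holomorphic_at_identity_def T hol using re_im_decomp[of X, symmetric] by blast
  qed
qed

lemma associated_subalgebra_Jfield: "associated_subalgebra g G Jfield = s"
proof
  show "s \<subseteq> associated_subalgebra g G Jfield"
  proof
    fix X assume X: "X \<in> s"
    have "(\<lambda>Y. if Y \<in> g then \<Omega> X Y else 0) \<in> complex_dual g"
      by (auto simp: complex_dual_def complex_linear_on_def Omega_linear g_closed)
    then have "(X, \<lambda>Y. if Y \<in> g then \<Omega> X Y else 0) \<in> L_space g s \<omega>"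
      using X s_subset by (auto simp: L_space_def Omega_eq)
    then show "X \<in> associated_subalgebra g G Jfield"
      unfolding associated_subalgebra_def holomorphic_at_identity_Jfield by force
  qed
qed (auto simp: associated_subalgebra_def holomorphic_at_identity_Jfield L_space_def)

subsection \<open>Smoothness\<close>

lemma J0_sum:
  assumes "finite C" "\<And>c. c \<in> C \<Longrightarrow> e c \<in> gtan"
  shows "(\<Sum>c\<in>C. gscale (a c) (e c)) \<in> gtan \<and>
    J0 (\<Sum>c\<in>C. gscale (a c) (e c)) = (\<Sum>c\<in>C. gscale (a c) (J0 (e c)))"
  using assms
proof (induction C rule: finite_induct)
  case empty
  have z: "0 \<in> gtan" by (simp add: gtan_def real_linear_on_def g0_closed zero_prod_def)
  have "gscale 0 0 + gscale 0 0 = (0 :: 'm cmatrix gvec)" "gscale 0 (J0 0) + gscale 0 (J0 0) = 0"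
    by (auto simp: gscale_def prod_eq_iff fun_eq_iff)
  then have "J0 0 = 0" using J0_linear[OF z z, of 0 0] by simp
  then show ?case using z by simp
next
  case (insert c C)
  have "gscale (a c) (e c) + (\<Sum>c\<in>C. gscale (a c) (e c)) =
    gscale (a c) (e c) + gscale 1 (\<Sum>c\<in>C. gscale (a c) (e c))"
    "gscale (a c) (J0 (e c)) + gscale 1 (\<Sum>c\<in>C. gscale (a c) (J0 (e c)))
     = gscale (a c) (J0 (e c)) + (\<Sum>c\<in>C. gscale (a c) (J0 (e c)))"
    by (auto simp: gscale_def prod_eq_iff)
  then show ?case using insert J0_linear[of "e c" "\<Sum>c\<in>C. gscale (a c) (e c)" "a c" 1]
    by (simp add: gtan_add gtan_scale)
qed

lemma snd_sum_apply: "snd (\<Sum>c\<in>C. f c) x = (\<Sum>c\<in>C. snd (f c) x)"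
  for f :: "'c \<Rightarrow> 'm cmatrix gvec"
  by (induction C rule: infinite_finite_induct) auto

text \<open>In an orthonormal basis of the real form, \<open>J0\<close> has constant coefficients. On the group the
  inverse is the transpose, so translating to the identity and back is polynomial and makes
  sense on all matrices.\<close>

lemma Jfield_smooth:
  assumes \<sigma>: "gsection G \<sigma>"
  shows "\<exists>\<rho>. gsection G \<rho> \<and> (\<forall>p\<in>G. gvalue G \<rho> p = Jfield p (gvalue G \<sigma> p))"
proof -
  obtain B where B: "finite B" "B \<subseteq> g0"
    and expand: "\<And>x. x \<in> g0 \<Longrightarrow> (\<Sum>i\<in>B. (x \<bullet> i) *\<^sub>R i) = x"
    by (rule orthonormal_basis_expansion[OF g0_subspace]) blast
  have expand_form: "f x = (\<Sum>i\<in>B. (x \<bullet> i) * f i)" if "real_linear_on g0 f" "x \<in> g0" for f x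
    using real_linear_on_sum[OF that(1) g0_subspace B(1), of "\<lambda>i. i" "\<lambda>i. x \<bullet> i"]
      B(2) expand[OF that(2)] by auto
  define e1 where "e1 c = (c, 0 :: 'm cmatrix \<Rightarrow> real)" for c :: "'m cmatrix"
  define e2 where "e2 c = (0 :: 'm cmatrix, \<lambda>v. if v \<in> g0 then v \<bullet> c else 0)" for c
  have e: "e1 c \<in> gtan" "e2 c \<in> gtan" if "c \<in> B" for c
    using B(2) that
    by (auto simp: e1_def e2_def gtan_def real_linear_on_def g0_closed inner_add_left)
  define x1 where "x1 q c = (transpose q ** fst \<sigma> q) \<bullet> c" for q c
  define x2 where "x2 q c = snd \<sigma> q (q ** c)" for q c
  define W where "W q = (\<Sum>c\<in>B. gscale (x1 q c) (J0 (e1 c))) + (\<Sum>c\<in>B. gscale (x2 q c) (J0 (e2 c)))"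
    for q
  define \<rho> where "\<rho> = (\<lambda>q. q ** fst (W q), \<lambda>q v. \<Sum>d\<in>B. ((transpose q ** v) \<bullet> d) * snd (W q) d)"
  have \<sigma>1: "smooth (fst \<sigma>)" and \<sigma>2: "\<And>p. linear (snd \<sigma> p)" "\<And>v. smooth (\<lambda>p. snd \<sigma> p v)"
    and \<sigma>3: "\<And>p. p \<in> G \<Longrightarrow> fst \<sigma> p \<in> tangent_space G p"
    using \<sigma> by (auto simp: gsection_def)
  have x: "smooth (\<lambda>q. x1 q c)" "smooth (\<lambda>q. x2 q c)" for c
    unfolding x1_def x2_def
    by (intro smooth_inner smooth_matrix_mult smooth_transpose smooth_id \<sigma>1)
      (intro smooth_form_apply[OF \<sigma>2] smooth_matrix_mult smooth_id smooth_const)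
  have W1: "fst (W q) = (\<Sum>c\<in>B. x1 q c *\<^sub>R fst (J0 (e1 c))) + (\<Sum>c\<in>B. x2 q c *\<^sub>R fst (J0 (e2 c)))" for q
    by (simp add: W_def gscale_def fst_sum)
  have W2: "snd (W q) d = (\<Sum>c\<in>B. x1 q c * snd (J0 (e1 c)) d) + (\<Sum>c\<in>B. x2 q c * snd (J0 (e2 c)) d)"
    for q d by (simp add: W_def gscale_def snd_sum_apply)
  have sm1: "smooth (fst \<rho>)"
    unfolding \<rho>_def fst_conv W1
    by (intro smooth_matrix_mult smooth_id smooth_add smooth_sum
        smooth_bilinear[OF bounded_bilinear_scaleR] x smooth_const)
  have sm2: "smooth (\<lambda>p. snd \<rho> p v)" for v
    unfolding \<rho>_def snd_conv W2
    by (intro smooth_sum smooth_bilinear[OF bounded_bilinear_mult] smooth_inner smooth_matrix_mult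
        smooth_transpose smooth_id smooth_add x smooth_const)
  have lin: "linear (snd \<rho> p)" for p
    unfolding \<rho>_def snd_conv
    by (intro linearI) (simp_all add: matrix_distribs inner_add_left distrib_right sum.distrib
        sum_distrib_left mult.assoc)
  have W: "W p \<in> gtan \<and> Jfield p (gvalue G \<sigma> p) = left_translate p (W p)" if p: "p \<in> G" for p
  proof -
    have inv: "matrix_inv (transpose p) = p"
      using matrix_inv_orthogonal[OF transpose_orthogonal[OF G_orthogonal[OF p]]] by simp
    have x1: "transpose p ** fst \<sigma> p \<in> g0" using \<sigma>3[OF p] tangent_space_iff[OF p] by simp
    have lin: "real_linear_on g0 (\<lambda>w. snd \<sigma> p (p ** w))"
      by (simp add: real_linear_on_def matrix_distribs linear_add[OF \<sigma>2(1)] linear_scale[OF \<sigma>2(1)])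
    let ?u = "left_translate (transpose p) (gvalue G \<sigma> p)"
    let ?S1 = "\<Sum>c\<in>B. gscale (x1 p c) (e1 c)" and ?S2 = "\<Sum>c\<in>B. gscale (x2 p c) (e2 c)"
    have "?u = ?S1 + ?S2"
    proof (rule prod_eqI)
      show "fst ?u = fst (?S1 + ?S2)"
        using expand[OF x1]
        by (simp add: left_translate_def gvalue_def fst_sum gscale_def e1_def e2_def x1_def)
      show "snd ?u = snd (?S1 + ?S2)"
      proof
        fix w show "snd ?u w = snd (?S1 + ?S2) w"
          using expand_form[OF lin, of w]
          by (simp add: left_translate_def gvalue_def snd_sum_apply gscale_def e1_def e2_def x2_def
              inv tangent_space_iff[OF p] transpose_cancel[OF p] mult.commute)
      qed
    qed
    moreover have "?S1 \<in> gtan" "J0 ?S1 = (\<Sum>c\<in>B. gscale (x1 p c) (J0 (e1 c)))"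
      "?S2 \<in> gtan" "J0 ?S2 = (\<Sum>c\<in>B. gscale (x2 p c) (J0 (e2 c)))"
      using J0_sum[OF B(1), of e1] J0_sum[OF B(1), of e2] e by auto
    moreover have "gscale 1 u = u" for u :: "'m cmatrix gvec" by (simp add: gscale_def)
    ultimately have "?u \<in> gtan" "J0 ?u = W p"
      using J0_linear[of ?S1 ?S2 1 1] by (auto simp: W_def gtan_add)
    then show ?thesis using J0_gtan[of ?u] by (simp add: Jfield_def)
  qed
  have val: "gvalue G \<rho> p = left_translate p (W p)" if p: "p \<in> G" for p
  proof (rule prod_eqI)
    show "snd (gvalue G \<rho> p) = snd (left_translate p (W p))"
    proof
      fix v
      have "snd (W p) (transpose p ** v) = 0" if "transpose p ** v \<notin> g0"
        using W[OF p] that gtanD(3) by blast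
      moreover have "snd (W p) (transpose p ** v) = snd \<rho> p v" if "transpose p ** v \<in> g0"
        using expand_form[OF gtanD(2) that] W[OF p] by (simp add: \<rho>_def)
      ultimately show "snd (gvalue G \<rho> p) v = snd (left_translate p (W p)) v"
        using matrix_inv_orthogonal[OF G_orthogonal[OF p]]
        by (simp add: gvalue_def left_translate_def tangent_space_iff[OF p])
    qed
  qed (simp add: gvalue_def left_translate_def \<rho>_def)
  have "fst \<rho> p \<in> tangent_space G p" if "p \<in> G" for p
    using W[OF that] gtanD(1)[of "W p"] by (auto simp: \<rho>_def tangent_space_G[OF that])
  then have "gsection G \<rho>" using sm1 sm2 lin by (simp add: gsection_def)
  with val W show ?thesis by metis
qed

end

section \<open>Integrability\<close>

lemma frechet_derivative_eqI:
  "(f has_derivative f') (at p) \<Longrightarrow> frechet_derivative f (at p) v = f' v"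
  by (simp flip: frechet_derivative_at)

lemma has_frechet_derivative:
  "(f has_derivative f') (at p) \<Longrightarrow> (f has_derivative frechet_derivative f (at p)) (at p)"
  using frechet_derivative_works differentiableI by blast

lemma form_apply_has_derivative:
  fixes \<eta> :: "'a::euclidean_space \<Rightarrow> 'b::euclidean_space \<Rightarrow> real"
  assumes lin: "\<And>p. linear (\<eta> p)" and sm: "\<And>v. smooth (\<lambda>p. \<eta> p v)"
    and f: "(f has_derivative f') (at p)"
  shows "((\<lambda>q. \<eta> q (f q)) has_derivative
    (\<lambda>v. frechet_derivative (\<lambda>q. \<eta> q (f p)) (at p) v + \<eta> p (f' v))) (at p)"
proof -
  have D: "((\<lambda>q. \<Sum>b\<in>Basis. (h q \<bullet> b) * \<eta> q b) has_derivative
    (\<lambda>v. \<Sum>b\<in>Basis. (h p \<bullet> b) * frechet_derivative (\<lambda>q. \<eta> q b) (at p) v + (h' v \<bullet> b) * \<eta> p b)) (at p)"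
    if "(h has_derivative h') (at p)" for h h'
    by (intro has_derivative_sum has_derivative_mult has_derivative_inner_left that
        smooth_has_derivative sm)
  have "((\<lambda>q. \<eta> q (f p)) has_derivative
    (\<lambda>v. \<Sum>b\<in>Basis. (f p \<bullet> b) * frechet_derivative (\<lambda>q. \<eta> q b) (at p) v)) (at p)"
    using D[of "\<lambda>q. f p" "\<lambda>v. 0"] linear_form_expansion[OF lin, of _ "f p"] by simp
  then have "frechet_derivative (\<lambda>q. \<eta> q (f p)) (at p) v =
    (\<Sum>b\<in>Basis. (f p \<bullet> b) * frechet_derivative (\<lambda>q. \<eta> q b) (at p) v)" for v
    by (rule frechet_derivative_eqI)
  then show ?thesis
    using D[OF f] linear_form_expansion[OF lin, of _ "f _"] linear_form_expansion[OF lin, of _ "f' _"]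
    by (simp add: sum.distrib)
qed

context admissible_matrix_group
begin

text \<open>The components of a section in the left trivialization; the inverse is written as the
  transpose, which makes them smooth on all matrices.\<close>

definition body :: "'m cmatrix gfield \<Rightarrow> 'm cmatrix \<Rightarrow> 'm cmatrix" where
  "body \<sigma> q = transpose q ** fst \<sigma> q"

definition coform :: "'m cmatrix gfield \<Rightarrow> 'm cmatrix \<Rightarrow> 'm cmatrix \<Rightarrow> real" where
  "coform \<sigma> q C = snd \<sigma> q (q ** C)"

definition dbody :: "'m cmatrix \<Rightarrow> 'm cmatrix gfield \<Rightarrow> 'm cmatrix \<Rightarrow> 'm cmatrix" where
  "dbody p \<sigma> v = frechet_derivative (body \<sigma>) (at p) v"

lemma gsectionD:
  assumes "gsection G \<sigma>"
  shows "smooth (fst \<sigma>)" "linear (snd \<sigma> p)" "smooth (\<lambda>p. snd \<sigma> p v)"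
    "p \<in> G \<Longrightarrow> body \<sigma> p \<in> g0" "p \<in> G \<Longrightarrow> fst \<sigma> p = p ** body \<sigma> p"
  using assms by (auto simp: gsection_def body_def transpose_cancel simp flip: tangent_space_iff)

lemma body_has_derivative:
  assumes "gsection G \<sigma>"
  shows "(body \<sigma> has_derivative dbody p \<sigma>) (at p)"
proof -
  have "smooth (body \<sigma>)"
    unfolding body_def
    by (intro smooth_matrix_mult smooth_transpose smooth_id gsectionD(1)[OF assms])
  from smooth_has_derivative[OF this] show ?thesis
    unfolding dbody_def .
qed

lemma translate_tangent: "p \<in> G \<Longrightarrow> C \<in> g0 \<Longrightarrow> p ** C \<in> tangent_space G p"
  by (auto simp: tangent_space_G)

lemma dbody_g0:
  assumes "gsection G \<sigma>" "p \<in> G" "C \<in> g0"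
  shows "dbody p \<sigma> (p ** C) \<in> g0"
  using derivative_along_subspace[OF body_has_derivative[OF assms(1)] g0_subspace
      gsectionD(4)[OF assms(1)] assms(2) translate_tangent] assms by blast

lemma field_derivative:
  assumes \<sigma>: "gsection G \<sigma>" and p: "p \<in> G" and C: "C \<in> g0"
  shows "frechet_derivative (fst \<sigma>) (at p) (p ** C) = p ** (C ** body \<sigma> p + dbody p \<sigma> (p ** C))"
proof -
  have 1: "((\<lambda>q. q ** body \<sigma> q) has_derivative (\<lambda>v. p ** dbody p \<sigma> v + v ** body \<sigma> p)) (at p)"
    by (rule bounded_bilinear.FDERIV[OF bounded_bilinear_matrix_mult has_derivative_ident
          body_has_derivative[OF \<sigma>]])
  have "frechet_derivative (fst \<sigma>) (at p) (p ** C) = p ** dbody p \<sigma> (p ** C) + (p ** C) ** body \<sigma> p"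
    by (rule derivative_along_eqI[OF smooth_has_derivative[OF gsectionD(1)[OF \<sigma>]] 1
          gsectionD(5)[OF \<sigma>] p translate_tangent[OF p C]])
  then show ?thesis by (simp add: matrix_distribs matrix_mul_assoc)
qed

lemma coform_has_derivative:
  assumes \<sigma>: "gsection G \<sigma>" and f: "(f has_derivative f') (at p)"
  shows "((\<lambda>q. coform \<sigma> q (f q)) has_derivative
    (\<lambda>v. frechet_derivative (\<lambda>q. snd \<sigma> q (p ** f p)) (at p) v + snd \<sigma> p (p ** f' v + v ** f p))) (at p)"
  unfolding coform_def
  by (rule form_apply_has_derivative[OF gsectionD(2,3)[OF \<sigma>]
        bounded_bilinear.FDERIV[OF bounded_bilinear_matrix_mult has_derivative_ident f]])

lemma coform_const_has_derivative:
  assumes \<sigma>: "gsection G \<sigma>"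
  shows "((\<lambda>q. coform \<sigma> q C) has_derivative frechet_derivative (\<lambda>q. coform \<sigma> q C) (at p)) (at p)"
  by (rule has_frechet_derivative[OF coform_has_derivative[OF \<sigma> has_derivative_const]])

lemma coform_body_has_derivative:
  assumes \<sigma>: "gsection G \<sigma>" and \<rho>: "gsection G \<rho>"
  shows "((\<lambda>q. coform \<rho> q (body \<sigma> q)) has_derivative
    frechet_derivative (\<lambda>q. coform \<rho> q (body \<sigma> q)) (at p)) (at p)"
  by (rule has_frechet_derivative[OF coform_has_derivative[OF \<rho> body_has_derivative[OF \<sigma>]]])

lemma coform_linear:
  assumes \<sigma>: "gsection G \<sigma>"
  shows "coform \<sigma> q (C + D) = coform \<sigma> q C + coform \<sigma> q D"
    "coform \<sigma> q (C - D) = coform \<sigma> q C - coform \<sigma> q D"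
  by (simp_all add: coform_def matrix_distribs linear_add[OF gsectionD(2)[OF \<sigma>]]
      linear_diff[OF gsectionD(2)[OF \<sigma>]])

text \<open>Compared with the constant field \<open>p C\<close>, the left-invariant field of \<open>C\<close> contributes the bracket of
  \<open>C\<close> with the vector part.\<close>

lemma Lie_derivative_form_translated:
  assumes \<sigma>: "gsection G \<sigma>" and \<rho>: "gsection G \<rho>" and p: "p \<in> G" and C: "C \<in> g0"
  shows "Lie_derivative_form (fst \<sigma>) (snd \<rho>) p (p ** C) =
    frechet_derivative (\<lambda>q. coform \<rho> q C) (at p) (p ** body \<sigma> p)
    + coform \<rho> p (commutator C (body \<sigma> p) + dbody p \<sigma> (p ** C))"
proof -
  note lin = linear_add[OF gsectionD(2)[OF \<rho>]] linear_diff[OF gsectionD(2)[OF \<rho>]]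
  have "frechet_derivative (\<lambda>q. coform \<rho> q C) (at p) v =
    frechet_derivative (\<lambda>q. snd \<rho> q (p ** C)) (at p) v + snd \<rho> p (v ** C)" for v
    using frechet_derivative_eqI[OF coform_has_derivative[OF \<rho> has_derivative_const]] by simp
  then show ?thesis
    by (simp add: Lie_derivative_form_def field_derivative[OF \<sigma> p C] gsectionD(5)[OF \<sigma> p]
        coform_def commutator_def matrix_distribs matrix_mul_assoc lin)
qed

text \<open>The form part of the Courant bracket is the skew-symmetrization of this expression.\<close>

definition half_bracket :: "'m cmatrix \<Rightarrow> 'm cmatrix gfield \<Rightarrow> 'm cmatrix gfield \<Rightarrow> 'm cmatrix \<Rightarrow> real"
  where "half_bracket p \<sigma> \<rho> C =
    frechet_derivative (\<lambda>q. coform \<rho> q C) (at p) (p ** body \<sigma> p)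
    + coform \<rho> p (commutator C (body \<sigma> p) + dbody p \<sigma> (p ** C))
    - frechet_derivative (\<lambda>q. coform \<rho> q (body \<sigma> q)) (at p) (p ** C) / 2"

lemma pairing_has_derivative:
  assumes \<sigma>: "gsection G \<sigma>" and \<rho>: "gsection G \<rho>"
  shows "((\<lambda>q. snd \<rho> q (fst \<sigma> q) - snd \<sigma> q (fst \<rho> q)) has_derivative
     frechet_derivative (\<lambda>q. snd \<rho> q (fst \<sigma> q) - snd \<sigma> q (fst \<rho> q)) (at p)) (at p)"
  by (rule has_frechet_derivative[OF has_derivative_diff[OF
        form_apply_has_derivative[OF gsectionD(2,3)[OF \<rho>] smooth_has_derivative[OF gsectionD(1)[OF \<sigma>]]]
        form_apply_has_derivative[OF gsectionD(2,3)[OF \<sigma>] smooth_has_derivative[OF gsectionD(1)[OF \<rho>]]]]])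

lemma snd_courant_bracket_translated:
  assumes \<sigma>: "gsection G \<sigma>" and \<rho>: "gsection G \<rho>" and p: "p \<in> G" and C: "C \<in> g0"
  shows "snd (courant_bracket \<sigma> \<rho>) p (p ** C) = half_bracket p \<sigma> \<rho> C - half_bracket p \<rho> \<sigma> C"
proof -
  note d = pairing_has_derivative[OF \<sigma> \<rho>, of p]
  have "frechet_derivative (\<lambda>q. snd \<rho> q (fst \<sigma> q) - snd \<sigma> q (fst \<rho> q)) (at p) (p ** C) =
    frechet_derivative (\<lambda>q. coform \<rho> q (body \<sigma> q)) (at p) (p ** C)
    - frechet_derivative (\<lambda>q. coform \<sigma> q (body \<rho> q)) (at p) (p ** C)"
    by (rule derivative_along_eqI[OF d has_derivative_diff[OF coform_body_has_derivative[OF \<sigma> \<rho>]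
            coform_body_has_derivative[OF \<rho> \<sigma>]] _ p translate_tangent[OF p C]])
      (simp add: coform_def gsectionD(5)[OF \<sigma>] gsectionD(5)[OF \<rho>])
  then show ?thesis
    by (simp add: courant_bracket_def half_bracket_def Lie_derivative_form_translated \<sigma> \<rho> p C
        diff_divide_distrib)
qed

lemma fst_courant_bracket_translated:
  assumes \<sigma>: "gsection G \<sigma>" and \<rho>: "gsection G \<rho>" and p: "p \<in> G"
  shows "fst (courant_bracket \<sigma> \<rho>) p =
    p ** (commutator (body \<sigma> p) (body \<rho> p) + dbody p \<rho> (p ** body \<sigma> p) - dbody p \<sigma> (p ** body \<rho> p))"
  by (simp add: courant_bracket_def Lie_bracket_field_def gsectionD(5)[OF \<sigma> p] gsectionD(5)[OF \<rho> p]
      field_derivative[OF \<sigma> p gsectionD(4)[OF \<rho> p]] field_derivative[OF \<rho> p gsectionD(4)[OF \<sigma> p]]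
      commutator_def matrix_distribs)

lemma linear_Lie_derivative_form:
  assumes \<sigma>: "gsection G \<sigma>" and \<rho>: "gsection G \<rho>"
  shows "linear (Lie_derivative_form (fst \<sigma>) (snd \<rho>) p)"
proof -
  note lin = gsectionD(2)[OF \<rho>]
  have d: "((\<lambda>q. snd \<rho> q v) has_derivative frechet_derivative (\<lambda>q. snd \<rho> q v) (at p)) (at p)" for v
    by (rule smooth_has_derivative[OF gsectionD(3)[OF \<rho>]])
  have X: "linear (frechet_derivative (fst \<sigma>) (at p))"
    using smooth_has_derivative[OF gsectionD(1)[OF \<sigma>]] has_derivative_linear by blast
  show ?thesis
  proof (rule linearI)
    fix v w
    show "Lie_derivative_form (fst \<sigma>) (snd \<rho>) p (v + w) =
      Lie_derivative_form (fst \<sigma>) (snd \<rho>) p v + Lie_derivative_form (fst \<sigma>) (snd \<rho>) p w"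
      using frechet_derivative_eqI[OF has_derivative_add[OF d[of v] d[of w]]]
      by (simp add: Lie_derivative_form_def linear_add[OF lin] linear_add[OF X])
  next
    fix r v
    show "Lie_derivative_form (fst \<sigma>) (snd \<rho>) p (r *\<^sub>R v) = r *\<^sub>R Lie_derivative_form (fst \<sigma>) (snd \<rho>) p v"
      using frechet_derivative_eqI[OF has_derivative_mult_right[OF d[of v], of r]]
      by (simp add: Lie_derivative_form_def linear_scale[OF lin] linear_scale[OF X] distrib_left)
  qed
qed

lemma linear_snd_courant_bracket:
  assumes \<sigma>: "gsection G \<sigma>" and \<rho>: "gsection G \<rho>"
  shows "linear (snd (courant_bracket \<sigma> \<rho>) p)"
proof -
  note F = has_derivative_linear[OF pairing_has_derivative[OF \<sigma> \<rho>]]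
  note L = linear_Lie_derivative_form[OF \<sigma> \<rho>, of p] linear_Lie_derivative_form[OF \<rho> \<sigma>, of p]
  show ?thesis
    by (intro linearI)
      (simp_all add: courant_bracket_def linear_add[OF F] linear_scale[OF F] linear_add[OF L(1)]
        linear_scale[OF L(1)] linear_add[OF L(2)] linear_scale[OF L(2)] algebra_simps add_divide_distrib)
qed

subsection \<open>Complex sections of the holomorphic subbundle\<close>

definition holomorphic_section :: "'m cmatrix gfield \<Rightarrow> 'm cmatrix gfield \<Rightarrow> bool" where
  "holomorphic_section \<sigma> \<sigma>' \<longleftrightarrow> gsection G \<sigma> \<and> gsection G \<sigma>' \<and>
     (\<forall>p\<in>G. (gvalue G \<sigma> p, gvalue G \<sigma>' p) \<in> holomorphic_fibre G Jfield p)"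

text \<open>The vector part, as a complex matrix, of the section \<open>\<sigma> + \<i> \<sigma>'\<close> of the complexification.\<close>

definition cbody :: "'m cmatrix gfield \<Rightarrow> 'm cmatrix gfield \<Rightarrow> 'm cmatrix \<Rightarrow> 'm cmatrix" where
  "cbody \<sigma> \<sigma>' q = body \<sigma> q + cscale \<i> (body \<sigma>' q)"

definition dcbody :: "'m cmatrix \<Rightarrow> 'm cmatrix gfield \<Rightarrow> 'm cmatrix gfield \<Rightarrow> 'm cmatrix \<Rightarrow> 'm cmatrix" where
  "dcbody p \<sigma> \<sigma>' C = dbody p \<sigma> (p ** C) + cscale \<i> (dbody p \<sigma>' (p ** C))"

text \<open>The derivative along the left-invariant complex vector field \<open>Y\<close>.\<close>

definition Dcbody :: "'m cmatrix \<Rightarrow> 'm cmatrix gfield \<Rightarrow> 'm cmatrix gfield \<Rightarrow> 'm cmatrix \<Rightarrow> 'm cmatrix" where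
  "Dcbody p \<sigma> \<sigma>' Y = dcbody p \<sigma> \<sigma>' (re_part Y) + cscale \<i> (dcbody p \<sigma> \<sigma>' (im_part Y))"

lemma re_im_in_g0: "Y \<in> s \<Longrightarrow> re_part Y \<in> g0" "Y \<in> s \<Longrightarrow> im_part Y \<in> g0"
  using s_subset re_part_g0 im_part_g0 by auto

lemma holomorphic_sectionD:
  assumes "holomorphic_section \<sigma> \<sigma>'"
  shows "gsection G \<sigma>" "gsection G \<sigma>'"
    "q \<in> G \<Longrightarrow> cbody \<sigma> \<sigma>' q \<in> s"
    "q \<in> G \<Longrightarrow> Y \<in> s \<Longrightarrow> cext (coform \<sigma> q) (coform \<sigma>' q) Y = \<Omega> (cbody \<sigma> \<sigma>' q) Y"
proof -
  show "gsection G \<sigma>" "gsection G \<sigma>'" using assms by (auto simp: holomorphic_section_def)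
  have val: "snd (left_translate (transpose q) (gvalue G \<rho> q)) C = coform \<rho> q C"
    if "q \<in> G" "C \<in> g0" for q \<rho> C
    using matrix_inv_orthogonal[OF transpose_orthogonal[OF G_orthogonal[OF that(1)]]] that
    by (simp add: left_translate_def gvalue_def coform_def translate_tangent)
  have fstv: "fst (left_translate (transpose q) (gvalue G \<rho> q)) = body \<rho> q" for q \<rho>
    by (simp add: left_translate_def gvalue_def body_def)
  have L: "inL (left_translate (transpose q) (gvalue G \<sigma> q)) (left_translate (transpose q) (gvalue G \<sigma>' q))"
    if "q \<in> G" for q
    using assms that by (auto simp: holomorphic_section_def holomorphic_fibre_iff)
  show "cbody \<sigma> \<sigma>' q \<in> s" if "q \<in> G"
    using L[OF that] by (simp add: inL_def fstv cbody_def)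
  show "cext (coform \<sigma> q) (coform \<sigma>' q) Y = \<Omega> (cbody \<sigma> \<sigma>' q) Y" if "q \<in> G" "Y \<in> s"
  proof -
    have "cext (snd (left_translate (transpose q) (gvalue G \<sigma> q)))
        (snd (left_translate (transpose q) (gvalue G \<sigma>' q))) Y = \<Omega> (cbody \<sigma> \<sigma>' q) Y"
      using L[OF that(1)] that(2) by (auto simp: inL_def fstv cbody_def)
    then show ?thesis
      using val[OF that(1)] re_im_in_g0[OF that(2)] by (simp add: cext_def)
  qed
qed

lemma bounded_linear_cscale: "bounded_linear (cscale c :: 'm cmatrix \<Rightarrow> 'm cmatrix)"
  by (intro linear_conv_bounded_linear[THEN iffD1] linearI)
    (simp_all add: cmat.scale_right_distrib scaleR_cscale)

lemma cbody_has_derivative: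
  assumes "holomorphic_section \<sigma> \<sigma>'"
  shows "(cbody \<sigma> \<sigma>' has_derivative (\<lambda>v. dbody p \<sigma> v + cscale \<i> (dbody p \<sigma>' v))) (at p)"
  unfolding cbody_def
  by (intro has_derivative_add bounded_linear.has_derivative[OF bounded_linear_cscale]
      body_has_derivative holomorphic_sectionD[OF assms])

lemma dcbody_s:
  assumes "holomorphic_section \<sigma> \<sigma>'" "p \<in> G" "C \<in> g0"
  shows "dcbody p \<sigma> \<sigma>' C \<in> s"
  unfolding dcbody_def
  by (rule derivative_along_subspace[OF cbody_has_derivative[OF assms(1)]
        cmat_subspace_imp_subspace[OF s_subspace] holomorphic_sectionD(3)[OF assms(1)] assms(2)
        translate_tangent[OF assms(2,3)]])

lemma Dcbody_s:
  assumes "holomorphic_section \<sigma> \<sigma>'" "p \<in> G" "Y \<in> s"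
  shows "Dcbody p \<sigma> \<sigma>' Y \<in> s"
  using assms by (simp add: Dcbody_def dcbody_s re_im_in_g0 s_closed)

lemma bounded_bilinear_Omega: "bounded_bilinear \<Omega>"
  by (intro bilinear_conv_bounded_bilinear[THEN iffD1])
    (auto simp: bilinear_def Omega_linear scaleR_conv_of_real[where 'a = complex] intro!: linearI)

text \<open>Differentiating the identity \<open>\<rho>(Y) = \<omega>(\<beta>, Y)\<close>, \<open>Y \<in> s\<close>, of a section with vector part
  \<open>\<beta>\<close> along the group.\<close>

lemma coform_derivative:
  assumes h: "holomorphic_section \<rho> \<rho>'" and p: "p \<in> G" and C: "C \<in> g0" and Y: "Y \<in> s"
  defines "d \<equiv> \<lambda>\<rho> Z. frechet_derivative (\<lambda>q. coform \<rho> q Z) (at p) (p ** C)"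
  shows "d \<rho> (re_part Y) - d \<rho>' (im_part Y) = Re (\<Omega> (dcbody p \<rho> \<rho>' C) Y)"
    "d \<rho> (im_part Y) + d \<rho>' (re_part Y) = Im (\<Omega> (dcbody p \<rho> \<rho>' C) Y)"
proof -
  have O: "((\<lambda>q. \<Omega> (cbody \<rho> \<rho>' q) Y) has_derivative
    (\<lambda>v. \<Omega> (dbody p \<rho> v + cscale \<i> (dbody p \<rho>' v)) Y)) (at p)"
    by (rule bounded_linear.has_derivative[OF
          bounded_bilinear.bounded_linear_left[OF bounded_bilinear_Omega] cbody_has_derivative[OF h]])
  note c = coform_const_has_derivative[OF holomorphic_sectionD(1)[OF h]]
    coform_const_has_derivative[OF holomorphic_sectionD(2)[OF h]]
  have eq: "Complex (coform \<rho> q (re_part Y) - coform \<rho>' q (im_part Y))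
      (coform \<rho> q (im_part Y) + coform \<rho>' q (re_part Y)) = \<Omega> (cbody \<rho> \<rho>' q) Y" if "q \<in> G" for q
    using holomorphic_sectionD(4)[OF h that Y] by (simp add: cext_def)
  show "d \<rho> (re_part Y) - d \<rho>' (im_part Y) = Re (\<Omega> (dcbody p \<rho> \<rho>' C) Y)"
    unfolding d_def dcbody_def
    by (rule derivative_along_eqI[OF has_derivative_diff[OF c]
          bounded_linear.has_derivative[OF bounded_linear_Re O] _ p translate_tangent[OF p C]])
      (simp flip: eq)
  show "d \<rho> (im_part Y) + d \<rho>' (re_part Y) = Im (\<Omega> (dcbody p \<rho> \<rho>' C) Y)"
    unfolding d_def dcbody_def
    by (rule derivative_along_eqI[OF has_derivative_add[OF c]
          bounded_linear.has_derivative[OF bounded_linear_Im O] _ p translate_tangent[OF p C]])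
      (simp flip: eq)
qed

lemma coform_body_derivative:
  assumes h: "holomorphic_section \<sigma> \<sigma>'" "holomorphic_section \<rho> \<rho>'" and p: "p \<in> G" and C: "C \<in> g0"
  defines "e \<equiv> \<lambda>\<rho> \<sigma>. frechet_derivative (\<lambda>q. coform \<rho> q (body \<sigma> q)) (at p) (p ** C)"
    and "E \<equiv> \<Omega> (dcbody p \<rho> \<rho>' C) (cbody \<sigma> \<sigma>' p) + \<Omega> (cbody \<rho> \<rho>' p) (dcbody p \<sigma> \<sigma>' C)"
  shows "e \<rho> \<sigma> - e \<rho>' \<sigma>' = Re E" "e \<rho> \<sigma>' + e \<rho>' \<sigma> = Im E"
proof -
  note s = holomorphic_sectionD(1,2)[OF h(1)] holomorphic_sectionD(1,2)[OF h(2)]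
  have O: "((\<lambda>q. \<Omega> (cbody \<rho> \<rho>' q) (cbody \<sigma> \<sigma>' q)) has_derivative
    (\<lambda>v. \<Omega> (cbody \<rho> \<rho>' p) (dbody p \<sigma> v + cscale \<i> (dbody p \<sigma>' v)) +
         \<Omega> (dbody p \<rho> v + cscale \<i> (dbody p \<rho>' v)) (cbody \<sigma> \<sigma>' p))) (at p)"
    by (rule bounded_bilinear.FDERIV[OF bounded_bilinear_Omega cbody_has_derivative[OF h(2)]
          cbody_has_derivative[OF h(1)]])
  have eq: "Complex (coform \<rho> q (body \<sigma> q) - coform \<rho>' q (body \<sigma>' q))
      (coform \<rho> q (body \<sigma>' q) + coform \<rho>' q (body \<sigma> q)) = \<Omega> (cbody \<rho> \<rho>' q) (cbody \<sigma> \<sigma>' q)"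
    if "q \<in> G" for q
    using holomorphic_sectionD(4)[OF h(2) that holomorphic_sectionD(3)[OF h(1) that]]
      re_im_of_real_pair[OF gsectionD(4)[OF s(1) that] gsectionD(4)[OF s(2) that]]
    by (simp add: cext_def cbody_def)
  have E: "E = \<Omega> (cbody \<rho> \<rho>' p) (dbody p \<sigma> (p ** C) + cscale \<i> (dbody p \<sigma>' (p ** C))) +
         \<Omega> (dbody p \<rho> (p ** C) + cscale \<i> (dbody p \<rho>' (p ** C))) (cbody \<sigma> \<sigma>' p)"
    by (simp add: E_def dcbody_def)
  show "e \<rho> \<sigma> - e \<rho>' \<sigma>' = Re E"
    unfolding e_def E
    by (rule derivative_along_eqI[OF has_derivative_diff[OF coform_body_has_derivative[OF s(1,3)]
            coform_body_has_derivative[OF s(2,4)]]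
          bounded_linear.has_derivative[OF bounded_linear_Re O] _ p translate_tangent[OF p C]])
      (simp flip: eq)
  show "e \<rho> \<sigma>' + e \<rho>' \<sigma> = Im E"
    unfolding e_def E
    by (rule derivative_along_eqI[OF has_derivative_add[OF coform_body_has_derivative[OF s(2,3)]
            coform_body_has_derivative[OF s(1,4)]]
          bounded_linear.has_derivative[OF bounded_linear_Im O] _ p translate_tangent[OF p C]])
      (simp flip: eq)
qed

text \<open>The complex bilinear extension of \<open>half_bracket\<close> expressed by \<open>\<omega>\<close>: the right-hand side involves
  only the vector parts of the two sections and their derivatives.\<close>

lemma complex_half_bracket:
  assumes h: "holomorphic_section \<sigma> \<sigma>'" "holomorphic_section \<rho> \<rho>'" and p: "p \<in> G" and Y: "Y \<in> s"
  defines "A \<equiv> cbody \<sigma> \<sigma>' p" and "B \<equiv> cbody \<rho> \<rho>' p" and "H \<equiv> half_bracket p"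
  shows "cext (\<lambda>C. H \<sigma> \<rho> C - H \<sigma>' \<rho>' C) (\<lambda>C. H \<sigma> \<rho>' C + H \<sigma>' \<rho> C) Y =
    \<Omega> (Dcbody p \<rho> \<rho>' A) Y + \<Omega> B (commutator Y A + Dcbody p \<sigma> \<sigma>' Y)
    - (\<Omega> (Dcbody p \<rho> \<rho>' Y) A + \<Omega> B (Dcbody p \<sigma> \<sigma>' Y)) / 2"
proof -
  note s = holomorphic_sectionD(1,2)[OF h(1)] holomorphic_sectionD(1,2)[OF h(2)]
  define C1 C2 where "C1 = re_part Y" and "C2 = im_part Y"
  have C: "C1 \<in> g0" "C2 \<in> g0" using re_im_in_g0[OF Y] by (auto simp: C1_def C2_def)
  have b: "body \<sigma> p \<in> g0" "body \<sigma>' p \<in> g0" using gsectionD(4) s p by auto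
  have A: "A \<in> s" using holomorphic_sectionD(3)[OF h(1) p] by (simp add: A_def)
  have reA: "re_part A = body \<sigma> p" "im_part A = body \<sigma>' p"
    using re_im_of_real_pair[OF b] by (auto simp: A_def cbody_def)
  \<comment> \<open>complex bilinearity in the vector field and in \<open>Y\<close> turns the real derivatives into \<open>Dcbody\<close>\<close>
  define t1 where "t1 \<sigma> \<rho> C = frechet_derivative (\<lambda>q. coform \<rho> q C) (at p) (p ** body \<sigma> p)" for \<sigma> \<rho> C
  have T1: "cext (\<lambda>C. t1 \<sigma> \<rho> C - t1 \<sigma>' \<rho>' C) (\<lambda>C. t1 \<sigma> \<rho>' C + t1 \<sigma>' \<rho> C) Y = \<Omega> (Dcbody p \<rho> \<rho>' A) Y"
    using coform_derivative[OF h(2) p b(1) Y] coform_derivative[OF h(2) p b(2) Y]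
    by (simp add: Dcbody_def reA Omega_linear cext_def complex_eq_iff t1_def algebra_simps)
  \<comment> \<open>\<open>S\<close> is the complexification of \<open>w\<close>; it lies in \<open>s\<close>, where the form is given by \<open>\<omega>\<close>\<close>
  define w where "w \<sigma> C = commutator C (body \<sigma> p) + dbody p \<sigma> (p ** C)" for \<sigma> C
  define S where "S = commutator Y A + Dcbody p \<sigma> \<sigma>' Y"
  have S: "S \<in> s" unfolding S_def by (intro s_closed(2) s_commutator Y A Dcbody_s h p)
  have w: "w \<sigma> C \<in> g0" "w \<sigma>' C \<in> g0" if "C \<in> g0" for C
    unfolding w_def by (intro g0_closed(2) g0_commutator that b dbody_g0 s p)+
  have Y_eq: "Y = C1 + cscale \<i> C2" by (simp add: C1_def C2_def re_im_decomp)
  have "S = (w \<sigma> C1 - w \<sigma>' C2) + cscale \<i> (w \<sigma>' C1 + w \<sigma> C2)"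
    unfolding S_def Dcbody_def C1_def[symmetric] C2_def[symmetric]
    unfolding Y_eq A_def cbody_def dcbody_def w_def
    by (simp add: commutator_simps cmat.scale_right_distrib cmat.scale_minus_left algebra_simps)
  then have reS: "re_part S = w \<sigma> C1 - w \<sigma>' C2" "im_part S = w \<sigma>' C1 + w \<sigma> C2"
    using re_im_of_real_pair[of "w \<sigma> C1 - w \<sigma>' C2" "w \<sigma>' C1 + w \<sigma> C2"] w C g0_closed by auto
  have T2: "cext (\<lambda>C. coform \<rho> p (w \<sigma> C) - coform \<rho>' p (w \<sigma>' C))
      (\<lambda>C. coform \<rho>' p (w \<sigma> C) + coform \<rho> p (w \<sigma>' C)) Y = \<Omega> B S"
    using holomorphic_sectionD(4)[OF h(2) p S]
    by (simp add: B_def[symmetric] cext_def reS coform_linear[OF s(3)] coform_linear[OF s(4)]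
        C1_def[symmetric] C2_def[symmetric] complex_eq_iff)
  define t3 where "t3 \<sigma> \<rho> C = frechet_derivative (\<lambda>q. coform \<rho> q (body \<sigma> q)) (at p) (p ** C)" for \<sigma> \<rho> C
  have T3: "cext (\<lambda>C. t3 \<sigma> \<rho> C - t3 \<sigma>' \<rho>' C) (\<lambda>C. t3 \<sigma> \<rho>' C + t3 \<sigma>' \<rho> C) Y =
    \<Omega> (Dcbody p \<rho> \<rho>' Y) A + \<Omega> B (Dcbody p \<sigma> \<sigma>' Y)"
    using coform_body_derivative[OF h p C(1)] coform_body_derivative[OF h p C(2)]
    by (simp add: Dcbody_def C1_def[symmetric] C2_def[symmetric] Omega_linear cext_def
        complex_eq_iff t3_def A_def B_def algebra_simps)
  have Heq: "H \<sigma> \<rho> C = t1 \<sigma> \<rho> C + coform \<rho> p (w \<sigma> C) - t3 \<sigma> \<rho> C / 2" for \<sigma> \<rho> C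
    by (simp add: H_def half_bracket_def t1_def t3_def w_def)
  have "cext (\<lambda>C. H \<sigma> \<rho> C - H \<sigma>' \<rho>' C) (\<lambda>C. H \<sigma> \<rho>' C + H \<sigma>' \<rho> C) Y =
    \<Omega> (Dcbody p \<rho> \<rho>' A) Y + \<Omega> B S - (\<Omega> (Dcbody p \<rho> \<rho>' Y) A + \<Omega> B (Dcbody p \<sigma> \<sigma>' Y)) / 2"
    unfolding T1[symmetric] T2[symmetric] T3[symmetric]
    by (simp add: Heq cext_def complex_eq_iff field_simps)
  then show ?thesis by (simp add: S_def)
qed

text \<open>With \<open>\<alpha>\<close>, \<open>\<beta>\<close> the vector parts of two sections, the bracket has the vector part
  \<open>\<gamma> = [\<alpha>, \<beta>] + D\<^sub>\<alpha>\<beta> - D\<^sub>\<beta>\<alpha> \<in> s\<close>. In the form part all derivatives of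
  \<open>\<alpha>\<close> and \<open>\<beta>\<close> in the direction of the argument cancel, and by the closedness of \<open>\<omega>\<close> the
  rest is \<open>\<omega>(\<gamma>, \<sqdot>)\<close>.\<close>

lemma Jfield_integrable:
  assumes h: "holomorphic_section \<sigma> \<sigma>'" "holomorphic_section \<rho> \<rho>'" and p: "p \<in> G"
  shows "(gvalue G (courant_bracket \<sigma> \<rho>) p - gvalue G (courant_bracket \<sigma>' \<rho>') p,
          gvalue G (courant_bracket \<sigma> \<rho>') p + gvalue G (courant_bracket \<sigma>' \<rho>) p)
         \<in> holomorphic_fibre G Jfield p"
proof -
  note s = holomorphic_sectionD(1,2)[OF h(1)] holomorphic_sectionD(1,2)[OF h(2)]
  define A B where "A = cbody \<sigma> \<sigma>' p" and "B = cbody \<rho> \<rho>' p"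
  have AB: "A \<in> s" "B \<in> s" using holomorphic_sectionD(3) h p by (auto simp: A_def B_def)
  define \<Gamma> where "\<Gamma> = commutator A B + Dcbody p \<rho> \<rho>' A - Dcbody p \<sigma> \<sigma>' B"
  have \<Gamma>: "\<Gamma> \<in> s"
    unfolding \<Gamma>_def by (intro s_closed(2,3) s_commutator AB Dcbody_s h p)
  have inv: "matrix_inv (transpose p) = p"
    using matrix_inv_orthogonal[OF transpose_orthogonal[OF G_orthogonal[OF p]]] by simp
  define lt where "lt \<sigma> \<rho> = left_translate (transpose p) (gvalue G (courant_bracket \<sigma> \<rho>) p)" for \<sigma> \<rho>
  have lt_fst: "fst (lt \<sigma> \<rho>) =
    commutator (body \<sigma> p) (body \<rho> p) + dbody p \<rho> (p ** body \<sigma> p) - dbody p \<sigma> (p ** body \<rho> p)"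
    if "gsection G \<sigma>" "gsection G \<rho>" for \<sigma> \<rho>
    using that p by (simp add: lt_def left_translate_def gvalue_def fst_courant_bracket_translated
        transpose_cancel)
  have lt_snd: "snd (lt \<sigma> \<rho>) C = (if C \<in> g0 then half_bracket p \<sigma> \<rho> C - half_bracket p \<rho> \<sigma> C else 0)"
    if "gsection G \<sigma>" "gsection G \<rho>" for \<sigma> \<rho> C
    using that p by (simp add: lt_def left_translate_def gvalue_def inv
        snd_courant_bracket_translated tangent_space_iff transpose_cancel)
  have lt_gtan: "lt \<sigma> \<rho> \<in> gtan" if st: "gsection G \<sigma>" "gsection G \<rho>" for \<sigma> \<rho>
  proof -
    have "fst (lt \<sigma> \<rho>) \<in> g0"
      unfolding lt_fst[OF st] by (intro g0_closed(2,3) g0_commutator dbody_g0 gsectionD(4) st p)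
    moreover have "real_linear_on g0 (snd (lt \<sigma> \<rho>))"
    proof -
      note lin = linear_snd_courant_bracket[OF st, of p]
      have "snd (lt \<sigma> \<rho>) C = snd (courant_bracket \<sigma> \<rho>) p (p ** C)" if "C \<in> g0" for C
        using that st p by (simp add: lt_snd snd_courant_bracket_translated)
      then show ?thesis
        by (simp add: real_linear_on_def g0_closed matrix_distribs linear_add[OF lin] linear_scale[OF lin])
    qed
    ultimately show ?thesis by (auto simp: gtan_def mem_Times_iff lt_snd[OF st])
  qed
  define u v where "u = lt \<sigma> \<rho> - lt \<sigma>' \<rho>'" and "v = lt \<sigma> \<rho>' + lt \<sigma>' \<rho>"
  have uv: "u \<in> gtan" "v \<in> gtan" by (auto simp: u_def v_def s intro!: gtan_add gtan_diff lt_gtan)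
  have reA: "re_part A = body \<sigma> p" "im_part A = body \<sigma>' p"
    using re_im_of_real_pair[OF gsectionD(4) gsectionD(4)] s p by (auto simp: A_def cbody_def)
  have reB: "re_part B = body \<rho> p" "im_part B = body \<rho>' p"
    using re_im_of_real_pair[OF gsectionD(4) gsectionD(4)] s p by (auto simp: B_def cbody_def)
  have fst_uv: "fst u + cscale \<i> (fst v) = \<Gamma>"
    unfolding \<Gamma>_def Dcbody_def reA reB
    unfolding A_def B_def cbody_def dcbody_def u_def v_def
    by (simp add: lt_fst s commutator_simps cmat.scale_right_distrib cmat.scale_right_diff_distrib
        algebra_simps)
  have "cext (snd u) (snd v) Y = \<Omega> \<Gamma> Y" if Y: "Y \<in> s" for Y
  proof -
    have "cext (snd u) (snd v) Y =
       \<Omega> (Dcbody p \<rho> \<rho>' A) Y + \<Omega> B (commutator Y A + Dcbody p \<sigma> \<sigma>' Y)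
         - (\<Omega> (Dcbody p \<rho> \<rho>' Y) A + \<Omega> B (Dcbody p \<sigma> \<sigma>' Y)) / 2
     - (\<Omega> (Dcbody p \<sigma> \<sigma>' B) Y + \<Omega> A (commutator Y B + Dcbody p \<rho> \<rho>' Y)
         - (\<Omega> (Dcbody p \<sigma> \<sigma>' Y) B + \<Omega> A (Dcbody p \<rho> \<rho>' Y)) / 2)"
      unfolding A_def B_def complex_half_bracket[OF h p Y, symmetric]
        complex_half_bracket[OF h(2,1) p Y, symmetric]
      using re_im_in_g0[OF Y] by (simp add: cext_def u_def v_def lt_snd s complex_eq_iff)
    also have "\<dots> = \<Omega> (Dcbody p \<rho> \<rho>' A) Y - \<Omega> (Dcbody p \<sigma> \<sigma>' B) Y
      + (\<Omega> B (commutator Y A) - \<Omega> A (commutator Y B))"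
      using Omega_swap[of "Dcbody p \<rho> \<rho>' Y" A] Omega_swap[of "Dcbody p \<sigma> \<sigma>' Y" B]
      by (simp add: Omega_linear field_simps)
    also have "\<dots> = \<Omega> \<Gamma> Y"
      using Omega_closed[OF AB Y] by (simp add: \<Gamma>_def Omega_linear)
    finally show ?thesis .
  qed
  then have "inL u v" using \<Gamma> by (simp add: inL_def fst_uv)
  with uv show ?thesis
    unfolding holomorphic_fibre_iff[OF p] left_translate_add left_translate_diff
    by (simp add: u_def v_def lt_def)
qed

theorem invariant_gcs_Jfield: "invariant_gcs G Jfield"
  unfolding invariant_gcs_def generalized_complex_structure_def
proof (intro conjI ballI allI impI)
  fix \<sigma> assume "gsection G \<sigma>"
  then show "\<exists>\<rho>. gsection G \<rho> \<and> (\<forall>p\<in>G. gvalue G \<rho> p = Jfield p (gvalue G \<sigma> p))"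
    by (rule Jfield_smooth)
qed (auto simp: Jfield_closed Jfield_Jfield Jfield_pairing Jfield_linear Jfield_invariant
    holomorphic_section_def intro!: Jfield_integrable)

end

section \<open>Skew-symmetric matrices as bivectors\<close>

definition cdot :: "complex^'m::finite \<Rightarrow> complex^'m \<Rightarrow> complex" where
  "cdot u v = (\<Sum>a\<in>UNIV. u $ a * v $ a)"

text \<open>The standard bilinear form identifies skew-symmetric matrices with bivectors; this is
  \<open>u \<and> v\<close>.\<close>

definition bivector :: "complex^'m::finite \<Rightarrow> complex^'m \<Rightarrow> 'm cmatrix" where
  "bivector u v = (\<chi> a b. u $ a * v $ b - v $ a * u $ b)"

definition bil :: "'m::finite cmatrix \<Rightarrow> complex^'m \<Rightarrow> complex^'m \<Rightarrow> complex" where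
  "bil A u v = cdot u (A *v v)"

lemma cdot_commute: "cdot u v = cdot v u"
  by (simp add: cdot_def mult.commute)

lemma cdot_simps:
  "cdot (u + v) w = cdot u w + cdot v w" "cdot u (v + w) = cdot u v + cdot u w"
  "cdot (u - v) w = cdot u w - cdot v w" "cdot u (v - w) = cdot u v - cdot u w"
  "cdot (c *s u) v = c * cdot u v" "cdot u (c *s v) = c * cdot u v"
  "cdot 0 u = 0" "cdot u 0 = 0" "cdot (- u) v = - cdot u v" "cdot u (- v) = - cdot u v"
  by (simp_all add: cdot_def algebra_simps sum.distrib sum_subtractf sum_distrib_left sum_negf)

lemma cdot_axis: "cdot (axis a 1) v = v $ a"
  by (simp add: cdot_def axis_def if_distrib[of "\<lambda>x. x * _"] cong: if_cong)

lemma cdot_matrix: "cdot u (A *v v) = cdot (transpose A *v u) v"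
proof -
  have "cdot u (A *v v) = (\<Sum>a\<in>UNIV. \<Sum>b\<in>UNIV. u $ a * (A $ a $ b * v $ b))"
    by (simp add: cdot_def matrix_vector_mult_def sum_distrib_left)
  also have "\<dots> = (\<Sum>b\<in>UNIV. \<Sum>a\<in>UNIV. u $ a * (A $ a $ b * v $ b))"
    by (rule sum.swap)
  also have "\<dots> = cdot (transpose A *v u) v"
    by (simp add: cdot_def matrix_vector_mult_def transpose_def sum_distrib_left mult_ac)
  finally show ?thesis .
qed

lemma bivector_apply: "bivector u v *v w = cdot v w *s u - cdot u w *s v"
  by (simp add: bivector_def matrix_vector_mult_def cdot_def vec_eq_iff algebra_simps
      sum_subtractf sum_distrib_left sum_distrib_right)

lemma bivector_simps:
  "bivector v u = - bivector u v" "bivector u u = 0"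
  "bivector (c *s u) v = cscale c (bivector u v)"
  by (simp_all add: bivector_def vec_eq_iff algebra_simps)

lemma bivector_so: "bivector u v \<in> so_complex"
  by (simp add: so_complex_def bivector_def transpose_def vec_eq_iff)

lemma bil_bivector: "bil (bivector u v) x y = cdot x u * cdot v y - cdot x v * cdot u y"
  by (simp add: bil_def bivector_apply cdot_simps)

lemma matrix_vector_simps:
  fixes A B :: "'m::finite cmatrix"
  shows "cscale c A *v v = c *s (A *v v)" "(- A) *v v = - (A *v v)" "(A + B) *v v = A *v v + B *v v"
    "(A - B) *v v = A *v v - B *v v" "A *v (c *s v) = c *s (A *v v)" "A *v (- v) = - (A *v v)"
    "A *v (v + w) = A *v v + A *v w" "A *v (v - w) = A *v v - A *v w"
  by (simp_all add: matrix_vector_mult_def vec_eq_iff sum_distrib_left mult_ac sum_negf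
      algebra_simps sum.distrib sum_subtractf)

lemma bil_simps:
  "bil (A + B) u v = bil A u v + bil B u v" "bil (A - B) u v = bil A u v - bil B u v"
  "bil (cscale c A) u v = c * bil A u v" "bil (- A) u v = - bil A u v" "bil 0 u v = 0"
  "bil A (u + u') v = bil A u v + bil A u' v" "bil A u (v + v') = bil A u v + bil A u v'"
  "bil A (c *s u) v = c * bil A u v" "bil A u (c *s v) = c * bil A u v"
  "bil A (u - u') v = bil A u v - bil A u' v" "bil A u (v - v') = bil A u v - bil A u v'"
  "bil A 0 v = 0" "bil A u 0 = 0" "bil A (- u) v = - bil A u v" "bil A u (- v) = - bil A u v"
  by (simp_all add: bil_def cdot_simps matrix_vector_simps)

lemma bil_sum: "bil (\<Sum>i\<in>I. f i) u v = (\<Sum>i\<in>I. bil (f i) u v)"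
  by (induction I rule: infinite_finite_induct) (simp_all add: bil_simps)

lemma bil_skew: "A \<in> so_complex \<Longrightarrow> bil A u v = - bil A v u"
proof -
  assume "A \<in> so_complex"
  then have "bil A u v = bil (- A) v u"
    by (simp add: bil_def so_complex_def cdot_matrix[of u] cdot_commute[of _ v])
  then show ?thesis by (simp add: bil_simps)
qed

lemma bil_commutator:
  assumes "B \<in> so_complex"
  shows "bil (commutator A B) u v = bil A u (B *v v) + bil A (B *v u) v"
proof -
  have "bil (commutator A B) u v = bil A u (B *v v) - cdot u (B *v (A *v v))"
    unfolding commutator_def bil_simps by (simp add: bil_def matrix_vector_mul_assoc)
  also have "cdot u (B *v (A *v v)) = cdot ((- B) *v u) (A *v v)"
    using assms by (simp add: cdot_matrix[of u] so_complex_def)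
  also have "\<dots> = - bil A (B *v u) v"
    by (simp add: bil_def cdot_def matrix_vector_mult_def sum_negf)
  finally show ?thesis by simp
qed

lemma commutator_bivector:
  "commutator (bivector u v) (bivector x y) =
    cscale (cdot v x) (bivector u y) - cscale (cdot v y) (bivector u x)
    - cscale (cdot u x) (bivector v y) + cscale (cdot u y) (bivector v x)"
proof -
  have m: "(bivector u v ** bivector x y) $ a $ b =
    cdot v x * u $ a * y $ b - cdot v y * u $ a * x $ b - cdot u x * v $ a * y $ b
    + cdot u y * v $ a * x $ b" for u v x y :: "complex^'a" and a b
    by (simp add: bivector_def matrix_matrix_mult_def cdot_def algebra_simps sum_subtractf
        sum.distrib sum_distrib_left sum_distrib_right)
  show ?thesis
    by (simp add: vec_eq_iff commutator_def m)
      (simp add: bivector_def cdot_commute algebra_simps)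
qed

lemma so_subspace: "cmat.subspace so_complex"
  by (auto simp: cmat.subspace_def so_complex_def)

lemma so_commutator: "A \<in> so_complex \<Longrightarrow> B \<in> so_complex \<Longrightarrow> commutator A B \<in> so_complex"
  by (simp add: so_complex_def commutator_def matrix_transpose_mul)

lemma tau_so: "A \<in> so_complex \<Longrightarrow> tau n ix A \<in> so_complex"
  by (simp add: so_complex_def flip: tau_transpose tau_minus)

lemma tau_commutator: "tau n ix (commutator A B) = commutator (tau n ix A) (tau n ix B)"
  by (simp add: commutator_def tau_diff tau_mult)

section \<open>Isotropic coordinates on \<open>so(2n, C)\<close>\<close>

lemma sum_pairs: "(\<Sum>k = 1..n. f (2*k-1) + f (2*k)) = (\<Sum>i = 1..2*n. f i)"
  for f :: "nat \<Rightarrow> 'a::comm_monoid_add"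
proof (induction n)
  case (Suc n)
  have "{1..2 * Suc n} = insert (2*n+2) (insert (2*n+1) {1..2*n})" by auto
  then have "(\<Sum>i = 1..2 * Suc n. f i) = f (2*n+1) + f (2*n+2) + (\<Sum>i = 1..2*n. f i)"
    by (simp add: add_ac)
  then show ?case using Suc by (simp add: add_ac)
qed simp

locale so_coordinates =
  fixes n :: nat and ix :: "nat \<Rightarrow> 'm::finite"
  assumes n4: "4 \<le> n" and bij: "bij_betw ix {1..2 * n} UNIV"
begin

text \<open>\<open>pv k\<close> and \<open>mv k\<close> are the weight vectors for \<open>\<epsilon>\<^sub>k\<close> and \<open>-\<epsilon>\<^sub>k\<close>. Both families \<open>q\<close> and \<open>r\<close>
  span maximal isotropic subspaces, and these are dual to each other. At \<open>k = n\<close> the two weights are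
  exchanged, because \<open>s\<close> then lies in the stabilizer of a flag in the span of \<open>q\<close>.\<close>

definition e :: "nat \<Rightarrow> complex^'m" where "e i = axis (ix i) 1"
definition pv :: "nat \<Rightarrow> complex^'m" where "pv k = e (2*k-1) - \<i> *s e (2*k)"
definition mv :: "nat \<Rightarrow> complex^'m" where "mv k = e (2*k-1) + \<i> *s e (2*k)"
definition q :: "nat \<Rightarrow> complex^'m" where "q k = (if k = n then mv n else pv k)"
definition r :: "nat \<Rightarrow> complex^'m" where "r k = (if k = n then pv n else mv k)"

lemma cdot_e: "i \<in> {1..2*n} \<Longrightarrow> j \<in> {1..2*n} \<Longrightarrow> cdot (e i) (e j) = (if i = j then 1 else 0)"
proof -
  assume "i \<in> {1..2*n}" "j \<in> {1..2*n}"
  then have "ix i = ix j \<longleftrightarrow> i = j"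
    using bij inj_on_eq_iff[of ix "{1..2*n}" i j] by (auto simp: bij_betw_def)
  then show ?thesis unfolding e_def cdot_axis by (simp add: axis_def)
qed

lemma cdot_pm:
  assumes "j \<in> {1..n}" "k \<in> {1..n}"
  shows "cdot (pv j) (pv k) = 0" "cdot (mv j) (mv k) = 0"
    "cdot (pv j) (mv k) = (if j = k then 2 else 0)" "cdot (mv j) (pv k) = (if j = k then 2 else 0)"
proof -
  have "2*j-1 \<in> {1..2*n}" "2*j \<in> {1..2*n}" "2*k-1 \<in> {1..2*n}" "2*k \<in> {1..2*n}"
    "2*j-1 \<noteq> 2*k" "2*j \<noteq> 2*k-1" "2*j-1 = 2*k-1 \<longleftrightarrow> j = k"
    using assms by auto presburger+
  then show "cdot (pv j) (pv k) = 0" "cdot (mv j) (mv k) = 0"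
    "cdot (pv j) (mv k) = (if j = k then 2 else 0)" "cdot (mv j) (pv k) = (if j = k then 2 else 0)"
    by (simp_all add: pv_def mv_def cdot_simps cdot_e)
qed

lemma cdot_qr [simp]:
  assumes "j \<in> {1..n}" "k \<in> {1..n}"
  shows "cdot (q j) (q k) = 0" "cdot (r j) (r k) = 0"
    "cdot (q j) (r k) = (if j = k then 2 else 0)" "cdot (r j) (q k) = (if j = k then 2 else 0)"
  using assms n4 by (auto simp: q_def r_def cdot_pm)

lemma completeness: "v = (\<Sum>k = 1..n. (1/2) *s (cdot (r k) v *s q k + cdot (q k) v *s r k))"
proof -
  have "(1/2) *s (cdot (r k) v *s q k + cdot (q k) v *s r k)
    = cdot (e (2*k-1)) v *s e (2*k-1) + cdot (e (2*k)) v *s e (2*k)" for k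
    by (cases "k = n") (simp_all add: q_def r_def pv_def mv_def cdot_simps vec_eq_iff algebra_simps)
  then have "(\<Sum>k = 1..n. (1/2) *s (cdot (r k) v *s q k + cdot (q k) v *s r k)) =
    (\<Sum>i = 1..2*n. cdot (e i) v *s e i)"
    using sum_pairs[of "\<lambda>i. cdot (e i) v *s e i" n] by simp
  also have "\<dots> = (\<Sum>a\<in>UNIV. v $ a *s axis a 1)"
    unfolding e_def cdot_axis using sum.reindex_bij_betw[OF bij, of "\<lambda>a. v $ a *s axis a 1"] .
  also have "\<dots> = v"
    by (simp add: vec_eq_iff axis_def if_distrib[of "\<lambda>x. _ * x"] cong: if_cong)
  finally show ?thesis by simp
qed

lemma bil_mult: "bil (A ** B) u v =
    (\<Sum>k = 1..n. (1/2) * (bil A u (q k) * bil B (r k) v + bil A u (r k) * bil B (q k) v))"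
proof -
  have s: "bil A u (\<Sum>i\<in>I. f i) = (\<Sum>i\<in>I. bil A u (f i))" for I and f :: "nat \<Rightarrow> complex^'m"
    by (induction I rule: infinite_finite_induct) (simp_all add: bil_simps)
  have "bil (A ** B) u v = bil A u (B *v v)" by (simp add: bil_def matrix_vector_mul_assoc)
  also have "\<dots> = bil A u (\<Sum>k = 1..n. (1/2) *s (cdot (r k) (B *v v) *s q k + cdot (q k) (B *v v) *s r k))"
    using completeness[of "B *v v"] by simp
  also have "\<dots> = (\<Sum>k = 1..n. (1/2) * (bil A u (q k) * bil B (r k) v + bil A u (r k) * bil B (q k) v))"
    unfolding s bil_simps bil_def[of B, symmetric] by (simp add: mult.commute)
  finally show ?thesis .
qed

lemma bil_ext:
  assumes "\<And>j k. j \<in> {1..n} \<Longrightarrow> k \<in> {1..n} \<Longrightarrow> bil A (q j) (q k) = bil B (q j) (q k) \<and>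
     bil A (q j) (r k) = bil B (q j) (r k) \<and> bil A (r j) (q k) = bil B (r j) (q k) \<and>
     bil A (r j) (r k) = bil B (r j) (r k)"
  shows "A = B"
proof -
  have s: "bil A u (\<Sum>i\<in>I. f i) = (\<Sum>i\<in>I. bil A u (f i))"
    "bil A (\<Sum>i\<in>I. f i) u = (\<Sum>i\<in>I. bil A (f i) u)" for A I u and f :: "nat \<Rightarrow> complex^'m"
    by (induction I rule: infinite_finite_induct) (simp_all add: bil_simps)
  have left: "bil A u v = (\<Sum>k = 1..n. (1/2) * (cdot (r k) u * bil A (q k) v + cdot (q k) u * bil A (r k) v))"
    for A u v
    using arg_cong[OF completeness[of u], of "\<lambda>u. bil A u v"] by (simp add: s bil_simps add_divide_distrib)
  have right: "bil A u v = (\<Sum>k = 1..n. (1/2) * (cdot (r k) v * bil A u (q k) + cdot (q k) v * bil A u (r k)))"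
    for A u v
    using arg_cong[OF completeness[of v], of "\<lambda>v. bil A u v"] by (simp add: s bil_simps add_divide_distrib)
  have basis: "bil A u (q k) = bil B u (q k)" "bil A u (r k) = bil B u (r k)" if "k \<in> {1..n}" for u k
    unfolding left[of _ u] using assms that by (auto intro!: sum.cong)
  have "bil A u v = bil B u v" for u v
    unfolding right[of _ u v] using basis by (auto intro!: sum.cong)
  moreover have "bil M (axis a 1) (axis b 1) = M $ a $ b" for M :: "'m cmatrix" and a b
    unfolding bil_def cdot_axis
    by (simp add: matrix_vector_mult_def axis_def if_distrib[of "\<lambda>x. _ * x"] cong: if_cong)
  ultimately show ?thesis by (metis vec_eq_iff)
qed

text \<open>Expansion in the basis of root vectors and Cartan elements; the coefficients are matrix
  coordinates of \<open>A\<close> for the dual basis vectors.\<close>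

lemma so_expansion:
  assumes A: "A \<in> so_complex"
  shows "A = (\<Sum>j = 1..n. \<Sum>k = 1..n. cscale (bil A (r j) (r k) / 8) (bivector (q j) (q k))
    + cscale (bil A (q k) (r j) / 4) (bivector (r k) (q j))
    + cscale (bil A (q j) (q k) / 8) (bivector (r j) (r k)))" (is "A = ?B")
proof (rule bil_ext)
  fix j k assume jk: "j \<in> {1..n}" "k \<in> {1..n}"
  have sw: "bil A (r b) (q a) = - bil A (q a) (r b)" "bil A (q b) (q a) = - bil A (q a) (q b)"
    "bil A (r b) (r a) = - bil A (r a) (r b)" for a b
    by (rule bil_skew[OF A])+
  define \<delta> :: "nat \<Rightarrow> nat \<Rightarrow> complex" where "\<delta> a b = (if a = b then 2 else 0)" for a b
  have d1: "(\<Sum>a = 1..n. \<Sum>b = 1..n. f a b * (\<delta> x a * \<delta> b y)) = 4 * f x y"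
    if "x \<in> {1..n}" "y \<in> {1..n}" for f :: "nat \<Rightarrow> nat \<Rightarrow> complex" and x y
  proof -
    have "(\<Sum>a = 1..n. \<Sum>b = 1..n. f a b * (\<delta> x a * \<delta> b y)) =
      (\<Sum>a = 1..n. \<Sum>b = 1..n. if b = y then if x = a then 4 * f a b else 0 else 0)"
      by (intro sum.cong refl) (auto simp: \<delta>_def)
    also have "\<dots> = (\<Sum>a = 1..n. if x = a then 4 * f a y else 0)"
      using that by (intro sum.cong refl) auto
    finally show ?thesis using that by simp
  qed
  have d2: "(\<Sum>a = 1..n. \<Sum>b = 1..n. f a b * (\<delta> x b * \<delta> a y)) = 4 * f y x"
    if "x \<in> {1..n}" "y \<in> {1..n}" for f :: "nat \<Rightarrow> nat \<Rightarrow> complex" and x y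
    by (subst sum.swap) (rule d1[OF that])
  have \<delta>: "cdot (q x) (r y) = \<delta> x y" "cdot (r x) (q y) = \<delta> x y"
    if "x \<in> {1..n}" "y \<in> {1..n}" for x y
    using that by (simp_all add: \<delta>_def)
  have B: "bil ?B x y = (\<Sum>a = 1..n. \<Sum>b = 1..n.
      bil A (r a) (r b) / 8 * (cdot x (q a) * cdot (q b) y - cdot x (q b) * cdot (q a) y)
      + bil A (q b) (r a) / 4 * (cdot x (r b) * cdot (q a) y - cdot x (q a) * cdot (r b) y)
      + bil A (q a) (q b) / 8 * (cdot x (r a) * cdot (r b) y - cdot x (r b) * cdot (r a) y))" for x y
    by (simp only: bil_sum bil_simps bil_bivector)
  have "bil ?B (q j) (q k) = (\<Sum>a = 1..n. \<Sum>b = 1..n. bil A (q a) (q b) / 8 * (\<delta> j a * \<delta> b k))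
      - (\<Sum>a = 1..n. \<Sum>b = 1..n. bil A (q a) (q b) / 8 * (\<delta> j b * \<delta> a k))"
    unfolding B sum_subtractf[symmetric] using jk
    by (intro sum.cong refl) (simp add: \<delta> right_diff_distrib diff_divide_distrib del: cdot_qr(3,4))
  then have 1: "bil ?B (q j) (q k) = bil A (q j) (q k)"
    unfolding d1[OF jk] d2[OF jk] using sw(2)[of j k] by simp
  have "bil ?B (r j) (r k) = (\<Sum>a = 1..n. \<Sum>b = 1..n. bil A (r a) (r b) / 8 * (\<delta> j a * \<delta> b k))
      - (\<Sum>a = 1..n. \<Sum>b = 1..n. bil A (r a) (r b) / 8 * (\<delta> j b * \<delta> a k))"
    unfolding B sum_subtractf[symmetric] using jk
    by (intro sum.cong refl) (simp add: \<delta> right_diff_distrib diff_divide_distrib del: cdot_qr(3,4))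
  then have 2: "bil ?B (r j) (r k) = bil A (r j) (r k)"
    unfolding d1[OF jk] d2[OF jk] using sw(3)[of j k] by simp
  have "bil ?B (r j) (q k) = (\<Sum>a = 1..n. \<Sum>b = 1..n. - bil A (q b) (r a) / 4 * (\<delta> j a * \<delta> b k))"
    unfolding B using jk by (intro sum.cong refl) (simp add: \<delta> del: cdot_qr(3,4))
  then have 3: "bil ?B (r j) (q k) = bil A (r j) (q k)"
    unfolding d1[OF jk] using sw(1)[of j k] by simp
  have "bil ?B (q j) (r k) = (\<Sum>a = 1..n. \<Sum>b = 1..n. bil A (q b) (r a) / 4 * (\<delta> j b * \<delta> a k))"
    unfolding B using jk by (intro sum.cong refl) (simp add: \<delta> del: cdot_qr(3,4))
  then have 4: "bil ?B (q j) (r k) = bil A (q j) (r k)"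
    unfolding d2[OF jk] by simp
  show "bil A (q j) (q k) = bil ?B (q j) (q k) \<and> bil A (q j) (r k) = bil ?B (q j) (r k) \<and>
     bil A (r j) (q k) = bil ?B (r j) (q k) \<and> bil A (r j) (r k) = bil ?B (r j) (r k)"
    using 1 2 3 4 by simp
qed

end

context so_coordinates
begin

subsection \<open>The root vectors as bivectors\<close>

lemma E_unit_nth: "E_unit ix i j $ a $ b = e i $ a * e j $ b"
  by (simp add: E_unit_def e_def axis_def)

lemma cnj_e [simp]: "cnj (e i $ a) = e i $ a"
  by (simp add: e_def axis_def)

lemma X_elem_eq: "j < k \<Longrightarrow> X_elem ix j k = bivector (pv j) (mv k)"
  and Y_elem_eq: "j < k \<Longrightarrow> Y_elem ix j k = - bivector (pv j) (pv k)"
  and Z_elem_eq: "j < k \<Longrightarrow> Z_elem ix j k = bivector (mv j) (mv k)"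
  and X_elem_swap: "j < k \<Longrightarrow> X_elem ix k j = - bivector (mv j) (pv k)"
  and H_elem_eq: "H_elem ix k = cscale (1/2) (bivector (pv k) (mv k))"
  unfolding X_elem_def Y_elem_def Z_elem_def H_elem_def G_plus_def G_minus_def G_plus_upper_def
    G_minus_upper_def conj_matrix_def bivector_def pv_def mv_def
  by (simp_all add: vec_eq_iff E_unit_nth cscale_def algebra_simps)

abbreviation (input) I where "I \<equiv> {1..n}"
abbreviation (input) s where "s \<equiv> s_algebra n ix"
abbreviation (input) \<tau> where "\<tau> \<equiv> tau n ix"
abbreviation (input) g0 where "g0 \<equiv> real_form so_complex \<tau>"

text \<open>The two generators of \<open>s\<close> that are neither a single root vector nor a single \<open>H\<^sub>k\<close>.\<close>

definition K where "K = H_elem ix (n-1) + H_elem ix n"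
definition T where "T = H_elem ix 1 + X_elem ix (n-1) n"

lemma bil_basis:
  assumes "a \<in> I" "b \<in> I" "j \<in> I" "k \<in> I"
  shows "bil (bivector (q a) (q b)) (q j) (q k) = 0" "bil (bivector (q a) (q b)) (q j) (r k) = 0"
    "bil (bivector (q a) (q b)) (r j) (r k)
      = (if j = a \<and> b = k then 4 else 0) - (if j = b \<and> a = k then 4 else 0)"
    "bil (bivector (q a) (r b)) (q j) (q k) = 0"
    "bil (bivector (q a) (r b)) (q j) (r k) = (if j = b \<and> a = k then - 4 else 0)"
    "bil (bivector (q a) (r b)) (r j) (r k) = 0"
proof -
  have d: "(if P then 2 else 0) * (if Q then 2 else 0) = (if P \<and> Q then 4 else (0::complex))" for P Q
    by simp
  show "bil (bivector (q a) (q b)) (q j) (q k) = 0" "bil (bivector (q a) (q b)) (q j) (r k) = 0"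
    "bil (bivector (q a) (r b)) (q j) (q k) = 0" "bil (bivector (q a) (r b)) (r j) (r k) = 0"
    unfolding bil_bivector
    by (simp_all only: cdot_qr[OF assms(3) assms(1)] cdot_qr[OF assms(3) assms(2)]
      cdot_qr[OF assms(1) assms(4)] cdot_qr[OF assms(2) assms(4)] mult_zero_left mult_zero_right diff_self)
  show "bil (bivector (q a) (q b)) (r j) (r k)
      = (if j = a \<and> b = k then 4 else 0) - (if j = b \<and> a = k then 4 else 0)"
    unfolding bil_bivector
    by (simp only: cdot_qr[OF assms(3) assms(1)] cdot_qr[OF assms(3) assms(2)]
      cdot_qr[OF assms(1) assms(4)] cdot_qr[OF assms(2) assms(4)] d)
  have "0 - (if P then 4 else 0) = (if P then - 4 else (0::complex))" for P by simp
  then show "bil (bivector (q a) (r b)) (q j) (r k) = (if j = b \<and> a = k then - 4 else 0)"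
    unfolding bil_bivector
    by (simp only: cdot_qr[OF assms(3) assms(1)] cdot_qr[OF assms(3) assms(2)]
      cdot_qr[OF assms(1) assms(4)] cdot_qr[OF assms(2) assms(4)] d mult_zero_left)
qed

lemma K_eq: "K = cscale (1/2) (bivector (q (n-1)) (r (n-1)) - bivector (q n) (r n))"
  and T_eq: "T = cscale (1/2) (bivector (q 1) (r 1)) + bivector (q (n-1)) (q n)"
proof -
  have ne: "n - 1 \<noteq> n" "1 \<noteq> n" "n - 1 < n" using n4 by auto
  have "bivector (pv n) (mv n) = - bivector (q n) (r n)"
    unfolding q_def r_def by (simp add: bivector_simps(1)[of "mv n" "pv n"])
  then have "H_elem ix n = cscale (1/2) (- bivector (q n) (r n))" by (simp add: H_elem_eq)
  moreover have "H_elem ix (n-1) = cscale (1/2) (bivector (q (n-1)) (r (n-1)))"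
    "H_elem ix 1 = cscale (1/2) (bivector (q 1) (r 1))"
    using ne by (simp_all add: H_elem_eq q_def r_def)
  moreover have "X_elem ix (n-1) n = bivector (q (n-1)) (q n)"
    using ne by (simp add: X_elem_eq q_def)
  ultimately show "K = cscale (1/2) (bivector (q (n-1)) (r (n-1)) - bivector (q n) (r n))"
    "T = cscale (1/2) (bivector (q 1) (r 1)) + bivector (q (n-1)) (q n)"
    unfolding K_def T_def by (simp_all add: cmat.scale_right_diff_distrib)
qed

lemma K_so: "K \<in> so_complex" and T_so: "T \<in> so_complex"
  unfolding K_eq T_eq
  by (intro cmat.subspace_scale[OF so_subspace] cmat.subspace_diff[OF so_subspace]
      cmat.subspace_add[OF so_subspace] bivector_so)+

lemma s_subspace: "cmat.subspace (s)"
  unfolding s_algebra_def by (rule cmat.subspace_span)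

lemma s_cscale: "A \<in> s \<Longrightarrow> cscale c A \<in> s"
  by (rule cmat.subspace_scale[OF s_subspace])

lemma s_neg: "- A \<in> s \<longleftrightarrow> A \<in> s"
  using cmat.subspace_neg[OF s_subspace] by fastforce

lemma K_in_s: "K \<in> s" and T_in_s: "T \<in> s"
  unfolding K_def T_def s_algebra_def by (auto intro!: cmat.span_base)

lemma X_in_s: "1 \<le> j \<Longrightarrow> j < k \<Longrightarrow> k \<le> n \<Longrightarrow> (j, k) \<noteq> (n-1, n) \<Longrightarrow> X_elem ix j k \<in> s"
  and Y_in_s: "1 \<le> j \<Longrightarrow> j < k \<Longrightarrow> k \<le> n \<Longrightarrow> Y_elem ix j k \<in> s"
  and Z_in_s: "Z_elem ix (n-1) n \<in> s"
  and H_in_s: "2 \<le> k \<Longrightarrow> k \<le> n - 2 \<Longrightarrow> H_elem ix k \<in> s"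
  unfolding s_algebra_def by (rule cmat.span_base, blast)+

lemma qr_in_s:
  assumes "j \<in> I" "k \<in> I" "j < k \<or> (j, k) = (n, n-1)"
  shows "bivector (q j) (r k) \<in> s"
proof -
  consider "j < k" "k < n" | "j < k" "k = n" | "j = n" "k = n - 1" using assms by force
  then show ?thesis
  proof cases
    case 1
    then show ?thesis using X_in_s[of j k] assms by (simp add: X_elem_eq q_def r_def)
  next
    case 2
    then show ?thesis using Y_in_s[of j k] assms by (simp add: Y_elem_eq q_def r_def s_neg)
  next
    case 3
    moreover have "n - 1 \<noteq> n" using n4 by auto
    ultimately show ?thesis using Z_in_s n4 bivector_simps(1)[of "mv (n-1)" "mv n"]
      by (simp add: Z_elem_eq q_def r_def s_neg)
  qed
qed

lemma qq_in_s:
  assumes "j \<in> I" "k \<in> I" "{j, k} \<noteq> {n-1, n}"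
  shows "bivector (q j) (q k) \<in> s"
proof -
  have *: "bivector (q j) (q k) \<in> s"
    if "j \<in> I" "k \<in> I" "j < k" "(j, k) \<noteq> (n-1, n)" for j k
  proof (cases "k = n")
    case True
    then show ?thesis using X_in_s[of j k] that by (simp add: X_elem_eq q_def)
  next
    case False
    then show ?thesis using Y_in_s[of j k] that by (simp add: Y_elem_eq q_def s_neg)
  qed
  consider "j < k" | "j = k" | "k < j" by linarith
  then show ?thesis
  proof cases
    case 1
    then show ?thesis using *[of j k] assms by auto
  next
    case 2
    then show ?thesis by (simp add: bivector_simps(2) cmat.subspace_0[OF s_subspace])
  next
    case 3
    then have "bivector (q k) (q j) \<in> s" using *[of k j] assms by auto
    then show ?thesis by (subst bivector_simps(1)) (simp add: s_neg)
  qed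
qed

lemma qr_diag_in_s:
  assumes "2 \<le> k" "k \<le> n - 2"
  shows "bivector (q k) (r k) \<in> s"
proof -
  have "cscale 2 (H_elem ix k) \<in> s" by (intro s_cscale H_in_s assms)
  then show ?thesis using assms n4 by (auto simp: H_elem_eq q_def r_def)
qed

subsection \<open>Equations for \<open>s\<close>\<close>

text \<open>The conditions say that \<open>A\<close> stabilizes the span of \<open>q\<^sub>1, \<dots>, q\<^sub>k\<close> for \<open>k \<le> n\<close>, \<open>k \<noteq> n - 1\<close>, and
  has trace 0 on the last quotient of this flag, which is a plane.\<close>

definition flag_algebra :: "'m cmatrix set" where
  "flag_algebra = {A \<in> so_complex. (\<forall>j\<in>I. \<forall>k\<in>I. bil A (q j) (q k) = 0) \<and>
     (\<forall>j\<in>I. \<forall>k\<in>I. j < k \<and> (j, k) \<noteq> (n-1, n) \<longrightarrow> bil A (q j) (r k) = 0) \<and>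
     bil A (q (n-1)) (r (n-1)) + bil A (q n) (r n) = 0}"

text \<open>The condition of \<open>s\<close> that makes it non-regular: the coefficient of the root vector
  \<open>q\<^sub>n\<^sub>-\<^sub>1 \<and> q\<^sub>n\<close> is tied to that of \<open>H\<^sub>1\<close>.\<close>

definition coupled :: "'m cmatrix set" where
  "coupled = {A \<in> flag_algebra. bil A (r (n-1)) (r n) = - 2 * bil A (q 1) (r 1)}"

lemma flagD:
  assumes "A \<in> flag_algebra"
  shows "A \<in> so_complex" "j \<in> I \<Longrightarrow> k \<in> I \<Longrightarrow> bil A (q j) (q k) = 0"
    "j \<in> I \<Longrightarrow> k \<in> I \<Longrightarrow> j < k \<Longrightarrow> (j, k) \<noteq> (n-1, n) \<Longrightarrow> bil A (q j) (r k) = 0"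
    "bil A (q n) (r n) = - bil A (q (n-1)) (r (n-1))"
  using assms by (auto simp: flag_algebra_def add_eq_0_iff)

lemma coupled_subspace: "cmat.subspace coupled"
  using so_subspace
  by (auto simp: cmat.subspace_def coupled_def flag_algebra_def bil_simps algebra_simps)
    (metis distrib_left mult_zero_right)+

lemma in_subspace_by_coordinates:
  assumes A: "A \<in> so_complex" and V: "cmat.subspace V"
    and "\<And>j k. j \<in> I \<Longrightarrow> k \<in> I \<Longrightarrow> bil A (r j) (r k) \<noteq> 0 \<Longrightarrow> bivector (q j) (q k) \<in> V"
    and "\<And>j k. j \<in> I \<Longrightarrow> k \<in> I \<Longrightarrow> bil A (q j) (r k) \<noteq> 0 \<Longrightarrow> bivector (q k) (r j) \<in> V"
    and "\<And>j k. j \<in> I \<Longrightarrow> k \<in> I \<Longrightarrow> bil A (q j) (q k) \<noteq> 0 \<Longrightarrow> bivector (r j) (r k) \<in> V"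
  shows "A \<in> V"
proof -
  have sc: "cscale c X \<in> V" if "c \<noteq> 0 \<Longrightarrow> X \<in> V" for c X
    using that V by (cases "c = 0") (auto simp: cmat.subspace_0 cmat.subspace_scale)
  have "bivector (r k) (q j) \<in> V" if "j \<in> I" "k \<in> I" "bil A (q k) (r j) \<noteq> 0" for j k
    using cmat.subspace_neg[OF V assms(4)[OF that(2,1,3)]] by (simp flip: bivector_simps(1))
  then show ?thesis
    using assms(3,5)
    by (subst so_expansion[OF A]) (auto intro!: cmat.subspace_sum[OF V] cmat.subspace_add[OF V] sc)
qed

text \<open>After subtracting multiples of \<open>T\<close> and \<open>K\<close> all coordinates belonging to bivectors outside of
  \<open>s\<close> vanish.\<close>

lemma coupled_subset_s:
  assumes A: "A \<in> coupled"
  shows "A \<in> s"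
proof -
  define B where "B = A - (cscale (bil A (r 1) (q 1) / 2) T + cscale (bil A (r (n-1)) (q (n-1)) / 2) K)"
  have I: "1 \<in> I" "n \<in> I" "n - 1 \<in> I" using n4 by auto
  have ne: "n - 1 \<noteq> n" "1 \<noteq> n - 1" "1 \<noteq> n" using n4 by auto
  have so: "A \<in> so_complex" "B \<in> so_complex"
    using A flagD(1) unfolding B_def
    by (auto simp: coupled_def intro!: cmat.subspace_diff[OF so_subspace]
        cmat.subspace_add[OF so_subspace] cmat.subspace_scale[OF so_subspace] K_so T_so)
  have Ap: "A \<in> flag_algebra" and Ac: "bil A (r (n-1)) (r n) = - 2 * bil A (q 1) (r 1)"
    using A by (auto simp: coupled_def)
  note sk = bil_skew[OF so(1)]
  have T: "bil T (q j) (q k) = 0" "bil T (q j) (r k) = (if j = 1 \<and> k = 1 then - 2 else 0)"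
    "bil T (r j) (r k) = (if j = n - 1 \<and> k = n then 4 else if j = n \<and> k = n - 1 then - 4 else 0)"
    if "j \<in> I" "k \<in> I" for j k
    using that I ne by (simp_all add: T_eq bil_simps bil_basis del: atLeastAtMost_iff One_nat_def)
  have K: "bil K (q j) (q k) = 0" "bil K (q j) (r k) = (if j = k \<and> j = n - 1 then - 2 else if j = k \<and> j = n then 2 else 0)"
    "bil K (r j) (r k) = 0"
    if "j \<in> I" "k \<in> I" for j k
    using that I ne by (auto simp: K_eq bil_simps bil_basis simp del: atLeastAtMost_iff One_nat_def)
  have rq: "bil A (r k) (q k) = - bil A (q k) (r k)" for k by (rule sk)
  have Bqq: "bil B (q j) (q k) = 0" if "j \<in> I" "k \<in> I" for j k
    using that flagD(2)[OF Ap] by (simp add: B_def bil_simps T K del: atLeastAtMost_iff One_nat_def)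
  have Bqr: "bil B (q j) (r k) = 0" if "j \<in> I" "k \<in> I" "\<not> (k < j) \<and> (j, k) \<noteq> (n-1, n) \<and> (j = k \<longrightarrow> j = 1 \<or> j \<ge> n - 1)" for j k
  proof -
    have "j \<ge> n - 1 \<Longrightarrow> j = n - 1 \<or> j = n" using that(1) by auto
    moreover have "j < k \<or> j = k" "(j, k) \<noteq> (n-1, n)" "j = k \<Longrightarrow> j = 1 \<or> j \<ge> n - 1"
      using that(3) by auto
    ultimately consider "j < k" "(j, k) \<noteq> (n-1, n)" | "j = k" "j = 1" | "j = k" "j = n - 1" | "j = k" "j = n"
      by blast
    then show ?thesis
    proof cases
      case 1
      then show ?thesis
        using that(1,2) flagD(3)[OF Ap that(1,2)] ne
        by (auto simp: B_def bil_simps T K simp del: atLeastAtMost_iff One_nat_def)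
    next
      case 2
      have "bil B (q 1) (r 1) = 0"
        using I ne rq by (simp add: B_def bil_simps T K del: atLeastAtMost_iff One_nat_def)
      then show ?thesis using 2 by simp
    next
      case 3
      have "bil B (q (n-1)) (r (n-1)) = 0"
        using I ne rq by (simp add: B_def bil_simps T K del: atLeastAtMost_iff One_nat_def)
      then show ?thesis using 3 by simp
    next
      case 4
      have "bil B (q n) (r n) = 0"
        using I ne rq flagD(4)[OF Ap]
        by (simp add: B_def bil_simps T K del: atLeastAtMost_iff One_nat_def)
      then show ?thesis using 4 by simp
    qed
  qed
  have Brr: "bil B (r j) (r k) = 0" if "j \<in> I" "k \<in> I" "{j, k} = {n-1, n}" for j k
    using that I ne Ac rq[of 1] sk[of "r n" "r (n-1)"]
    by (auto simp: B_def bil_simps T K doubleton_eq_iff simp del: atLeastAtMost_iff One_nat_def)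
  have "B \<in> s"
  proof (rule in_subspace_by_coordinates[OF so(2) s_subspace])
    fix j k assume jk: "j \<in> I" "k \<in> I"
    show "bivector (q j) (q k) \<in> s" if "bil B (r j) (r k) \<noteq> 0"
      using qq_in_s[OF jk] Brr[OF jk] that by auto
    show "bivector (q k) (r j) \<in> s" if "bil B (q j) (r k) \<noteq> 0"
    proof -
      have "k < j \<or> (j, k) = (n-1, n) \<or> (j = k \<and> 2 \<le> j \<and> j \<le> n - 2)"
        using Bqr[OF jk] that jk by force
      then show ?thesis using qr_in_s[OF jk(2,1)] qr_diag_in_s by auto
    qed
    show "bivector (r j) (r k) \<in> s" if "bil B (q j) (q k) \<noteq> 0"
      using Bqq[OF jk] that by simp
  qed
  then have "B + (cscale (bil A (r 1) (q 1) / 2) T + cscale (bil A (r (n-1)) (q (n-1)) / 2) K) \<in> s"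
    by (intro cmat.subspace_add[OF s_subspace] s_cscale T_in_s K_in_s)
  then show ?thesis by (simp add: B_def)
qed

lemma bivector_coupledI:
  assumes "\<And>j k. j \<in> I \<Longrightarrow> k \<in> I \<Longrightarrow> bil (bivector u v) (q j) (q k) = 0"
    and "\<And>j k. j \<in> I \<Longrightarrow> k \<in> I \<Longrightarrow> j < k \<Longrightarrow> (j, k) \<noteq> (n-1, n) \<Longrightarrow> bil (bivector u v) (q j) (r k) = 0"
    and "bil (bivector u v) (q (n-1)) (r (n-1)) + bil (bivector u v) (q n) (r n) = 0"
    and "bil (bivector u v) (r (n-1)) (r n) = - 2 * bil (bivector u v) (q 1) (r 1)"
  shows "bivector u v \<in> coupled"
  using assms bivector_so unfolding coupled_def flag_algebra_def by blast

lemma s_eq_coupled: "s = coupled"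
proof
  show "coupled \<subseteq> s" using coupled_subset_s by blast
  have I: "1 \<in> I" "n \<in> I" "n - 1 \<in> I" using n4 by auto
  have ne: "n - 1 \<noteq> n" "1 \<noteq> n - 1" "1 \<noteq> n" using n4 by auto
  note sub = coupled_subspace
  have qq: "bivector (q j) (q k) \<in> coupled" if "j \<in> I" "k \<in> I" "j < k" "(j, k) \<noteq> (n-1, n)" for j k
    using that I ne
    by (intro bivector_coupledI) (auto simp: bil_basis simp del: atLeastAtMost_iff One_nat_def)
  have qr: "bivector (q j) (r k) \<in> coupled" if "j \<in> I" "k \<in> I" "j < k \<or> (j, k) = (n, n-1)" for j k
    using that I ne
    by (intro bivector_coupledI) (auto simp: bil_basis simp del: atLeastAtMost_iff One_nat_def)
  have diag: "bivector (q k) (r k) \<in> coupled" if "2 \<le> k" "k \<le> n - 2" for k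
  proof -
    have "k \<in> I" "k \<noteq> 1" "k \<noteq> n - 1" "k \<noteq> n" using that n4 by auto
    then show ?thesis using I
      by (intro bivector_coupledI) (auto simp: bil_basis simp del: atLeastAtMost_iff One_nat_def)
  qed
  have K: "K \<in> coupled"
    using I ne K_so
    by (auto simp: coupled_def flag_algebra_def K_eq bil_simps bil_basis simp del: atLeastAtMost_iff One_nat_def)
  have T: "T \<in> coupled"
    using I ne T_so
    by (auto simp: coupled_def flag_algebra_def T_eq bil_simps bil_basis simp del: atLeastAtMost_iff One_nat_def)
  have H: "H_elem ix k \<in> coupled" if "2 \<le> k" "k \<le> n - 2" for k
  proof -
    have "k \<noteq> n" using that n4 by auto
    then show ?thesis using diag[OF that]
      by (auto simp: H_elem_eq q_def r_def intro!: cmat.subspace_scale[OF sub])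
  qed
  have X: "X_elem ix j k \<in> coupled" if "1 \<le> j" "j < k" "k \<le> n" "(j, k) \<noteq> (n-1, n)" for j k
    using qq[of j k] qr[of j k] that by (cases "k = n") (auto simp: X_elem_eq q_def r_def)
  have Y: "Y_elem ix j k \<in> coupled" if "1 \<le> j" "j < k" "k \<le> n" for j k
    using qq[of j k] qr[of j k] that
    by (cases "k = n") (auto simp: Y_elem_eq q_def r_def intro!: cmat.subspace_neg[OF sub])
  have Z: "Z_elem ix (n-1) n \<in> coupled"
  proof -
    have "bivector (mv n) (mv (n-1)) \<in> coupled" using qr[OF I(2,3)] ne by (simp add: q_def r_def)
    then have "- bivector (mv n) (mv (n-1)) \<in> coupled" by (rule cmat.subspace_neg[OF sub])
    then show ?thesis using n4 by (simp add: Z_elem_eq flip: bivector_simps(1))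
  qed
  show "s \<subseteq> coupled"
    unfolding s_algebra_def
    by (rule cmat.span_minimal[OF _ sub])
      (use H K T X Y Z in \<open>auto simp: K_def T_def simp del: One_nat_def\<close>)
qed

lemma coupledD:
  assumes "A \<in> s"
  shows "A \<in> flag_algebra" "bil A (r (n-1)) (r n) = - 2 * bil A (q 1) (r 1)"
  using assms by (auto simp: s_eq_coupled coupled_def)

text \<open>On the stabilizer of the span of \<open>q\<^sub>1, \<dots>, q\<^sub>n\<close> the matrix of the \<open>bil A (q j) (r k)\<close> is
  multiplicative up to a factor, so the flag conditions pass to commutators as for block triangular
  matrices. Both coefficients in the coupling condition vanish on commutators.\<close>

lemma s_commutator:
  assumes AB: "A \<in> s" "B \<in> s"
  shows "commutator A B \<in> s"
proof -
  have I: "1 \<in> I" "n \<in> I" "n - 1 \<in> I" using n4 by auto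
  have ne: "n - 1 \<noteq> n" "1 \<noteq> n - 1" "1 \<noteq> n" using n4 by auto
  note A = flagD[OF coupledD(1)[OF AB(1)]] and B = flagD[OF coupledD(1)[OF AB(2)]]
  have qq: "bil (M ** N) (q j) (q k) = 0"
    if "M \<in> flag_algebra" "N \<in> flag_algebra" "j \<in> I" "k \<in> I" for M N j k
    unfolding bil_mult using that flagD(2)[OF that(1)] flagD(2)[OF that(2)]
    by (auto intro!: sum.neutral)
  have qr: "bil (M ** N) (q j) (r k) = (\<Sum>l\<in>I. (1/2) * (bil M (q j) (r l) * bil N (q l) (r k)))"
    if "M \<in> flag_algebra" "j \<in> I" "k \<in> I" for M N j k
    unfolding bil_mult using that(2,3) flagD(2)[OF that(1)] by (auto intro!: sum.cong)
  have tri: "bil M (q j) (r k) = 0"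
    if "M \<in> flag_algebra" "j \<in> I" "k \<in> I" "\<not> k \<le> j" "j \<noteq> n - 1 \<or> k \<noteq> n" for M j k
    using flagD(3)[OF that(1-3)] that by auto
  have two: "(\<Sum>l\<in>I. f l) = f (n-1) + f n" if "\<And>l. l \<in> I \<Longrightarrow> l \<noteq> n - 1 \<Longrightarrow> l \<noteq> n \<Longrightarrow> f l = 0"
    for f :: "nat \<Rightarrow> complex"
  proof -
    have "(\<Sum>l\<in>I. f l) = (\<Sum>l\<in>{n-1, n}. f l)"
      using that I by (intro sum.mono_neutral_right) auto
    then show ?thesis using ne by simp
  qed
  have lower: "bil (M ** N) (q j) (r k) = 0"
    if M: "M \<in> flag_algebra" and N: "N \<in> flag_algebra" and jk: "j \<in> I" "k \<in> I" "j < k" "(j, k) \<noteq> (n-1, n)" for M N j k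
  proof -
    have "bil M (q j) (r l) * bil N (q l) (r k) = 0" if l: "l \<in> I" for l
    proof (rule ccontr)
      assume "bil M (q j) (r l) * bil N (q l) (r k) \<noteq> 0"
      then have "l \<le> j \<or> (j = n - 1 \<and> l = n)" "k \<le> l \<or> (l = n - 1 \<and> k = n)"
        using tri[OF M jk(1) l] tri[OF N l jk(2)] by auto
      then show False using jk by auto
    qed
    then show ?thesis unfolding qr[OF M jk(1,2)] by (intro sum.neutral) simp
  qed
  have block: "bil (M ** N) (q j) (r j) =
     (1/2) * (bil M (q j) (r (n-1)) * bil N (q (n-1)) (r j)) + (1/2) * (bil M (q j) (r n) * bil N (q n) (r j))"
    if M: "M \<in> flag_algebra" and N: "N \<in> flag_algebra" and j: "j = n - 1 \<or> j = n" for M N j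
  proof -
    have jI: "j \<in> I" using j I by auto
    have "bil N (q l) (r j) = 0" if "l \<in> I" "l \<noteq> n - 1" "l \<noteq> n" for l
      using tri[OF N that(1) jI] that j by auto
    then show ?thesis unfolding qr[OF M jI jI] by (intro two) auto
  qed
  have first: "bil (M ** N) (q 1) (r 1) = (1/2) * (bil M (q 1) (r 1) * bil N (q 1) (r 1))"
    if M: "M \<in> flag_algebra" and N: "N \<in> flag_algebra" for M N
  proof -
    have "bil M (q 1) (r l) = 0" if "l \<in> I" "l \<noteq> 1" for l
      using tri[OF M I(1) that(1)] that ne by auto
    then have "(\<Sum>l\<in>I. (1/2) * (bil M (q 1) (r l) * bil N (q l) (r 1))) =
       (\<Sum>l\<in>{1}. (1/2) * (bil M (q 1) (r l) * bil N (q l) (r 1)))"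
      using I by (intro sum.mono_neutral_right) auto
    then show ?thesis using qr[OF M I(1) I(1)] by simp
  qed
  have rr: "bil (M ** N) (r (n-1)) (r n) =
     (1/2) * (bil N (r (n-1)) (r n) * bil M (r (n-1)) (q (n-1)) + bil M (r (n-1)) (r n) * bil N (q n) (r n))"
    if M: "M \<in> flag_algebra" and N: "N \<in> flag_algebra" for M N
  proof -
    note sk = bil_skew[OF flagD(1)[OF M]] bil_skew[OF flagD(1)[OF N]]
    have z: "bil X (r k) (r k) = 0" if "X \<in> flag_algebra" for X k
      using bil_skew[OF flagD(1)[OF that], of "r k" "r k"] by simp
    have "bil M (r (n-1)) (q l) = 0" "bil N (q l) (r n) = 0" if "l \<in> I" "l \<noteq> n - 1" "l \<noteq> n" for l
      using tri[OF M that(1) I(3)] tri[OF N that(1) I(2)] that sk(1)[of "r (n-1)" "q l"] by auto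
    then have "bil (M ** N) (r (n-1)) (r n) =
      (1/2) * (bil M (r (n-1)) (q (n-1)) * bil N (r (n-1)) (r n) + bil M (r (n-1)) (r (n-1)) * bil N (q (n-1)) (r n))
      + (1/2) * (bil M (r (n-1)) (q n) * bil N (r n) (r n) + bil M (r (n-1)) (r n) * bil N (q n) (r n))"
      unfolding bil_mult by (intro two) auto
    then show ?thesis using z[OF M] z[OF N] by (simp add: algebra_simps)
  qed
  let ?C = "commutator A B"
  note Ap = coupledD(1)[OF AB(1)] and Bp = coupledD(1)[OF AB(2)]
  have "?C \<in> flag_algebra"
    unfolding flag_algebra_def
  proof (intro CollectI conjI ballI impI)
    show "?C \<in> so_complex" by (intro so_commutator A B)
    show "bil ?C (q j) (q k) = 0" if "j \<in> I" "k \<in> I" for j k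
      using qq that Ap Bp by (simp add: commutator_def bil_simps)
    show "bil ?C (q j) (r k) = 0" if "j \<in> I" "k \<in> I" "j < k \<and> (j, k) \<noteq> (n-1, n)" for j k
      using lower that Ap Bp by (simp add: commutator_def bil_simps)
    show "bil ?C (q (n-1)) (r (n-1)) + bil ?C (q n) (r n) = 0"
      using block[OF Ap Bp] block[OF Bp Ap] by (simp add: commutator_def bil_simps algebra_simps)
  qed
  moreover have "bil ?C (q 1) (r 1) = 0"
    unfolding commutator_def bil_simps first[OF Ap Bp] first[OF Bp Ap] by simp
  moreover have "bil ?C (r (n-1)) (r n) = 0"
    unfolding commutator_def bil_simps rr[OF Ap Bp] rr[OF Bp Ap] A(4) B(4)
      bil_skew[OF A(1), of "r (n-1)" "q (n-1)"] bil_skew[OF B(1), of "r (n-1)" "q (n-1)"]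
    by (simp add: algebra_simps)
  ultimately show ?thesis by (simp add: s_eq_coupled coupled_def)
qed

end

context so_coordinates
begin

subsection \<open>The conjugation in isotropic coordinates\<close>

text \<open>The antilinear map of vectors that induces \<open>\<tau>\<close> on bivectors.\<close>

definition vconj :: "complex^'m \<Rightarrow> complex^'m" where
  "vconj u = (\<chi> a. (if a = ix (2*n) then - 1 else 1) * cnj (u $ a))"

lemma tau_bivector: "\<tau> (bivector u v) = bivector (vconj u) (vconj v)"
  by (simp add: vec_eq_iff tau_nth bivector_def vconj_def algebra_simps)

lemma bil_tau: "bil (\<tau> A) u v = cnj (bil A (vconj u) (vconj v))"
  unfolding bil_def cdot_def matrix_vector_mult_def
  by (simp add: tau_nth vconj_def sum_distrib_left cnj_sum)
    (intro sum.cong refl, simp)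

lemma vconj_simps: "vconj (u + v) = vconj u + vconj v" "vconj (u - v) = vconj u - vconj v"
  "vconj (c *s u) = cnj c *s vconj u"
  by (simp_all add: vconj_def vec_eq_iff algebra_simps)

lemma vconj_e: "i \<in> {1..2*n} \<Longrightarrow> vconj (e i) = (if i = 2*n then - e i else e i)"
proof -
  assume "i \<in> {1..2*n}"
  moreover have "2*n \<in> {1..2*n}" using n4 by simp
  ultimately have "ix i = ix (2*n) \<longleftrightarrow> i = 2*n"
    using bij inj_on_eq_iff[of ix "{1..2*n}" i "2*n"] by (auto simp: bij_betw_def)
  then show ?thesis by (auto simp: e_def vconj_def axis_def vec_eq_iff)
qed

lemma vconj_pm:
  assumes "k \<in> I"
  shows "k < n \<Longrightarrow> vconj (pv k) = mv k" "k < n \<Longrightarrow> vconj (mv k) = pv k"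
    "vconj (pv n) = pv n" "vconj (mv n) = mv n"
proof -
  have i: "2*k-1 \<in> {1..2*n}" "2*k \<in> {1..2*n}" "2*n-1 \<in> {1..2*n}" "2*n \<in> {1..2*n}"
    "2*k-1 \<noteq> 2*n" "2*n-1 \<noteq> 2*n"
    using assms by auto
  then show "k < n \<Longrightarrow> vconj (pv k) = mv k" "k < n \<Longrightarrow> vconj (mv k) = pv k"
    "vconj (pv n) = pv n" "vconj (mv n) = mv n"
    by (simp_all add: pv_def mv_def vconj_simps vconj_e del: atLeastAtMost_iff)
qed

lemma vconj_qr:
  "k \<in> I \<Longrightarrow> k < n \<Longrightarrow> vconj (q k) = r k" "k \<in> I \<Longrightarrow> k < n \<Longrightarrow> vconj (r k) = q k"
  "vconj (q n) = q n" "vconj (r n) = r n"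
  using n4 vconj_pm[of n] by (auto simp: q_def r_def vconj_pm)

lemma vconj_special: "vconj (q 1) = r 1" "vconj (r 1) = q 1"
  "vconj (q (n-1)) = r (n-1)" "vconj (r (n-1)) = q (n-1)"
  using n4 by (auto intro!: vconj_qr)

lemma bil_real: "\<tau> A = A \<Longrightarrow> bil A u v = cnj (bil A (vconj u) (vconj v))"
  by (metis bil_tau)

lemma special_indices: "1 \<in> I" "n \<in> I" "n - 1 \<in> I" "n - 1 \<noteq> n" "1 \<noteq> n - 1" "1 \<noteq> n" "n - 1 < n"
  using n4 by auto

text \<open>The conjugation exchanges \<open>q\<^sub>k\<close> and \<open>r\<^sub>k\<close> for \<open>k < n\<close> and fixes \<open>q\<^sub>n\<close> and \<open>r\<^sub>n\<close>, so each flag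
  condition on a real \<open>A\<close> yields a second one. For \<open>k = n - 1\<close> and \<open>k = n\<close> the diagonal coordinates
  are imaginary and real and add up to 0, so they vanish.\<close>

lemma real_flag_coordinates:
  assumes A: "A \<in> flag_algebra" "\<tau> A = A" and jk: "j \<in> I" "k \<in> I"
  shows "bil A (r j) (r k) \<noteq> 0 \<Longrightarrow> (j, k) = (n-1, n) \<or> (j, k) = (n, n-1)"
    "bil A (q j) (r k) \<noteq> 0 \<Longrightarrow> (j = k \<and> k \<le> n - 2) \<or> (j, k) = (n-1, n)"
    "k < n \<Longrightarrow> Re (bil A (q k) (r k)) = 0"
proof -
  note P = flagD[OF A(1)] and re = bil_real[OF A(2)] and sk = bil_skew[OF P(1)]
  have im: "Re (bil A (q k) (r k)) = 0" if "k \<in> I" "k < n" for k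
  proof -
    have "bil A (q k) (r k) = cnj (bil A (r k) (q k))"
      using re[of "q k" "r k"] that by (simp add: vconj_qr)
    also have "\<dots> = - cnj (bil A (q k) (r k))" using sk[of "r k" "q k"] by simp
    finally show ?thesis by (simp add: complex_eq_iff)
  qed
  then show "k < n \<Longrightarrow> Re (bil A (q k) (r k)) = 0" using jk by blast
  have last: "bil A (q n) (r n) = 0" "bil A (q (n-1)) (r (n-1)) = 0"
  proof -
    have "bil A (q n) (r n) = cnj (bil A (q n) (r n))" using re[of "q n" "r n"] by (simp add: vconj_qr)
    then have 1: "Im (bil A (q n) (r n)) = 0" by (simp add: complex_eq_iff)
    have 2: "Re (bil A (q (n-1)) (r (n-1))) = 0" using im special_indices by blast
    show "bil A (q n) (r n) = 0" "bil A (q (n-1)) (r (n-1)) = 0"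
      using 1 2 P(4) by (auto simp: complex_eq_iff)
  qed
  have rr: "bil A (r j) (r k) = 0" if "j \<in> I" "k \<in> I" "j < k" "(j, k) \<noteq> (n-1, n)" for j k
  proof (cases "k = n")
    case True
    then have "bil A (q j) (r n) = 0" using P(3)[of j n] that by auto
    then show ?thesis using re[of "r j" "r k"] that True by (simp add: vconj_qr)
  next
    case False
    then show ?thesis using re[of "r j" "r k"] P(2)[of j k] that by (simp add: vconj_qr)
  qed
  show "(j, k) = (n-1, n) \<or> (j, k) = (n, n-1)" if "bil A (r j) (r k) \<noteq> 0"
  proof (rule ccontr)
    assume c: "\<not> ?thesis"
    consider "j < k" | "j = k" | "k < j" by linarith
    then show False
    proof cases
      case 1
      then show False using rr[OF jk] c that by auto
    next
      case 2
      then show False using sk[of "r j" "r j"] that by simp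
    next
      case 3
      then show False using rr[OF jk(2,1)] c that sk[of "r j" "r k"] by auto
    qed
  qed
  show "(j = k \<and> k \<le> n - 2) \<or> (j, k) = (n-1, n)" if nz: "bil A (q j) (r k) \<noteq> 0"
  proof (rule ccontr)
    assume c: "\<not> ?thesis"
    consider "j < k" | "j = k" | "k < j" by linarith
    then show False
    proof cases
      case 1
      then show False using P(3)[OF jk] c nz by auto
    next
      case 2
      then have "j = n - 1 \<or> j = n" using c jk by auto
      then show False using last nz 2 by auto
    next
      case 3
      show False
      proof (cases "j = n")
        case True
        then show False using re[of "q j" "r k"] P(2)[OF jk(1,2)] jk nz 3 by (simp add: vconj_qr)
      next
        case False
        then have "bil A (q k) (r j) = 0" using P(3)[OF jk(2,1)] 3 by auto
        then show False
          using re[of "q j" "r k"] jk nz 3 False sk[of "r j" "q k"] by (simp add: vconj_qr)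
      qed
    qed
  qed
qed

subsection \<open>Admissibility\<close>

lemma s_subset_so: "s \<subseteq> so_complex"
  using coupledD(1) flagD(1) by blast

lemma complex_subalgebra_s: "complex_subalgebra (s)"
  by (simp add: complex_subalgebra_def s_subspace s_commutator)

text \<open>Up to sign, every bivector of basis vectors lies in \<open>s\<close> or is conjugate to one that does, except
  for the diagonal ones with \<open>k = 1\<close>, \<open>n - 1\<close>, \<open>n\<close>: these come from \<open>T\<close>, \<open>K\<close> and \<open>\<tau> K\<close>.\<close>

lemma s_plus_tau_s: "{A + \<tau> B | A B. A \<in> s \<and> B \<in> s} = so_complex"
proof -
  define V where "V = {A + \<tau> B | A B. A \<in> s \<and> B \<in> s}"
  note s0 = cmat.subspace_0[OF s_subspace]
  have tz: "\<tau> 0 = 0" using tau_scaleR[of n ix 0 0] by simp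
  have V: "cmat.subspace V"
    unfolding cmat.subspace_def
  proof (intro conjI ballI allI)
    show "0 \<in> V" unfolding V_def using s0 tz by force
    fix x y c assume "x \<in> V"
    then obtain A B where x: "x = A + \<tau> B" "A \<in> s" "B \<in> s"
      by (auto simp: V_def)
    have "cscale c x = cscale c A + \<tau> (cscale (cnj c) B)"
      by (simp add: x tau_cscale cmat.scale_right_distrib)
    then show "cscale c x \<in> V" unfolding V_def using x s_cscale by blast
    assume "y \<in> V"
    then obtain C D where y: "y = C + \<tau> D" "C \<in> s" "D \<in> s"
      by (auto simp: V_def)
    have "x + y = (A + C) + \<tau> (B + D)" by (simp add: x y tau_add)
    then show "x + y \<in> V" unfolding V_def using x y cmat.subspace_add[OF s_subspace] by blast
  qed
  have sV: "A \<in> V" if "A \<in> s" for A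
  proof -
    have "A = A + \<tau> 0" by (simp add: tz)
    then show ?thesis unfolding V_def using that s0 by blast
  qed
  have tV: "\<tau> A \<in> V" if "A \<in> s" for A
  proof -
    have "\<tau> A = 0 + \<tau> A" by simp
    then show ?thesis unfolding V_def using that s0 by blast
  qed
  note idx = special_indices
  have neg: "bivector u v \<in> V" if "bivector v u \<in> V" for u v
    using cmat.subspace_neg[OF V that] by (simp flip: bivector_simps(1))
  have Z: "bivector (q n) (r (n-1)) \<in> s" using qr_in_s idx by auto
  have X: "bivector (q (n-1)) (q n) \<in> V"
    by (rule neg, use tV[OF Z] in \<open>simp add: tau_bivector vconj_qr vconj_special del: One_nat_def\<close>)
  have qq: "bivector (q j) (q k) \<in> V" if "j \<in> I" "k \<in> I" for j k
    using qq_in_s[OF that] X neg[OF X] sV by (auto simp: doubleton_eq_iff)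
  have diag: "bivector (q k) (r k) \<in> V" if k: "k \<in> I" for k
  proof -
    consider "k = 1" | "2 \<le> k" "k \<le> n - 2" | "k = n - 1" | "k = n" using k by force
    then show ?thesis
    proof cases
      case 1
      have "cscale 2 (T - bivector (q (n-1)) (q n)) \<in> V"
        by (intro cmat.subspace_scale[OF V] cmat.subspace_diff[OF V] sV T_in_s X)
      then show ?thesis by (simp add: T_eq 1)
    next
      case 2
      then show ?thesis by (intro sV qr_diag_in_s)
    next
      case 3
      have "K - \<tau> K \<in> V" by (intro cmat.subspace_diff[OF V] sV tV K_in_s)
      moreover have "K - \<tau> K = bivector (q (n-1)) (r (n-1))"
        by (simp add: K_eq tau_cscale tau_diff tau_minus tau_bivector vconj_qr vconj_special
            bivector_simps(1)[of "r (n-1)" "q (n-1)"] vec_eq_iff algebra_simps del: One_nat_def)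
      ultimately show ?thesis using 3 by simp
    next
      case 4
      have "- (K + \<tau> K) \<in> V"
        by (intro cmat.subspace_neg[OF V] cmat.subspace_add[OF V] sV tV K_in_s)
      moreover have "- (K + \<tau> K) = bivector (q n) (r n)"
        by (simp add: K_eq tau_cscale tau_diff tau_minus tau_bivector vconj_qr vconj_special
            bivector_simps(1)[of "r (n-1)" "q (n-1)"] vec_eq_iff algebra_simps del: One_nat_def)
      ultimately show ?thesis using 4 by simp
    qed
  qed
  have qr: "bivector (q j) (r k) \<in> V" if jk: "j \<in> I" "k \<in> I" for j k
  proof -
    consider "j < k \<or> (j, k) = (n, n-1)" | "j = k" | "k < j" "j < n" | "j = n" "k < n - 1"
      using jk by force
    then show ?thesis
    proof cases
      case 1
      then show ?thesis by (intro sV qr_in_s jk)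
    next
      case 2
      then show ?thesis using diag jk by simp
    next
      case 3
      then have t: "\<tau> (bivector (q k) (r j)) \<in> V" by (intro tV qr_in_s jk) simp
      show ?thesis by (rule neg, use t 3 jk in \<open>simp add: tau_bivector vconj_qr\<close>)
    next
      case 4
      then have "\<tau> (bivector (q j) (q k)) \<in> V"
        using idx by (intro tV qq_in_s jk) (auto simp: doubleton_eq_iff)
      then show ?thesis using 4 jk by (simp add: tau_bivector vconj_qr)
    qed
  qed
  have rr: "bivector (r j) (r k) \<in> V" if jk: "j \<in> I" "k \<in> I" for j k
  proof -
    have n1: "bivector (r j) (r n) \<in> V" if "j \<in> I" "j < n" for j
    proof -
      have "\<tau> (bivector (q j) (r n)) \<in> V" using that idx by (intro tV qr_in_s) auto
      then show ?thesis using that by (simp add: tau_bivector vconj_qr)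
    qed
    consider "j < n" "k < n" | "j < n" "k = n" | "j = n" "k < n" | "j = n" "k = n" using jk by force
    then show ?thesis
    proof cases
      case 1
      then have "\<tau> (bivector (q j) (q k)) \<in> V"
        by (intro tV qq_in_s jk) (auto simp: doubleton_eq_iff)
      then show ?thesis using 1 jk by (simp add: tau_bivector vconj_qr)
    next
      case 2
      then show ?thesis using n1 jk by simp
    next
      case 3
      show ?thesis by (rule neg, use 3 n1 jk in simp)
    next
      case 4
      then show ?thesis by (simp add: bivector_simps(2) cmat.subspace_0[OF V])
    qed
  qed
  have "so_complex \<subseteq> V"
    using in_subspace_by_coordinates[OF _ V] qq qr rr by blast
  moreover have "V \<subseteq> so_complex"
    using s_subset_so unfolding V_def by (blast intro: tau_so cmat.subspace_add[OF so_subspace])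
  ultimately show ?thesis unfolding V_def by blast
qed

lemma complex_dualD:
  assumes "f \<in> complex_dual so_complex" "A \<in> so_complex" "B \<in> so_complex"
  shows "f (A + B) = f A + f B" "f (cscale c A) = c * f A" "f (- A) = - f A"
proof -
  have *: "f (cscale a A + cscale b B) = a * f A + b * f B" for a b
    using assms unfolding complex_dual_def complex_linear_on_def by blast
  show "f (A + B) = f A + f B" using *[of 1 1] by simp
  show "f (cscale c A) = c * f A" using *[of c 0] by simp
  show "f (- A) = - f A" using *[of "-1" 0] by simp
qed

text \<open>Both sides are linear in \<open>A\<close> and agree on the basis of bivectors.\<close>

lemma dual_cartan_basis_coordinate:
  assumes \<epsilon>: "dual_cartan_basis n ix \<epsilon>" and k: "k \<in> I" "k < n" and A: "A \<in> so_complex"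
  shows "\<epsilon> k A = - (1/2) * bil A (q k) (r k)"
proof -
  have d: "\<epsilon> k \<in> complex_dual so_complex"
    and H: "\<And>j. j \<in> I \<Longrightarrow> \<epsilon> k (H_elem ix j) = (if j = k then 1 else 0)"
    and X: "\<And>i j. i \<in> I \<Longrightarrow> j \<in> I \<Longrightarrow> i \<noteq> j \<Longrightarrow> \<epsilon> k (X_elem ix i j) = 0"
    and Y: "\<And>i j. i \<in> I \<Longrightarrow> j \<in> I \<Longrightarrow> i < j \<Longrightarrow> \<epsilon> k (Y_elem ix i j) = 0"
    and Z: "\<And>i j. i \<in> I \<Longrightarrow> j \<in> I \<Longrightarrow> i < j \<Longrightarrow> \<epsilon> k (Z_elem ix i j) = 0"
    using \<epsilon> k unfolding dual_cartan_basis_def by blast+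
  note lin = complex_dualD[OF d]
  have neg: "\<epsilon> k (bivector v u) = - \<epsilon> k (bivector u v)" for u v
    using lin(3)[OF bivector_so bivector_so, of u v] by (simp flip: bivector_simps(1))
  have self: "\<epsilon> k (bivector u u) = 0" for u
    using neg[of u u] by simp
  have pp: "\<epsilon> k (bivector (pv i) (pv j)) = 0" if "i \<in> I" "j \<in> I" for i j
  proof -
    have *: "\<epsilon> k (bivector (pv i) (pv j)) = 0" if "i \<in> I" "j \<in> I" "i < j" for i j
      using Y[OF that] lin(3)[OF bivector_so bivector_so, of "pv i" "pv j"] that
      by (simp add: Y_elem_eq)
    consider "i < j" | "i = j" | "j < i" by linarith
    then show ?thesis
      by cases (use *[OF that] *[OF that(2,1)] self neg[of "pv i" "pv j"] in auto)
  qed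
  have mm: "\<epsilon> k (bivector (mv i) (mv j)) = 0" if "i \<in> I" "j \<in> I" for i j
  proof -
    have *: "\<epsilon> k (bivector (mv i) (mv j)) = 0" if "i \<in> I" "j \<in> I" "i < j" for i j
      using Z[OF that] that by (simp add: Z_elem_eq)
    consider "i < j" | "i = j" | "j < i" by linarith
    then show ?thesis
      by cases (use *[OF that] *[OF that(2,1)] self neg[of "mv i" "mv j"] in auto)
  qed
  have pm: "\<epsilon> k (bivector (pv i) (mv j)) = (if i = j \<and> j = k then 2 else 0)" if "i \<in> I" "j \<in> I" for i j
  proof -
    consider "i < j" | "i = j" | "j < i" by linarith
    then show ?thesis
    proof cases
      case 1
      then show ?thesis using X[OF that] by (simp add: X_elem_eq)
    next
      case 2
      then show ?thesis using H[OF that(2)] lin(2)[OF bivector_so bivector_so, of "1/2" "pv j" "mv j"]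
        by (auto simp: H_elem_eq field_simps split: if_splits)
    next
      case 3
      then show ?thesis
        using X[OF that] X_elem_swap[OF 3] bivector_simps(1)[of "mv j" "pv i"] by simp
    qed
  qed
  have mp: "\<epsilon> k (bivector (mv i) (pv j)) = (if i = j \<and> j = k then - 2 else 0)" if "i \<in> I" "j \<in> I" for i j
    using pm[OF that(2,1)] neg[of "mv i" "pv j"] by auto
  let ?V = "{A \<in> so_complex. \<epsilon> k A = - (1/2) * bil A (q k) (r k)}"
  have V: "cmat.subspace ?V"
    using so_subspace lin complex_dualD(2)[OF d, of 0 0 0]
    by (auto simp: cmat.subspace_def bil_simps algebra_simps)
  have "A \<in> ?V"
  proof (rule in_subspace_by_coordinates[OF A V])
    fix i j assume ij: "i \<in> I" "j \<in> I"
    have "\<epsilon> k (bivector (q i) (q j)) = 0"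
      using ij k by (cases "i = n"; cases "j = n") (simp_all add: q_def pp mm pm mp del: atLeastAtMost_iff)
    then show "bivector (q i) (q j) \<in> ?V"
      using ij k by (simp add: bivector_so bil_bivector del: atLeastAtMost_iff)
    have "\<epsilon> k (bivector (r i) (r j)) = 0"
      using ij k by (cases "i = n"; cases "j = n") (simp_all add: r_def pp mm pm mp del: atLeastAtMost_iff)
    then show "bivector (r i) (r j) \<in> ?V"
      using ij k by (simp add: bivector_so bil_bivector del: atLeastAtMost_iff)
    have "\<epsilon> k (bivector (q j) (r i)) = (if i = k \<and> j = k then 2 else 0)"
      using ij k by (cases "i = n"; cases "j = n") (auto simp: q_def r_def pp mm pm mp simp del: atLeastAtMost_iff)
    then show "bivector (q j) (r i) \<in> ?V"
      using ij k bil_basis(5)[OF ij(2,1) k(1) k(1)] by (auto simp: bivector_so)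
  qed
  then show ?thesis by simp
qed

end

context so_coordinates
begin

text \<open>The second element is \<open>\<i> T\<close> corrected by a multiple of the conjugate of \<open>X\<^sub>n\<^sub>-\<^sub>1\<^sub>,\<^sub>n\<close>.\<close>

lemma real_form_elements:
  shows "2 \<le> k \<Longrightarrow> k \<le> n - 2 \<Longrightarrow> cscale \<i> (H_elem ix k) \<in> s \<inter> g0"
    and "cscale \<i> (T + bivector (q n) (r (n-1))) \<in> s \<inter> g0"
proof -
  note idx = special_indices
  have "\<tau> (cscale \<i> (H_elem ix k)) = cscale \<i> (H_elem ix k)" if "2 \<le> k" "k \<le> n - 2"
  proof -
    have "k \<in> I" "k < n" using that by auto
    then show ?thesis
      by (simp add: H_elem_eq tau_cscale tau_bivector vconj_pm bivector_simps(1)[of "mv k" "pv k"]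
          vec_eq_iff)
  qed
  then show "2 \<le> k \<Longrightarrow> k \<le> n - 2 \<Longrightarrow> cscale \<i> (H_elem ix k) \<in> s \<inter> g0"
    using s_cscale[OF H_in_s] s_subset_so by (auto simp: real_form_def)
  have Z: "bivector (q n) (r (n-1)) \<in> s" using qr_in_s idx by auto
  have s: "cscale \<i> (T + bivector (q n) (r (n-1))) \<in> s"
    by (intro s_cscale cmat.subspace_add[OF s_subspace] T_in_s Z)
  have "\<tau> (T + bivector (q n) (r (n-1))) = - (T + bivector (q n) (r (n-1)))"
    by (simp add: T_eq tau_add tau_cscale tau_bivector vconj_qr vconj_special
        bivector_simps(1)[of "r 1" "q 1"] bivector_simps(1)[of "q n" "q (n-1)"]
        bivector_simps(1)[of "r (n-1)" "q n"] vec_eq_iff del: One_nat_def)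
  then have "\<tau> (cscale \<i> (T + bivector (q n) (r (n-1)))) = cscale \<i> (T + bivector (q n) (r (n-1)))"
    by (simp only: tau_cscale) (simp add: vec_eq_iff algebra_simps)
  then show "cscale \<i> (T + bivector (q n) (r (n-1))) \<in> s \<inter> g0"
    using s s_subset_so by (auto simp: real_form_def)
qed

text \<open>On \<open>s \<inter> g0\<close> the coordinates \<open>\<epsilon>\<^sub>1, \<dots>, \<epsilon>\<^sub>n\<^sub>-\<^sub>2\<close> are imaginary and determine the element, and
  \<open>Im \<omega>\<close> is, up to signs, the standard symplectic form in them; here \<open>n\<close> has to be even.\<close>

lemma nondegenerate:
  assumes even: "even n" and \<epsilon>: "dual_cartan_basis n ix \<epsilon>"
    and \<omega>: "\<And>X Y. X \<in> s \<inter> g0 \<Longrightarrow>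
           Y \<in> s \<inter> g0 \<Longrightarrow>
           \<omega> X Y = \<i> * (\<Sum>j = 1..n div 2 - 1. wedge (\<epsilon> (2*j-1)) (\<epsilon> (2*j)) X Y)"
    and X: "X \<in> s \<inter> g0"
    and 0: "\<And>Y. Y \<in> s \<inter> g0 \<Longrightarrow> Im (\<omega> X Y) = 0"
  shows "X = 0"
proof -
  note idx = special_indices
  have Xs: "X \<in> s" and Xso: "X \<in> so_complex" and Xt: "\<tau> X = X"
    using X by (auto simp: real_form_def)
  note P = coupledD[OF Xs]
  have eps: "\<epsilon> l A = - (1/2) * bil A (q l) (r l)" if "l \<in> {1..n-2}" "A \<in> so_complex" for l A
    using that n4 by (intro dual_cartan_basis_coordinate[OF \<epsilon>]) auto
  \<comment> \<open>the basis of \<open>s \<inter> g0\<close> dual to the coordinates, up to the factor \<open>\<i>\<close>\<close>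
  define y where "y k = (if k = 1 then cscale \<i> (T + bivector (q n) (r (n-1))) else cscale \<i> (H_elem ix k))" for k
  have y: "y k \<in> s \<inter> g0" if "k \<in> {1..n-2}" for k
    using real_form_elements that by (auto simp: y_def simp del: One_nat_def)
  have eps_y: "\<epsilon> l (y k) = (if l = k then \<i> else 0)" if l: "l \<in> {1..n-2}" and k: "k \<in> {1..n-2}" for l k
  proof -
    have I: "l \<in> I" "k \<in> I" "l < n - 1" "k < n - 1" "k \<noteq> n" using l k n4 by auto
    have "y k \<in> so_complex" using y[OF k] by (auto simp: real_form_def)
    then have "\<epsilon> l (y k) = - (1/2) * bil (y k) (q l) (r l)" by (rule eps[OF l])
    also have "bil (y k) (q l) (r l) = (if l = k then - 2 * \<i> else 0)"
    proof (cases "k = 1")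
      case True
      have "bil T (q l) (r l) = (if l = 1 then - 2 else 0)"
        using bil_basis(5)[OF idx(1,1) I(1,1)] bil_basis(2)[OF idx(3,2) I(1,1)]
        by (simp add: T_eq bil_simps del: One_nat_def)
      moreover have "bil (bivector (q n) (r (n-1))) (q l) (r l) = 0"
        using bil_basis(5)[OF idx(2,3) I(1,1)] I by simp
      ultimately show ?thesis using True by (simp add: y_def bil_simps del: One_nat_def)
    next
      case False
      have "H_elem ix k = cscale (1/2) (bivector (q k) (r k))" using I by (simp add: H_elem_eq q_def r_def)
      then show ?thesis
        using False bil_basis(5)[OF I(2,2) I(1,1)] by (auto simp: y_def bil_simps)
    qed
    finally show ?thesis by simp
  qed
  have w: "\<omega> X (y k) = \<i> * (\<Sum>j = 1..n div 2 - 1. \<epsilon> (2*j-1) X * (if 2*j = k then \<i> else 0)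
      - (if 2*j-1 = k then \<i> else 0) * \<epsilon> (2*j) X)" if k: "k \<in> {1..n-2}" for k
  proof -
    have "wedge (\<epsilon> (2*j-1)) (\<epsilon> (2*j)) X (y k) = \<epsilon> (2*j-1) X * (if 2*j = k then \<i> else 0)
      - (if 2*j-1 = k then \<i> else 0) * \<epsilon> (2*j) X" if "j \<in> {1..n div 2 - 1}" for j
    proof -
      have "2*j \<in> {1..n-2}" "2*j-1 \<in> {1..n-2}" using that by auto
      then show ?thesis by (simp only: wedge_def eps_y[OF _ k])
    qed
    then show ?thesis unfolding \<omega>[OF X y[OF k]] by simp
  qed
  have re: "Re (\<epsilon> l X) = 0" if "l \<in> {1..n-2}" for l
  proof -
    have "l \<in> I" "l < n" using that n4 by auto
    then have "Re (bil X (q l) (r l)) = 0"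
      using real_flag_coordinates(3)[OF P(1) Xt, of l l] by blast
    then show ?thesis using eps[OF that Xso] by simp
  qed
  have z: "\<epsilon> l X = 0" if l: "l \<in> {1..n-2}" for l
  proof (cases "even l")
    case True
    then obtain m where m: "l = 2 * m" by blast
    have k: "2*m-1 \<in> {1..n-2}" "m \<in> {1..n div 2 - 1}" using l m by auto
    have "2*j \<noteq> 2*m-1" "2*j-1 = 2*m-1 \<longleftrightarrow> j = m" if "j \<in> {1..n div 2 - 1}" for j
      using that k(2) by auto presburger+
    then have "\<omega> X (y (2*m-1)) = \<i> * (\<Sum>j = 1..n div 2 - 1. if j = m then - \<i> * \<epsilon> (2*m) X else 0)"
      unfolding w[OF k(1)] by (intro arg_cong2[of _ _ _ _ "(*)"] refl sum.cong) auto
    also have "\<dots> = \<epsilon> l X" using k(2) m by simp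
    finally have "Im (\<epsilon> l X) = 0" using 0[OF y[OF k(1)]] by simp
    then show ?thesis using re[OF l] by (simp add: complex_eq_iff)
  next
    case False
    then obtain m' where m': "l = 2 * m' + 1" by (rule oddE)
    define m where "m = m' + 1"
    have m: "l = 2 * m - 1" "1 \<le> m" using m' by (auto simp: m_def)
    have k: "2*m \<in> {1..n-2}" "m \<in> {1..n div 2 - 1}" using l m even by (auto, presburger+)
    have "2*j-1 \<noteq> 2*m" "2*j = 2*m \<longleftrightarrow> j = m" if "j \<in> {1..n div 2 - 1}" for j
      using that k(2) by auto presburger+
    then have "\<omega> X (y (2*m)) = \<i> * (\<Sum>j = 1..n div 2 - 1. if j = m then \<i> * \<epsilon> (2*m-1) X else 0)"
      unfolding w[OF k(1)] by (intro arg_cong2[of _ _ _ _ "(*)"] refl sum.cong) auto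
    also have "\<dots> = - \<epsilon> l X" using k(2) m by simp
    finally have "Im (\<epsilon> l X) = 0" using 0[OF y[OF k(1)]] by simp
    then show ?thesis using re[OF l] by (simp add: complex_eq_iff)
  qed
  then have diag: "bil X (q l) (r l) = 0" if "l \<in> {1..n-2}" for l
    using eps[OF that Xso] that by simp
  have rr: "bil X (r (n-1)) (r n) = 0"
    using P(2) diag[of 1] n4 by simp
  have last: "bil X (q (n-1)) (r n) = 0"
    using bil_real[OF Xt, of "q (n-1)" "r n"] rr by (simp add: vconj_qr vconj_special del: One_nat_def)
  have "X \<in> {0}"
  proof (rule in_subspace_by_coordinates[OF Xso])
    show "cmat.subspace {0 :: 'm cmatrix}" by (simp add: cmat.subspace_def)
    fix j k assume jk: "j \<in> I" "k \<in> I"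
    have "bil X (r j) (r k) = 0"
      using real_flag_coordinates(1)[OF P(1) Xt jk] rr bil_skew[OF Xso, of "r n" "r (n-1)"] by auto
    then show "bivector (q j) (q k) \<in> {0}" if "bil X (r j) (r k) \<noteq> 0" using that by simp
    have "bil X (q j) (r k) = 0"
      using real_flag_coordinates(2)[OF P(1) Xt jk] last diag[of j] jk by auto
    then show "bivector (q k) (r j) \<in> {0}" if "bil X (q j) (r k) \<noteq> 0" using that by simp
    show "bivector (r j) (r k) \<in> {0}" if "bil X (q j) (q k) \<noteq> 0"
      using that flagD(2)[OF P(1) jk] by simp
  qed
  then show ?thesis by simp
qed

subsection \<open>The normalizer of \<open>s\<close> in the real form\<close>

lemma bil_commutator_weights:
  assumes "B \<in> so_complex"
    and "\<And>j. j \<in> I \<Longrightarrow> B *v q j = c j *s q j" "\<And>j. j \<in> I \<Longrightarrow> B *v r j = - c j *s r j"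
    and "j \<in> I" "k \<in> I"
  shows "bil (commutator A B) (q j) (q k) = (c j + c k) * bil A (q j) (q k)"
    "bil (commutator A B) (q j) (r k) = (c j - c k) * bil A (q j) (r k)"
  using assms by (simp_all add: bil_commutator bil_simps algebra_simps)

text \<open>Brackets with \<open>H\<^sub>2, \<dots>, H\<^sub>n\<^sub>-\<^sub>2\<close> and \<open>K\<close> multiply the coordinates by their weights and show that
  those with a nonzero weight vanish if they have to vanish on \<open>s\<close>. The coordinate of
  \<open>r\<^sub>n\<^sub>-\<^sub>1 \<and> r\<^sub>n\<close> and the trace have weight 0; for them the bracket with \<open>T\<close> is used.\<close>

lemma normalizer_subset_flag_algebra:
  assumes A: "A \<in> so_complex" and norm: "\<And>B. B \<in> s \<Longrightarrow> commutator A B \<in> s"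
  shows "A \<in> flag_algebra"
proof -
  note idx = special_indices
  have mid: "(if j = m then 2 else 0) * bil A (q j) (q k) + (if k = m then 2 else 0) * bil A (q j) (q k) = 0"
    "j < k \<Longrightarrow> (j, k) \<noteq> (n-1, n) \<Longrightarrow> (if j = m then 2 else 0) * bil A (q j) (r k)
       - (if k = m then 2 else 0) * bil A (q j) (r k) = 0"
    if m: "2 \<le> m" "m \<le> n - 2" and jk: "j \<in> I" "k \<in> I" for m j k
  proof -
    let ?B = "bivector (q m) (r m)" and ?l = "\<lambda>j. if j = m then 2 else 0 :: complex"
    have mI: "m \<in> I" using m by auto
    have "?B *v q j = ?l j *s q j" "?B *v r j = - ?l j *s r j" if "j \<in> I" for j
      using that mI by (auto simp: bivector_apply simp del: atLeastAtMost_iff)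
    note w = bil_commutator_weights[OF bivector_so this jk, where A = A]
    have "commutator A ?B \<in> flag_algebra" using norm[OF qr_diag_in_s[OF m]] coupledD(1) by blast
    note P = flagD[OF this]
    show "?l j * bil A (q j) (q k) + ?l k * bil A (q j) (q k) = 0"
      using w(1) P(2)[OF jk] by (simp only: distrib_right)
    show "?l j * bil A (q j) (r k) - ?l k * bil A (q j) (r k) = 0" if "j < k" "(j, k) \<noteq> (n-1, n)"
      using w(2) P(3)[OF jk that] by (simp only: left_diff_distrib)
  qed
  let ?l = "\<lambda>j. if j = n-1 then 1 else if j = n then - 1 else 0 :: complex"
  have K: "K *v q j = ?l j *s q j" "K *v r j = - ?l j *s r j" if "j \<in> I" for j
  proof -
    show "K *v q j = ?l j *s q j" "K *v r j = - ?l j *s r j"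
      using that idx
      by (auto simp: K_eq matrix_vector_simps bivector_apply vec_eq_iff simp del: atLeastAtMost_iff One_nat_def)
  qed
  have KP: "commutator A K \<in> flag_algebra" using norm[OF K_in_s] coupledD(1) by blast
  have wK: "bil (commutator A K) (q j) (q k) = (?l j + ?l k) * bil A (q j) (q k)"
    "bil (commutator A K) (q j) (r k) = (?l j - ?l k) * bil A (q j) (r k)"
    if "j \<in> I" "k \<in> I" for j k
    by (rule bil_commutator_weights(1)[OF K_so K that] bil_commutator_weights(2)[OF K_so K that];
        assumption)+
  note PK = flagD[OF KP]
  have TC: "commutator A T \<in> s" by (rule norm[OF T_in_s])
  have Tq: "T *v q (n-1) = 0" "T *v q n = 0" "T *v q 1 = q 1" "T *v r 1 = - r 1"
    "T *v r n = 2 *s q (n-1)" "T *v r (n-1) = - 2 *s q n"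
  proof -
    show "T *v q (n-1) = 0" "T *v q n = 0" "T *v q 1 = q 1" "T *v r 1 = - r 1"
      "T *v r n = 2 *s q (n-1)" "T *v r (n-1) = - 2 *s q n"
      using idx
      by (auto simp: T_eq matrix_vector_simps bivector_apply vec_eq_iff simp del: atLeastAtMost_iff One_nat_def)
  qed
  note bT = bil_commutator[OF T_so, of A] and sk = bil_skew[OF A]
  have F1: "bil A (q 1) (q (n-1)) = 0"
    using wK(1)[OF idx(1,3)] PK(2)[OF idx(1,3)] idx by (simp del: One_nat_def)
  have F2: "bil A (q 1) (q n) = 0"
    using wK(1)[OF idx(1,2)] PK(2)[OF idx(1,2)] idx by (simp del: One_nat_def)
  have F3: "bil A (q (n-1)) (q n) = 0"
  proof -
    have "bil (commutator A T) (q n) (r n) = - bil (commutator A T) (q (n-1)) (r (n-1))"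
      by (rule flagD(4)[OF coupledD(1)[OF TC]])
    then show ?thesis using sk[of "q n" "q (n-1)"] by (simp add: bT Tq bil_simps del: One_nat_def)
  qed
  have self: "bil A u u = 0" for u using sk[of u u] by simp
  have qq: "bil A (q j) (q k) = 0" if jk: "j \<in> I" "k \<in> I" for j k
  proof -
    consider "2 \<le> j" "j \<le> n - 2" | "2 \<le> k" "k \<le> n - 2" |
      "j \<in> {1, n-1, n}" "k \<in> {1, n-1, n}" using jk by force
    then show ?thesis
    proof cases
      case 1
      then show ?thesis using mid(1)[OF 1 jk] by (simp split: if_splits)
    next
      case 2
      then show ?thesis using mid(1)[OF 2 jk] by (simp split: if_splits)
    next
      case 3
      then show ?thesis
        using F1 F2 F3 self sk[of "q (n-1)" "q 1"] sk[of "q n" "q 1"] sk[of "q n" "q (n-1)"]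
        by (auto simp del: One_nat_def)
    qed
  qed
  have qr: "bil A (q j) (r k) = 0" if jk: "j \<in> I" "k \<in> I" "j < k" "(j, k) \<noteq> (n-1, n)" for j k
  proof -
    consider "2 \<le> j" "j \<le> n - 2" | "2 \<le> k" "k \<le> n - 2" | "j = 1" "k = n - 1" | "j = 1" "k = n"
      using jk by force
    then show ?thesis
    proof cases
      case 1
      then show ?thesis using mid(2)[OF 1 jk] jk by simp
    next
      case 2
      then show ?thesis using mid(2)[OF 2 jk] jk by simp
    next
      case 3
      then show ?thesis using wK(2)[OF jk(1,2)] PK(3)[OF jk] idx by (simp del: One_nat_def)
    next
      case 4
      then show ?thesis using wK(2)[OF jk(1,2)] PK(3)[OF jk] idx by (simp del: One_nat_def)
    qed
  qed
  have "bil A (q (n-1)) (r (n-1)) + bil A (q n) (r n) = 0"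
  proof -
    have "bil (commutator A T) (r (n-1)) (r n) = - 2 * bil (commutator A T) (q 1) (r 1)"
      by (rule coupledD(2)[OF TC])
    then have "- bil A (q (n-1)) (r (n-1)) = bil A (q n) (r n)"
      using sk[of "r (n-1)" "q (n-1)"] by (simp add: bT Tq bil_simps del: One_nat_def)
    then show ?thesis by (metis add.right_inverse)
  qed
  then show ?thesis using A qq qr by (simp add: flag_algebra_def)
qed

lemma span_commute:
  assumes "\<And>X Y. X \<in> D \<Longrightarrow> Y \<in> D \<Longrightarrow> commutator X Y = 0" "X \<in> cmat.span D" "Y \<in> cmat.span D"
  shows "commutator X Y = 0"
proof -
  have 1: "commutator X Y = 0" if "X \<in> D" for X
    using assms(3)
  proof (induction rule: cmat.span_induct_alt)
    case (step c x y)
    then show ?case using assms(1)[OF that] by (simp add: commutator_simps)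
  qed (simp add: commutator_simps)
  show ?thesis using assms(2)
  proof (induction rule: cmat.span_induct_alt)
    case (step c x y)
    then show ?case using 1 by (simp add: commutator_simps)
  qed (simp add: commutator_simps)
qed

text \<open>The elements of the real form that normalize \<open>s\<close> lie in an abelian algebra \<open>W\<close>. So a
  self-normalizing \<open>h\<close> among them contains everything real in \<open>W\<close>. But \<open>H\<^sub>n\<close> is real and normalizes
  \<open>W\<close>, hence \<open>h\<close>, and would be in \<open>h \<subseteq> W\<close>.\<close>

lemma no_normalizing_cartan_subalgebra:
  assumes cartan: "cartan_subalgebra (g0) h"
    and norm: "\<And>X Y. X \<in> h \<Longrightarrow> Y \<in> s \<Longrightarrow> commutator X Y \<in> s"
  shows False
proof -
  note idx = special_indices
  define D where "D = {bivector (q k) (r k) | k. k \<in> I \<and> k \<le> n - 2} \<union>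
    {bivector (q (n-1)) (q n), bivector (r (n-1)) (q n)}"
  define W where "W = cmat.span D"
  have W: "cmat.subspace W" by (simp add: W_def cmat.subspace_span)
  have DW: "X \<in> W" if "X \<in> D" for X using that by (simp add: W_def cmat.span_base)
  have Dcases: "P X" if "X \<in> D" "\<And>k. k \<in> I \<Longrightarrow> k \<noteq> n \<Longrightarrow> k \<noteq> n - 1 \<Longrightarrow> P (bivector (q k) (r k))"
    "P (bivector (q (n-1)) (q n))" "P (bivector (r (n-1)) (q n))" for P X
  proof -
    have "k \<noteq> n" "k \<noteq> n - 1" if "k \<in> I" "k \<le> n - 2" for k using that n4 by auto
    then show ?thesis using that by (auto simp: D_def)
  qed
  have comm: "commutator X Y = 0" if "X \<in> D" "Y \<in> D" for X Y
  proof -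
    have kk: "commutator (bivector (q k) (r k)) (bivector (q l) (r l)) = 0" if "k \<in> I" "l \<in> I" for k l
      using that by (cases "k = l") (simp add: commutator_def, simp add: commutator_bivector del: atLeastAtMost_iff)
    have k1: "commutator (bivector (q k) (r k)) (bivector (q (n-1)) (q n)) = 0"
      "commutator (bivector (q k) (r k)) (bivector (r (n-1)) (q n)) = 0"
      if "k \<in> I" "k \<noteq> n" "k \<noteq> n - 1" for k
      using that idx by (simp_all add: commutator_bivector del: atLeastAtMost_iff One_nat_def)
    have k2: "commutator (bivector (q (n-1)) (q n)) (bivector (r (n-1)) (q n)) = 0"
      using idx by (simp add: commutator_bivector bivector_simps(2) del: atLeastAtMost_iff One_nat_def)
    have self: "commutator X X = 0" for X :: "'m cmatrix" by (simp add: commutator_def)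
    show ?thesis
      by (rule Dcases[OF that(1)]; rule Dcases[OF that(2)])
        (use kk k1 k2 self commutator_minus_commute in \<open>metis neg_equal_0_iff_equal\<close>)+
  qed
  have hg: "h \<subseteq> g0"
    and self_norm: "\<And>X. X \<in> g0 \<Longrightarrow> (\<And>Y. Y \<in> h \<Longrightarrow> commutator X Y \<in> h) \<Longrightarrow> X \<in> h"
    and h0: "0 \<in> h"
    using cartan unfolding cartan_subalgebra_def by (blast, blast, auto simp: subspace_def)
  have hW: "h \<subseteq> W"
  proof
    fix X assume X: "X \<in> h"
    then have Xso: "X \<in> so_complex" and Xt: "\<tau> X = X" using hg by (auto simp: real_form_def)
    have P: "X \<in> flag_algebra" using normalizer_subset_flag_algebra[OF Xso norm[OF X]] .
    have n1: "bivector (q (n-1)) (q n) \<in> W" "bivector (r (n-1)) (q n) \<in> W"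
      by (auto intro!: DW simp: D_def)
    have neg: "bivector u v \<in> W" if "bivector v u \<in> W" for u v
      using cmat.subspace_neg[OF W that] by (simp flip: bivector_simps(1))
    show "X \<in> W"
    proof (rule in_subspace_by_coordinates[OF Xso W])
      fix j k assume jk: "j \<in> I" "k \<in> I"
      show "bivector (q j) (q k) \<in> W" if "bil X (r j) (r k) \<noteq> 0"
        using real_flag_coordinates(1)[OF P Xt jk that] n1 neg by auto
      show "bivector (q k) (r j) \<in> W" if "bil X (q j) (r k) \<noteq> 0"
        using real_flag_coordinates(2)[OF P Xt jk that]
      proof
        assume "j = k \<and> k \<le> n - 2"
        then show ?thesis using jk by (auto intro!: DW simp: D_def)
      next
        assume "(j, k) = (n-1, n)"
        then show ?thesis using n1 neg by auto
      qed
      show "bivector (r j) (r k) \<in> W" if "bil X (q j) (q k) \<noteq> 0"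
        using that flagD(2)[OF P jk] by simp
    qed
  qed
  define Hn where "Hn = H_elem ix n"
  have Hn: "Hn = cscale (-1/2) (bivector (q n) (r n))"
    unfolding Hn_def H_elem_eq using bivector_simps(1)[of "pv n" "mv n"]
    by (simp add: q_def r_def vec_eq_iff)
  have "Hn \<in> so_complex" unfolding Hn by (rule cmat.subspace_scale[OF so_subspace bivector_so])
  then have Hg: "Hn \<in> g0"
    by (simp add: real_form_def Hn tau_cscale tau_minus tau_bivector vconj_qr)
  have HD: "commutator Hn X \<in> W" if "X \<in> D" for X
  proof (rule Dcases[OF that])
    show "commutator Hn (bivector (q k) (r k)) \<in> W" if "k \<in> I" "k \<noteq> n" "k \<noteq> n - 1" for k
      using that idx cmat.subspace_0[OF W]
      by (simp add: Hn commutator_simps commutator_bivector del: atLeastAtMost_iff)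
    have "commutator Hn (bivector (q (n-1)) (q n)) = cscale (-1) (bivector (q (n-1)) (q n))"
      using idx by (simp add: Hn commutator_simps commutator_bivector
          bivector_simps(1)[of "q n" "q (n-1)"] vec_eq_iff del: atLeastAtMost_iff One_nat_def)
    then show "commutator Hn (bivector (q (n-1)) (q n)) \<in> W"
      by (simp del: One_nat_def, intro cmat.subspace_neg[OF W] DW) (simp add: D_def)
    have "commutator Hn (bivector (r (n-1)) (q n)) = cscale (-1) (bivector (r (n-1)) (q n))"
      using idx by (simp add: Hn commutator_simps commutator_bivector
          bivector_simps(1)[of "q n" "r (n-1)"] vec_eq_iff del: atLeastAtMost_iff One_nat_def)
    then show "commutator Hn (bivector (r (n-1)) (q n)) \<in> W"
      by (simp del: One_nat_def, intro cmat.subspace_neg[OF W] DW) (simp add: D_def)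
  qed
  have HW: "commutator Hn X \<in> W" if "X \<in> W" for X
    using that unfolding W_def
  proof (induction rule: cmat.span_induct_alt)
    case base
    show ?case using cmat.subspace_0[OF W] by (simp add: commutator_simps W_def)
  next
    case (step c x y)
    have "cscale c (commutator Hn x) + commutator Hn y \<in> W"
      using cmat.subspace_add[OF W cmat.subspace_scale[OF W HD[OF step(1)]]] step by (simp add: W_def)
    then show ?case by (simp add: commutator_simps W_def)
  qed
  have "Hn \<in> h"
  proof (rule self_norm[OF Hg])
    fix Y assume Y: "Y \<in> h"
    show "commutator Hn Y \<in> h"
    proof (rule self_norm)
      show "commutator Hn Y \<in> g0"
        using Hg Y hg by (auto simp: real_form_def tau_commutator intro!: so_commutator)
      fix Z assume "Z \<in> h"
      then have "commutator (commutator Hn Y) Z = 0"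
        using span_commute[OF comm, where X = "commutator Hn Y" and Y = Z] HW Y hW by (auto simp: W_def)
      then show "commutator (commutator Hn Y) Z \<in> h" using h0 by simp
    qed
  qed
  then have "Hn \<in> W" using hW by blast
  moreover have "W \<subseteq> {X. bil X (q n) (r n) = 0}"
    unfolding W_def
  proof (rule cmat.span_minimal)
    show "cmat.subspace {X. bil X (q n) (r n) = 0}" by (auto simp: cmat.subspace_def bil_simps)
    have "bil (bivector (q k) (r k)) (q n) (r n) = 0" if "k \<in> I" "k \<noteq> n" for k
      using bil_basis(5)[OF that(1,1) idx(2,2)] that by simp
    moreover have "bil (bivector (q (n-1)) (q n)) (q n) (r n) = 0"
      using bil_basis(2)[OF idx(3,2,2,2)] .
    moreover have "bil (bivector (r (n-1)) (q n)) (q n) (r n) = 0"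
      using idx by (simp add: bil_bivector del: atLeastAtMost_iff One_nat_def)
    ultimately show "D \<subseteq> {X. bil X (q n) (r n) = 0}" using Dcases[of _ "\<lambda>X. bil X (q n) (r n) = 0"] by blast
  qed
  ultimately have "bil Hn (q n) (r n) = 0" by blast
  then show False using bil_basis(5)[OF idx(2,2,2,2)] by (simp add: Hn bil_simps)
qed

end

theorem theorem3p2:
  fixes n :: nat
    and ix :: "nat \<Rightarrow> 'm::finite"
    and \<epsilon> :: "nat \<Rightarrow> complex^'m^'m \<Rightarrow> complex"
    and \<omega> :: "complex^'m^'m \<Rightarrow> complex^'m^'m \<Rightarrow> complex"
  assumes "4 \<le> n" and "even n"
    and "bij_betw ix {1..2 * n} UNIV"
    and "dual_cartan_basis n ix \<epsilon>"
    and "closed_two_form_on (s_algebra n ix) \<omega>"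
    and "\<And>X Y. X \<in> s_algebra n ix \<inter> real_form so_complex (tau n ix) \<Longrightarrow>
           Y \<in> s_algebra n ix \<inter> real_form so_complex (tau n ix) \<Longrightarrow>
           \<omega> X Y = \<i> * (\<Sum>j = 1..n div 2 - 1. wedge (\<epsilon> (2*j-1)) (\<epsilon> (2*j)) X Y)"
  shows "admissible_pair so_complex (tau n ix) (s_algebra n ix) \<omega> \<and>
    (\<exists>J. invariant_gcs (SO0 n ix) J \<and>
         holomorphic_at_identity so_complex (SO0 n ix) J = L_space so_complex (s_algebra n ix) \<omega> \<and>
         \<not> regular_gcs so_complex (tau n ix) (SO0 n ix) J)"
proof -
  interpret so_coordinates n ix
    using assms(1,3) by unfold_locales
  have adm: "admissible_pair so_complex (tau n ix) (s_algebra n ix) \<omega>"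
    unfolding admissible_pair_def
  proof (intro conjI ballI impI)
    fix X
    assume "X \<in> real_form so_complex (tau n ix) \<inter> s_algebra n ix"
      and "\<forall>Y \<in> real_form so_complex (tau n ix) \<inter> s_algebra n ix. Im (\<omega> X Y) = 0"
    then show "X = 0"
      using nondegenerate[OF assms(2,4,6), of X] by (simp add: Int_commute)
  qed (use s_subset_so complex_subalgebra_s assms(5) s_plus_tau_s in auto)
  interpret A: admissible_matrix_group "SO0 n ix" so_complex "tau n ix" "s_algebra n ix" \<omega>
    by unfold_locales
      (use one_in_SO0 SO0_orthogonal so_subspace so_commutator tau_so adm in
        \<open>auto simp: complex_subalgebra_def tau_add tau_cscale tau_tau tau_commutator
          tangent_space_SO0\<close>)
  have "\<not> regular_gcs so_complex (tau n ix) (SO0 n ix) A.Jfield"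
    unfolding regular_gcs_def A.associated_subalgebra_Jfield
    using no_normalizing_cartan_subalgebra by blast
  then show ?thesis
    using adm A.invariant_gcs_Jfield A.holomorphic_at_identity_Jfield by blast
qed

end
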